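(* Let $(M,g,S(TM))$ be a locally screen quasi-conformal null hypersurface, with quasi-conformal pair $(\varphi,\psi)$, $\psi\not\equiv 0$, of a semi-Riemannian manifold $(\bar M,\bar g)$. Then the screen distribution $S(TM)$ is integrable. Moreover, $M$ is totally umbilical in $\bar M$ if and only if each leaf $M'$ of $S(TM)$ is a totally umbilical codimension $2$ non-degenerate submanifold of $\bar M$.
   Context: Setting: $(\bar M^{n+2},\bar g)$ is a semi-Riemannian manifold of constant index $q\in\{1,\dots,n+1\}$ with Levi-Civita connection $\bar\nabla$. A hypersurface $M\subset\bar M$ with induced (degenerate) metric $g$ is null if $\mathrm{Rad}(TM)=TM\cap TM^\perp$ is nonzero at each point (then it has rank $1$ and equals $TM^\perp$). A screen distribution $S(TM)$ is a non-degenerate subbundle of $TM$ complementary to $TM^\perp$, so $TM=S(TM)\oplus_{\mathrm{orth}}\mathrm{Rad}(TM)$; $P:\Gamma(TM)\to\Gamma(S(TM))$ is the associated projection. For a nowhere zero local section $\xi$ of $TM^\perp$ there is a unique vector field $N$ along $M$ with $\bar g(\xi,N)=1$, $\bar g(N,N)=0$, $\bar g(N,X)=0$ for all $X\in\Gamma(S(TM))$. One works on a domain where such $\xi,N$ are fixed. Gauss-Weingarten formulas, for $X,Y\in\Gamma(TM)$: $\bar\nabla_XY=\nabla_XY+B(X,Y)N$, $\ \bar\nabla_XN=-A_NX+\tau(X)N$, $\ \nabla_XPY=\nabla^*_XPY+C(X,PY)\xi$, $\ \nabla_X\xi=-A^*_\xi X-\tau(X)\xi$, where $\nabla_XY\in\Gamma(TM)$,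 $\nabla^*_XPY,\ A_NX,\ A^*_\xi X\in\Gamma(S(TM))$ and $\tau(X)=\bar g(\bar\nabla_XN,\xi)$. Thus $B(X,Y)=g(A^*_\xi X,Y)$ and $C(X,PY)=g(A_NX,PY)$. $(M,g,S(TM))$ is locally screen quasi-conformal with quasi-conformal pair $(\varphi,\psi)$ if $A_N=\varphi A^*_\xi+\psi P$ on $\Gamma(TM)$ for (smooth) functions $\varphi,\psi$ on the domain considered. $M$ is totally umbilical in $\bar M$ if $B(X,Y)=\beta\, g(X,Y)$ for all $X,Y\in\Gamma(TM)$ for some function $\beta$. A non-degenerate submanifold $M'$ is totally umbilical if its second fundamental form satisfies $h'(X,Y)=g(X,Y)H$ for some normal vector field $H$. *)

theory Defs
  imports "HOL-Analysis.Analysis"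
begin

section \<open>Smooth manifolds\<close>

fun Ck_on :: "nat \<Rightarrow> ('a::euclidean_space \<Rightarrow> 'b::real_normed_vector) \<Rightarrow> 'a set \<Rightarrow> bool" where
  "Ck_on 0 f S \<longleftrightarrow> continuous_on S f"
| "Ck_on (Suc k) f S \<longleftrightarrow>
     f differentiable_on S \<and> (\<forall>v. Ck_on k (\<lambda>x. frechet_derivative f (at x) v) S)"

text \<open>The recursion uses the derivative \<open>at x\<close>, so \<open>smooth_on\<close> is only meant for open sets.\<close>

definition smooth_on :: "'a::euclidean_space set \<Rightarrow> ('a \<Rightarrow> 'b::real_normed_vector) \<Rightarrow> bool" where
  "smooth_on S f \<longleftrightarrow> (\<forall>k. Ck_on k f S)"

type_synonym ('m, 'e) chart = "'m set \<times> ('m \<Rightarrow> 'e)"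

definition chart_inv :: "('m, 'e) chart \<Rightarrow> 'e \<Rightarrow> 'm" where
  "chart_inv c = inv_into (fst c) (snd c)"

definition is_chart :: "('m::topological_space, 'e::euclidean_space) chart \<Rightarrow> bool" where
  "is_chart c \<longleftrightarrow> open (fst c) \<and> open (snd c ` fst c) \<and>
     homeomorphism (fst c) (snd c ` fst c) (snd c) (chart_inv c)"

definition compatible :: "('m::topological_space, 'e::euclidean_space) chart \<Rightarrow> ('m, 'e) chart \<Rightarrow> bool" where
  "compatible c d \<longleftrightarrow>
     smooth_on (snd c ` (fst c \<inter> fst d)) (snd d \<circ> chart_inv c) \<and>
     smooth_on (snd d ` (fst c \<inter> fst d)) (snd c \<circ> chart_inv d)"

definition smooth_atlas :: "('m::topological_space, 'e::euclidean_space) chart set \<Rightarrow> bool" where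
  "smooth_atlas A \<longleftrightarrow> (\<forall>c\<in>A. is_chart c) \<and> (\<Union>c\<in>A. fst c) = UNIV \<and>
     (\<forall>c\<in>A. \<forall>d\<in>A. compatible c d)"

text \<open>
  The whole type \<open>'m\<close> is the manifold. A tangent vector at \<open>p\<close> is represented by its components,
  an element of the model space \<open>'e\<close>, in one chart \<open>chart_at A p\<close> selected once and for all; thus
  the tangent space of the manifold at any point is the type \<open>'e\<close>, and \<open>tcoord A c p v\<close>
  are the components, in the chart \<open>c\<close>, of the vector represented by \<open>v\<close>. Vector fields are
  functions \<open>'m \<Rightarrow> 'e\<close>; because the selected chart may jump from point to point, their smoothness
  and derivatives are always expressed through \<open>field_rep\<close>, the components in one fixed chart.
\<close>

definition chart_at :: "('m, 'e) chart set \<Rightarrow> 'm \<Rightarrow> ('m, 'e) chart" where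
  "chart_at A p = (SOME c. c \<in> A \<and> p \<in> fst c)"

definition tcoord :: "('m, 'e::euclidean_space) chart set \<Rightarrow> ('m, 'e) chart \<Rightarrow> 'm \<Rightarrow> 'e \<Rightarrow> 'e" where
  "tcoord A c p v =
     frechet_derivative (snd c \<circ> chart_inv (chart_at A p)) (at (snd (chart_at A p) p)) v"

definition field_rep ::
    "('m, 'e::euclidean_space) chart set \<Rightarrow> ('m, 'e) chart \<Rightarrow> ('m \<Rightarrow> 'e) \<Rightarrow> 'e \<Rightarrow> 'e" where
  "field_rep A c X = (\<lambda>x. tcoord A c (chart_inv c x) (X (chart_inv c x)))"

definition smooth_fun :: "('m, 'e::euclidean_space) chart set \<Rightarrow> 'm set \<Rightarrow> ('m \<Rightarrow> real) \<Rightarrow> bool" where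
  "smooth_fun A W f \<longleftrightarrow> (\<forall>c\<in>A. smooth_on (snd c ` (W \<inter> fst c)) (f \<circ> chart_inv c))"

definition smooth_field :: "('m, 'e::euclidean_space) chart set \<Rightarrow> 'm set \<Rightarrow> ('m \<Rightarrow> 'e) \<Rightarrow> bool" where
  "smooth_field A W X \<longleftrightarrow> (\<forall>c\<in>A. smooth_on (snd c ` (W \<inter> fst c)) (field_rep A c X))"

definition vec_deriv ::
    "('m, 'e::euclidean_space) chart set \<Rightarrow> 'm \<Rightarrow> 'e \<Rightarrow> ('m \<Rightarrow> real) \<Rightarrow> real" where
  "vec_deriv A p v f =
     frechet_derivative (f \<circ> chart_inv (chart_at A p)) (at (snd (chart_at A p) p)) v"

text \<open>The components of \<open>[X, Y]\<close> at \<open>p\<close> in the selected chart are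
  \<open>(X\<^sup>i \<partial>\<^sub>i Y\<^sup>j - Y\<^sup>i \<partial>\<^sub>i X\<^sup>j)(p)\<close>.\<close>

definition lie_bracket ::
    "('m, 'e::euclidean_space) chart set \<Rightarrow> ('m \<Rightarrow> 'e) \<Rightarrow> ('m \<Rightarrow> 'e) \<Rightarrow> 'm \<Rightarrow> 'e" where
  "lie_bracket A X Y p =
     (let c = chart_at A p; x = snd c p in
       frechet_derivative (field_rep A c Y) (at x) (X p) -
       frechet_derivative (field_rep A c X) (at x) (Y p))"


section \<open>Semi-Riemannian metrics and the Levi-Civita connection\<close>

definition nondegenerate_on :: "('e::real_vector \<Rightarrow> 'e \<Rightarrow> real) \<Rightarrow> 'e set \<Rightarrow> bool" where
  "nondegenerate_on b V \<longleftrightarrow> (\<forall>v\<in>V. (\<forall>w\<in>V. b v w = 0) \<longrightarrow> v = 0)"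

definition has_index :: "('e::euclidean_space \<Rightarrow> 'e \<Rightarrow> real) \<Rightarrow> nat \<Rightarrow> bool" where
  "has_index b q \<longleftrightarrow>
     (\<exists>V. subspace V \<and> dim V = q \<and> (\<forall>v\<in>V. v \<noteq> 0 \<longrightarrow> b v v < 0)) \<and>
     (\<forall>V. subspace V \<and> (\<forall>v\<in>V. v \<noteq> 0 \<longrightarrow> b v v < 0) \<longrightarrow> dim V \<le> q)"

definition semi_riemannian_metric ::
    "('m::topological_space, 'e::euclidean_space) chart set \<Rightarrow> ('m \<Rightarrow> 'e \<Rightarrow> 'e \<Rightarrow> real) \<Rightarrow> nat \<Rightarrow> bool" where
  "semi_riemannian_metric A g q \<longleftrightarrow>
     (\<forall>p. bilinear (g p) \<and> (\<forall>v w. g p v w = g p w v) \<and>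
          nondegenerate_on (g p) UNIV \<and> has_index (g p) q) \<and>
     (\<forall>W X Y. open W \<and> smooth_field A W X \<and> smooth_field A W Y \<longrightarrow>
          smooth_fun A W (\<lambda>p. g p (X p) (Y p)))"

text \<open>
  \<open>D p v Y\<close> is the covariant derivative of \<open>Y\<close> at \<open>p\<close> in the direction \<open>v\<close>, required to be
  meaningful for every \<open>Y\<close> smooth on some open neighbourhood of \<open>p\<close>. The axioms are the usual ones
  (linearity, Leibniz rule, smoothness, vanishing torsion, compatibility with the metric) for
  vector fields over open sets, the first one being compatibility with restriction.
\<close>

definition levi_civita ::
    "('m::topological_space, 'e::euclidean_space) chart set \<Rightarrow> ('m \<Rightarrow> 'e \<Rightarrow> 'e \<Rightarrow> real) \<Rightarrow>
     ('m \<Rightarrow> 'e \<Rightarrow> ('m \<Rightarrow> 'e) \<Rightarrow> 'e) \<Rightarrow> bool" where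
  "levi_civita A g D \<longleftrightarrow>
     (\<forall>W X Y. open W \<and> smooth_field A W X \<and> smooth_field A W Y \<longrightarrow>
        (\<forall>p\<in>W. \<forall>v. (\<forall>q\<in>W. X q = Y q) \<longrightarrow> D p v X = D p v Y) \<and>
        (\<forall>p\<in>W. linear (\<lambda>v. D p v Y)) \<and>
        (\<forall>p\<in>W. \<forall>v. D p v (\<lambda>q. X q + Y q) = D p v X + D p v Y) \<and>
        (\<forall>f. smooth_fun A W f \<longrightarrow>
          (\<forall>p\<in>W. \<forall>v. D p v (\<lambda>q. f q *\<^sub>R Y q) = vec_deriv A p v f *\<^sub>R Y p + f p *\<^sub>R D p v Y)) \<and>
        smooth_field A W (\<lambda>p. D p (X p) Y) \<and>
        (\<forall>p\<in>W. D p (X p) Y - D p (Y p) X = lie_bracket A X Y p) \<and>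
        (\<forall>p\<in>W. \<forall>v. vec_deriv A p v (\<lambda>q. g q (X q) (Y q)) =
                    g p (D p v X) (Y p) + g p (X p) (D p v Y)))"


section \<open>Submanifolds\<close>

definition submanifold ::
    "('m::topological_space, 'e::euclidean_space) chart set \<Rightarrow> nat \<Rightarrow> 'm set \<Rightarrow> bool" where
  "submanifold A k K \<longleftrightarrow>
     (\<forall>p\<in>K. \<exists>c V. is_chart c \<and> (\<forall>d\<in>A. compatible c d) \<and> p \<in> fst c \<and>
        subspace V \<and> dim V = k \<and> snd c ` (fst c \<inter> K) = snd c ` fst c \<inter> V)"

text \<open>Velocities at \<open>p\<close> of smooth curves in \<open>K\<close>.\<close>

definition tangent_space ::
    "('m, 'e::euclidean_space) chart set \<Rightarrow> 'm set \<Rightarrow> 'm \<Rightarrow> 'e set" where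
  "tangent_space A K p =
     {v. \<exists>\<gamma> :: real \<Rightarrow> 'm. \<exists>e>0. \<gamma> 0 = p \<and>
           \<gamma> ` {-e<..<e} \<subseteq> K \<inter> fst (chart_at A p) \<and>
           smooth_on {-e<..<e} (snd (chart_at A p) \<circ> \<gamma>) \<and>
           ((snd (chart_at A p) \<circ> \<gamma>) has_vector_derivative v) (at 0)}"

definition normal_space ::
    "('m, 'e::euclidean_space) chart set \<Rightarrow> ('m \<Rightarrow> 'e \<Rightarrow> 'e \<Rightarrow> real) \<Rightarrow> 'm set \<Rightarrow> 'm \<Rightarrow> 'e set" where
  "normal_space A g K p = {v. \<forall>w\<in>tangent_space A K p. g p v w = 0}"

definition smooth_fun_along ::
    "('m::topological_space, 'e::euclidean_space) chart set \<Rightarrow> 'm set \<Rightarrow> ('m \<Rightarrow> real) \<Rightarrow> bool" where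
  "smooth_fun_along A K f \<longleftrightarrow>
     (\<forall>p\<in>K. \<exists>W F. open W \<and> p \<in> W \<and> smooth_fun A W F \<and> (\<forall>q\<in>K \<inter> W. F q = f q))"

definition field_extension ::
    "('m::topological_space, 'e::euclidean_space) chart set \<Rightarrow> 'm set \<Rightarrow> ('m \<Rightarrow> 'e) \<Rightarrow> 'm \<Rightarrow> ('m \<Rightarrow> 'e) \<Rightarrow> bool" where
  "field_extension A K Y p Z \<longleftrightarrow>
     (\<exists>W. open W \<and> p \<in> W \<and> smooth_field A W Z \<and> (\<forall>q\<in>K \<inter> W. Z q = Y q))"

text \<open>Sections of the ambient tangent bundle restricted to \<open>K\<close>, not necessarily tangent to \<open>K\<close>.\<close>

definition smooth_field_along ::
    "('m::topological_space, 'e::euclidean_space) chart set \<Rightarrow> 'm set \<Rightarrow> ('m \<Rightarrow> 'e) \<Rightarrow> bool" where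
  "smooth_field_along A K Y \<longleftrightarrow> (\<forall>p\<in>K. \<exists>Z. field_extension A K Y p Z)"

definition smooth_tangent_field ::
    "('m::topological_space, 'e::euclidean_space) chart set \<Rightarrow> 'm set \<Rightarrow> ('m \<Rightarrow> 'e) \<Rightarrow> bool" where
  "smooth_tangent_field A K Y \<longleftrightarrow>
     smooth_field_along A K Y \<and> (\<forall>p\<in>K. Y p \<in> tangent_space A K p)"

text \<open>Covariant derivative of a field along \<open>K\<close>; it does not depend on the chosen extension when
  \<open>v\<close> is tangent to the submanifold \<open>K\<close>, and is only used for such \<open>v\<close>.\<close>

definition cov_along ::
    "('m::topological_space, 'e::euclidean_space) chart set \<Rightarrow> ('m \<Rightarrow> 'e \<Rightarrow> ('m \<Rightarrow> 'e) \<Rightarrow> 'e) \<Rightarrow>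
     'm set \<Rightarrow> 'm \<Rightarrow> 'e \<Rightarrow> ('m \<Rightarrow> 'e) \<Rightarrow> 'e" where
  "cov_along A D K p v Y = D p v (SOME Z. field_extension A K Y p Z)"

definition nondegenerate_submanifold ::
    "('m::topological_space, 'e::euclidean_space) chart set \<Rightarrow> ('m \<Rightarrow> 'e \<Rightarrow> 'e \<Rightarrow> real) \<Rightarrow> nat \<Rightarrow> 'm set \<Rightarrow> bool" where
  "nondegenerate_submanifold A g k K \<longleftrightarrow>
     submanifold A k K \<and> (\<forall>p\<in>K. nondegenerate_on (g p) (tangent_space A K p))"

text \<open>\<open>h'(X, Y)\<close>: the normal component of the ambient covariant derivative.\<close>

definition second_fundamental_form ::
    "('m::topological_space, 'e::euclidean_space) chart set \<Rightarrow> ('m \<Rightarrow> 'e \<Rightarrow> 'e \<Rightarrow> real) \<Rightarrow>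
     ('m \<Rightarrow> 'e \<Rightarrow> ('m \<Rightarrow> 'e) \<Rightarrow> 'e) \<Rightarrow> 'm set \<Rightarrow> ('m \<Rightarrow> 'e) \<Rightarrow> ('m \<Rightarrow> 'e) \<Rightarrow> 'm \<Rightarrow> 'e" where
  "second_fundamental_form A g D K X Y p =
     (THE w. w \<in> normal_space A g K p \<and>
             cov_along A D K p (X p) Y - w \<in> tangent_space A K p)"

definition umbilical_with ::
    "('m::topological_space, 'e::euclidean_space) chart set \<Rightarrow> ('m \<Rightarrow> 'e \<Rightarrow> 'e \<Rightarrow> real) \<Rightarrow>
     ('m \<Rightarrow> 'e \<Rightarrow> ('m \<Rightarrow> 'e) \<Rightarrow> 'e) \<Rightarrow> 'm set \<Rightarrow> ('m \<Rightarrow> 'e) \<Rightarrow> bool" where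
  "umbilical_with A g D K H \<longleftrightarrow>
     smooth_field_along A K H \<and> (\<forall>p\<in>K. H p \<in> normal_space A g K p) \<and>
     (\<forall>X Y. smooth_tangent_field A K X \<and> smooth_tangent_field A K Y \<longrightarrow>
        (\<forall>p\<in>K. second_fundamental_form A g D K X Y p = g p (X p) (Y p) *\<^sub>R H p))"


section \<open>Distributions, integral manifolds and leaves\<close>

definition smooth_distribution ::
    "('m::topological_space, 'e::euclidean_space) chart set \<Rightarrow> 'm set \<Rightarrow> nat \<Rightarrow> ('m \<Rightarrow> 'e set) \<Rightarrow> bool" where
  "smooth_distribution A M k S \<longleftrightarrow>
     (\<forall>p\<in>M. S p \<subseteq> tangent_space A M p) \<and>
     (\<forall>p\<in>M. \<exists>W E. open W \<and> p \<in> W \<and> (\<forall>i<k. smooth_field_along A (M \<inter> W) (E i)) \<and>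
        (\<forall>q\<in>M \<inter> W. S q = span ((\<lambda>i::nat. E i q) ` {..<k}) \<and> dim (S q) = k))"

definition integral_manifold ::
    "('m::topological_space, 'e::euclidean_space) chart set \<Rightarrow> 'm set \<Rightarrow> nat \<Rightarrow> ('m \<Rightarrow> 'e set) \<Rightarrow> 'm set \<Rightarrow> bool" where
  "integral_manifold A M k S P \<longleftrightarrow>
     P \<subseteq> M \<and> P \<noteq> {} \<and> connected P \<and> submanifold A k P \<and> (\<forall>p\<in>P. tangent_space A P p = S p)"

definition integrable_distribution ::
    "('m::topological_space, 'e::euclidean_space) chart set \<Rightarrow> 'm set \<Rightarrow> nat \<Rightarrow> ('m \<Rightarrow> 'e set) \<Rightarrow> bool" where
  "integrable_distribution A M k S \<longleftrightarrow> (\<forall>p\<in>M. \<exists>P. integral_manifold A M k S P \<and> p \<in> P)"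

text \<open>
  Submanifolds above are embedded, whereas a leaf (maximal connected integral manifold) is in
  general only immersed. The leaf through \<open>p\<close> consists of the points that can be
  reached from \<open>p\<close> through a finite chain of successively intersecting embedded connected integral
  manifolds. The embedded integral manifolds contained in a leaf \<open>L\<close> are open in
  the manifold topology of \<open>L\<close> and cover it, so local properties of the immersed submanifold \<open>L\<close>
  are stated on them.
\<close>

definition leaf ::
    "('m::topological_space, 'e::euclidean_space) chart set \<Rightarrow> 'm set \<Rightarrow> nat \<Rightarrow> ('m \<Rightarrow> 'e set) \<Rightarrow> 'm set \<Rightarrow> bool" where
  "leaf A M k S L \<longleftrightarrow>
     (\<exists>p\<in>M. L = {q. (p, q) \<in> {(a, b). \<exists>P. integral_manifold A M k S P \<and> a \<in> P \<and> b \<in> P}\<^sup>*})"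

definition totally_umbilical_leaf ::
    "('m::topological_space, 'e::euclidean_space) chart set \<Rightarrow> ('m \<Rightarrow> 'e \<Rightarrow> 'e \<Rightarrow> real) \<Rightarrow>
     ('m \<Rightarrow> 'e \<Rightarrow> ('m \<Rightarrow> 'e) \<Rightarrow> 'e) \<Rightarrow> 'm set \<Rightarrow> nat \<Rightarrow> ('m \<Rightarrow> 'e set) \<Rightarrow> 'm set \<Rightarrow> bool" where
  "totally_umbilical_leaf A g D M k S L \<longleftrightarrow>
     L = \<Union>{P. integral_manifold A M k S P \<and> P \<subseteq> L} \<and>
     (\<exists>H. \<forall>P. integral_manifold A M k S P \<and> P \<subseteq> L \<longrightarrow>
        nondegenerate_submanifold A g k P \<and> umbilical_with A g D P H)"


section \<open>Null hypersurfaces\<close>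

definition null_hypersurface ::
    "('m::topological_space, 'e::euclidean_space) chart set \<Rightarrow> ('m \<Rightarrow> 'e \<Rightarrow> 'e \<Rightarrow> real) \<Rightarrow> 'm set \<Rightarrow> bool" where
  "null_hypersurface A g M \<longleftrightarrow> submanifold A (DIM('e) - 1) M \<and>
     (\<forall>p\<in>M. tangent_space A M p \<inter> normal_space A g M p \<noteq> {0})"

definition screen_distribution ::
    "('m::topological_space, 'e::euclidean_space) chart set \<Rightarrow> ('m \<Rightarrow> 'e \<Rightarrow> 'e \<Rightarrow> real) \<Rightarrow>
     'm set \<Rightarrow> ('m \<Rightarrow> 'e set) \<Rightarrow> bool" where
  "screen_distribution A g M S \<longleftrightarrow> smooth_distribution A M (DIM('e) - 2) S \<and>
     (\<forall>p\<in>M. nondegenerate_on (g p) (S p) \<and> S p \<inter> normal_space A g M p = {0} \<and>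
        {s + r | s r. s \<in> S p \<and> r \<in> normal_space A g M p} = tangent_space A M p)"

definition screen_proj ::
    "('m, 'e::euclidean_space) chart set \<Rightarrow> ('m \<Rightarrow> 'e \<Rightarrow> 'e \<Rightarrow> real) \<Rightarrow>
     'm set \<Rightarrow> ('m \<Rightarrow> 'e set) \<Rightarrow> 'm \<Rightarrow> 'e \<Rightarrow> 'e" where
  "screen_proj A g M S p X = (THE s. s \<in> S p \<and> X - s \<in> normal_space A g M p)"

definition null_pair ::
    "('m::topological_space, 'e::euclidean_space) chart set \<Rightarrow> ('m \<Rightarrow> 'e \<Rightarrow> 'e \<Rightarrow> real) \<Rightarrow>
     'm set \<Rightarrow> ('m \<Rightarrow> 'e set) \<Rightarrow> 'm set \<Rightarrow> ('m \<Rightarrow> 'e) \<Rightarrow> ('m \<Rightarrow> 'e) \<Rightarrow> bool" where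
  "null_pair A g M S U \<xi> N \<longleftrightarrow>
     openin (top_of_set M) U \<and> smooth_field_along A U \<xi> \<and> smooth_field_along A U N \<and>
     (\<forall>p\<in>U. \<xi> p \<in> normal_space A g M p \<and> \<xi> p \<noteq> 0 \<and>
        g p (\<xi> p) (N p) = 1 \<and> g p (N p) (N p) = 0 \<and> (\<forall>X\<in>S p. g p (N p) X = 0))"

text \<open>
  The objects of the Gauss-Weingarten formulas on a domain \<open>U\<close>. At a point \<open>p\<close>, \<open>X\<close> is a tangent
  vector of \<open>U\<close> and \<open>Y\<close> a tangent vector field along \<open>U\<close>; \<open>gauss_B\<close> is the coefficient of \<open>N\<close> in
  the decomposition of the ambient covariant derivative along the direct sum of \<open>TM\<close> and the line
  spanned by \<open>N\<close>, and \<open>gauss_conn\<close> is the component in \<open>TM\<close>.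
\<close>

definition gauss_B ::
    "('m::topological_space, 'e::euclidean_space) chart set \<Rightarrow> ('m \<Rightarrow> 'e \<Rightarrow> ('m \<Rightarrow> 'e) \<Rightarrow> 'e) \<Rightarrow>
     'm set \<Rightarrow> ('m \<Rightarrow> 'e) \<Rightarrow> 'm \<Rightarrow> 'e \<Rightarrow> ('m \<Rightarrow> 'e) \<Rightarrow> real" where
  "gauss_B A D U N p X Y =
     (THE b. cov_along A D U p X Y - b *\<^sub>R N p \<in> tangent_space A U p)"

definition gauss_conn ::
    "('m::topological_space, 'e::euclidean_space) chart set \<Rightarrow> ('m \<Rightarrow> 'e \<Rightarrow> ('m \<Rightarrow> 'e) \<Rightarrow> 'e) \<Rightarrow>
     'm set \<Rightarrow> ('m \<Rightarrow> 'e) \<Rightarrow> 'm \<Rightarrow> 'e \<Rightarrow> ('m \<Rightarrow> 'e) \<Rightarrow> 'e" where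
  "gauss_conn A D U N p X Y = cov_along A D U p X Y - gauss_B A D U N p X Y *\<^sub>R N p"

definition weingarten_tau ::
    "('m::topological_space, 'e::euclidean_space) chart set \<Rightarrow> ('m \<Rightarrow> 'e \<Rightarrow> 'e \<Rightarrow> real) \<Rightarrow>
     ('m \<Rightarrow> 'e \<Rightarrow> ('m \<Rightarrow> 'e) \<Rightarrow> 'e) \<Rightarrow> 'm set \<Rightarrow> ('m \<Rightarrow> 'e) \<Rightarrow> ('m \<Rightarrow> 'e) \<Rightarrow> 'm \<Rightarrow> 'e \<Rightarrow> real" where
  "weingarten_tau A g D U \<xi> N p X = g p (cov_along A D U p X N) (\<xi> p)"

definition shape_N ::
    "('m::topological_space, 'e::euclidean_space) chart set \<Rightarrow> ('m \<Rightarrow> 'e \<Rightarrow> 'e \<Rightarrow> real) \<Rightarrow>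
     ('m \<Rightarrow> 'e \<Rightarrow> ('m \<Rightarrow> 'e) \<Rightarrow> 'e) \<Rightarrow> 'm set \<Rightarrow> ('m \<Rightarrow> 'e) \<Rightarrow> ('m \<Rightarrow> 'e) \<Rightarrow> 'm \<Rightarrow> 'e \<Rightarrow> 'e" where
  "shape_N A g D U \<xi> N p X =
     weingarten_tau A g D U \<xi> N p X *\<^sub>R N p - cov_along A D U p X N"

definition shape_xi ::
    "('m::topological_space, 'e::euclidean_space) chart set \<Rightarrow> ('m \<Rightarrow> 'e \<Rightarrow> 'e \<Rightarrow> real) \<Rightarrow>
     ('m \<Rightarrow> 'e \<Rightarrow> ('m \<Rightarrow> 'e) \<Rightarrow> 'e) \<Rightarrow> 'm set \<Rightarrow> ('m \<Rightarrow> 'e) \<Rightarrow> ('m \<Rightarrow> 'e) \<Rightarrow> 'm \<Rightarrow> 'e \<Rightarrow> 'e" where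
  "shape_xi A g D U \<xi> N p X =
     - gauss_conn A D U N p X \<xi> - weingarten_tau A g D U \<xi> N p X *\<^sub>R \<xi> p"

definition screen_quasi_conformal_on ::
    "('m::topological_space, 'e::euclidean_space) chart set \<Rightarrow> ('m \<Rightarrow> 'e \<Rightarrow> 'e \<Rightarrow> real) \<Rightarrow>
     ('m \<Rightarrow> 'e \<Rightarrow> ('m \<Rightarrow> 'e) \<Rightarrow> 'e) \<Rightarrow> 'm set \<Rightarrow> ('m \<Rightarrow> 'e set) \<Rightarrow> 'm set \<Rightarrow>
     ('m \<Rightarrow> 'e) \<Rightarrow> ('m \<Rightarrow> 'e) \<Rightarrow> ('m \<Rightarrow> real) \<Rightarrow> ('m \<Rightarrow> real) \<Rightarrow> bool" where
  "screen_quasi_conformal_on A g D M S U \<xi> N \<phi> \<psi> \<longleftrightarrow>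
     null_pair A g M S U \<xi> N \<and> smooth_fun_along A U \<phi> \<and> smooth_fun_along A U \<psi> \<and>
     (\<forall>p\<in>U. \<forall>X\<in>tangent_space A M p.
        shape_N A g D U \<xi> N p X =
          \<phi> p *\<^sub>R shape_xi A g D U \<xi> N p X + \<psi> p *\<^sub>R screen_proj A g M S p X)"

text \<open>
  The local form \<open>B\<close> depends on the choice of \<open>\<xi>\<close>, which need not exist on all of \<open>M\<close>, so total
  umbilicity is required on every domain carrying such a choice.
\<close>

definition totally_umbilical_null ::
    "('m::topological_space, 'e::euclidean_space) chart set \<Rightarrow> ('m \<Rightarrow> 'e \<Rightarrow> 'e \<Rightarrow> real) \<Rightarrow>
     ('m \<Rightarrow> 'e \<Rightarrow> ('m \<Rightarrow> 'e) \<Rightarrow> 'e) \<Rightarrow> 'm set \<Rightarrow> ('m \<Rightarrow> 'e set) \<Rightarrow> bool" where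
  "totally_umbilical_null A g D M S \<longleftrightarrow>
     (\<forall>U \<xi> N. null_pair A g M S U \<xi> N \<longrightarrow>
        (\<exists>\<beta>. smooth_fun_along A U \<beta> \<and>
           (\<forall>X Y. smooth_tangent_field A U X \<and> smooth_tangent_field A U Y \<longrightarrow>
              (\<forall>p\<in>U. gauss_B A D U N p (X p) Y = \<beta> p * g p (X p) (Y p)))))"

end

theory Submission
  imports Defs
begin

text \<open>
  Write \<open>B(X, Y) = -g(D\<^sub>X \<xi>, Y)\<close> and \<open>C(X, Y) = -g(D\<^sub>X N, Y)\<close>. The form \<open>B\<close> is symmetric because the
  bracket of fields tangent to \<open>M\<close> is tangent to \<open>M\<close>, so quasi-conformality, i.e. \<open>C = \<phi> B + \<psi> g\<close> on the
  screen, makes \<open>C\<close> symmetric there; since \<open>g([X, Y], N) = C(X, Y) - C(Y, X)\<close>, the screen is involutive. It has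
  codimension one in \<open>M\<close>: in a slice chart an integral manifold is the graph of a solution of a total
  differential equation \<open>du = G(y, u)\<close>, obtained by solving along rays. On an integral manifold
  \<open>h'(X, Y) = C(X, Y) \<xi> + B(X, Y) N\<close>. Hence \<open>B = \<beta> g\<close> gives \<open>h' = g \<cdot> ((\<phi> \<beta> + \<psi>) \<xi> + \<beta> N)\<close>, and conversely
  \<open>h' = g \<cdot> H\<close> gives \<open>B = g(H, \<xi>) g\<close> on the screen, which extends to \<open>TM\<close> because \<open>B(\<xi>, -) = 0\<close>.
\<close>

section \<open>Calculus of smooth maps\<close>

text \<open>Solving along rays by contraction yields a function that is merely continuous across
  rays. Its differentiability there is what integrability provides, by comparison with a first-order
  guess; smoothness follows because the right side of \<open>du = G(y, u)\<close> is as regular as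
  \<open>u\<close>. The solution must finally become a chart, since \<open>submanifold\<close> asks
  for slice charts.

  The geometric data live along \<open>M\<close> only, while \<open>D\<close> differentiates fields
  on open sets. Two facts bridge the gap: a derivative in a direction tangent to \<open>K\<close>
  depends only on values along \<open>K\<close>, and the form \<open>g(_, N)\<close> extends to an
  open set through an extension of \<open>N\<close>. The equation is thus posed on an open set, with
  integrability known at points of \<open>M\<close>.

  Umbilicity and second fundamental forms are stated for fields, whereas the argument is pointwise,
  so screen fields through every vector are carried along with the integral manifolds. If
  \<open>n = 0\<close>, the screen has no non-null vector and the coefficients are not determined;
  they are then set to zero.\<close>

lemma linear_basis_expand:
  fixes L :: "'a::euclidean_space \<Rightarrow> 'b::real_vector"
  assumes "linear L"
  shows "L v = (\<Sum>b\<in>Basis. (v \<bullet> b) *\<^sub>R L b)"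
proof -
  have "L v = L (\<Sum>b\<in>Basis. (v \<bullet> b) *\<^sub>R b)" by (simp add: euclidean_representation)
  also have "\<dots> = (\<Sum>b\<in>Basis. (v \<bullet> b) *\<^sub>R L b)"
    using assms by (simp add: linear_sum linear_scale)
  finally show ?thesis .
qed

lemma Ck_on_subset: "Ck_on k f S \<Longrightarrow> T \<subseteq> S \<Longrightarrow> Ck_on k f T"
proof (induction k arbitrary: f)
  case 0
  then show ?case by (auto intro: continuous_on_subset)
next
  case (Suc k)
  then show ?case by (auto intro: differentiable_on_subset)
qed

text \<open>\<open>Ck_on\<close> differentiates \<open>at x\<close> rather than within
  \<open>S\<close>, so equality on \<open>S\<close> passes to the derivatives because
  \<open>S\<close> is open.\<close>

lemma Ck_on_cong:
  assumes "open S" "\<And>x. x \<in> S \<Longrightarrow> f x = g x"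
  shows "Ck_on k f S \<longleftrightarrow> Ck_on k g S"
  using assms(2)
proof (induction k arbitrary: f g)
  case 0
  then show ?case by (simp cong: continuous_on_cong)
next
  case (Suc k)
  have d: "f differentiable_on S \<longleftrightarrow> g differentiable_on S"
    unfolding differentiable_on_def differentiable_def
    by (metis Suc.prems has_derivative_transform)
  have "f differentiable_on S \<Longrightarrow>
      frechet_derivative f (at x) = frechet_derivative g (at x)" if "x \<in> S" for x
  proof (rule frechet_derivative_at)
    assume "f differentiable_on S"
    then have "f differentiable at x"
      using assms(1) that by (simp add: differentiable_on_eq_differentiable_at)
    then show "(g has_derivative frechet_derivative f (at x)) (at x)"
      using frechet_derivative_works has_derivative_transform_within_open[OF _ assms(1) that] Suc.prems
      by blast
  qed
  then have "f differentiable_on S \<Longrightarrow> Ck_on k (\<lambda>x. frechet_derivative f (at x) v) S \<longleftrightarrow>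
      Ck_on k (\<lambda>x. frechet_derivative g (at x) v) S" for v
    by (intro Suc.IH) simp
  with d show ?case by auto
qed

lemma Ck_on_Suc_differentiable:
  assumes "Ck_on (Suc k) f S" "open S" "x \<in> S"
  shows "f differentiable at x"
    and "(f has_derivative frechet_derivative f (at x)) (at x)"
  using assms by (auto simp: differentiable_on_eq_differentiable_at frechet_derivative_works)

text \<open>The inductive closure proofs use this form: once the derivative is an explicit formula
  in the data and their derivatives, the induction hypothesis applies to it.\<close>

lemma Ck_on_SucI:
  assumes "open S" "\<And>x. x \<in> S \<Longrightarrow> (f has_derivative f' x) (at x)"
    and "\<And>v. Ck_on k (\<lambda>x. f' x v) S"
  shows "Ck_on (Suc k) f S"
proof -
  have eq: "frechet_derivative f (at x) = f' x" if "x \<in> S" for x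
    using assms(2)[OF that] by (metis frechet_derivative_at)
  have "f differentiable_on S"
    using assms(1,2) by (auto simp: differentiable_on_eq_differentiable_at differentiable_def)
  moreover have "Ck_on k (\<lambda>x. frechet_derivative f (at x) v) S" for v
    using assms(3)[of v] by (subst Ck_on_cong[OF assms(1)]) (simp_all add: eq)
  ultimately show ?thesis by simp
qed

lemma Ck_on_SucD: "Ck_on (Suc k) f S \<Longrightarrow> Ck_on k f S"
proof (induction k arbitrary: f)
  case 0
  then show ?case by (simp add: differentiable_imp_continuous_on)
next
  case (Suc k)
  then show ?case by (metis Ck_on.simps(2))
qed

lemma Ck_on_continuous: "Ck_on k f S \<Longrightarrow> continuous_on S f"
  by (induction k) (use Ck_on_SucD in auto)

lemma Ck_on_local:
  assumes "open S" "\<And>x. x \<in> S \<Longrightarrow> \<exists>T. open T \<and> x \<in> T \<and> Ck_on k f (T \<inter> S)"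
  shows "Ck_on k f S"
  using assms(2)
proof (induction k arbitrary: f)
  case 0
  have "isCont f x" if x: "x \<in> S" for x
  proof -
    obtain T where "open T" "x \<in> T" "continuous_on (T \<inter> S) f" using 0[OF x] by auto
    then show ?thesis using assms(1) x
      by (metis IntI continuous_on_eq_continuous_at open_Int)
  qed
  then show ?case by (simp add: continuous_at_imp_continuous_on)
next
  case (Suc k)
  have "f differentiable at x" if x: "x \<in> S" for x
  proof -
    obtain T where T: "open T" "x \<in> T" "Ck_on (Suc k) f (T \<inter> S)" using Suc.prems[OF x] by blast
    show ?thesis
      by (rule Ck_on_Suc_differentiable(1)[OF T(3)]) (use T assms(1) x in auto)
  qed
  then have "f differentiable_on S"
    by (simp add: differentiable_at_imp_differentiable_on)
  moreover have "Ck_on k (\<lambda>x. frechet_derivative f (at x) v) S" for v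
    by (rule Suc.IH) (use Suc.prems in force)
  ultimately show ?case by simp
qed

lemma Ck_on_const [simp]: "open S \<Longrightarrow> Ck_on k (\<lambda>x. c) S"
proof (induction k arbitrary: c)
  case (Suc k)
  show ?case by (rule Ck_on_SucI[where f' = "\<lambda>_ _. 0"]) (use Suc in \<open>auto intro!: derivative_eq_intros\<close>)
qed simp

lemma Ck_on_bounded_linear: "open S \<Longrightarrow> bounded_linear f \<Longrightarrow> Ck_on k f S"
proof (cases k)
  case 0
  then show "bounded_linear f \<Longrightarrow> ?thesis" by (simp add: linear_continuous_on)
next
  case (Suc j)
  then show "open S \<Longrightarrow> bounded_linear f \<Longrightarrow> ?thesis" 
    unfolding Suc by (intro Ck_on_SucI[where f' = "\<lambda>_. f"]) (auto simp: bounded_linear_imp_has_derivative)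
qed

lemma Ck_on_add:
  assumes "open S" "Ck_on k f S" "Ck_on k g S"
  shows "Ck_on k (\<lambda>x. f x + g x) S"
  using assms(2-)
proof (induction k arbitrary: f g)
  case 0
  then show ?case by (auto intro: continuous_intros)
next
  case (Suc k)
  show ?case
    by (rule Ck_on_SucI[where f' = "\<lambda>x v. frechet_derivative f (at x) v + frechet_derivative g (at x) v"])
      (use Suc.prems in \<open>auto intro!: has_derivative_add Suc.IH assms(1)
        Ck_on_Suc_differentiable(2)[OF Suc.prems(1) assms(1)] Ck_on_Suc_differentiable(2)[OF Suc.prems(2) assms(1)]\<close>)
qed

text \<open>The product rule writes the derivative as a sum of two values of the same bilinear map,
  at functions for which the induction hypothesis is available.\<close>

lemma (in bounded_bilinear) Ck_on:
  fixes f :: "'d::euclidean_space \<Rightarrow> 'a" and g :: "'d \<Rightarrow> 'b"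
  assumes "open S" "Ck_on k f S" "Ck_on k g S"
  shows "Ck_on k (\<lambda>x. prod (f x) (g x)) S"
  using assms(2-)
proof (induction k arbitrary: f g)
  case 0
  then show ?case by (auto intro: continuous_on)
next
  case (Suc k)
  show ?case
  proof (rule Ck_on_SucI[OF assms(1)])
    show "((\<lambda>x. prod (f x) (g x)) has_derivative
        (\<lambda>v. prod (f x) (frechet_derivative g (at x) v) + prod (frechet_derivative f (at x) v) (g x))) (at x)"
      if "x \<in> S" for x
      by (rule FDERIV) (rule Ck_on_Suc_differentiable(2)[OF _ assms(1) that], fact)+
    show "Ck_on k (\<lambda>x. prod (f x) (frechet_derivative g (at x) v) + prod (frechet_derivative f (at x) v) (g x)) S" for v
      by (intro Ck_on_add assms(1) Suc.IH) (use Suc.prems Suc.prems[THEN Ck_on_SucD] in auto)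
  qed
qed

lemmas Ck_on_scaleR = bounded_bilinear.Ck_on[OF bounded_bilinear_scaleR]
lemmas Ck_on_mult = bounded_bilinear.Ck_on[OF bounded_bilinear_mult]

lemma Ck_on_linear_compose:
  assumes "open S" "Ck_on k f S" "bounded_linear L"
  shows "Ck_on k (\<lambda>x. L (f x)) S"
  using assms(2)
proof (induction k arbitrary: f)
  case 0
  then show ?case using assms(3) by (auto intro: bounded_linear.continuous_on)
next
  case (Suc k)
  show ?case
  proof (rule Ck_on_SucI[OF assms(1)])
    show "((\<lambda>x. L (f x)) has_derivative (\<lambda>v. L (frechet_derivative f (at x) v))) (at x)" if "x \<in> S" for x
      by (rule bounded_linear.has_derivative[OF assms(3) Ck_on_Suc_differentiable(2)[OF Suc.prems assms(1) that]])
    show "Ck_on k (\<lambda>x. L (frechet_derivative f (at x) v)) S" for v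
      by (rule Suc.IH) (use Suc.prems in simp)
  qed
qed

lemma Ck_on_sum:
  assumes "open S" "\<And>i. i \<in> J \<Longrightarrow> Ck_on k (f i) S"
  shows "Ck_on k (\<lambda>x. \<Sum>i\<in>J. f i x) S"
  using assms(2)
  by (induction J rule: infinite_finite_induct) (auto intro!: Ck_on_add simp: assms(1))

text \<open>In the chain rule the base point and the direction of \<open>g'\<close> both move with
  \<open>x\<close>, while \<open>Ck_on\<close> speaks of fixed directions. Expanding the direction
  in \<open>Basis\<close> separates the two, and the induction hypothesis is applied to each
  \<open>\<lambda>y. ?g' y b\<close>.\<close>

lemma Ck_on_compose:
  fixes f :: "'a::euclidean_space \<Rightarrow> 'b::euclidean_space" and g :: "'b \<Rightarrow> 'c::real_normed_vector"
  assumes "open S" "open T" "f ` S \<subseteq> T" "Ck_on k f S" "Ck_on k g T"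
  shows "Ck_on k (\<lambda>x. g (f x)) S"
  using assms(4,5)
proof (induction k arbitrary: g)
  case 0
  then show ?case using assms(3) by (auto intro: continuous_on_compose2[of T g])
next
  case (Suc k)
  let ?f' = "\<lambda>x. frechet_derivative f (at x)" and ?g' = "\<lambda>y. frechet_derivative g (at y)"
  have g': "(g has_derivative ?g' y) (at y)" if "y \<in> T" for y
    by (rule Ck_on_Suc_differentiable(2)[OF Suc.prems(2) assms(2) that])
  have f': "(f has_derivative ?f' x) (at x)" if "x \<in> S" for x
    by (rule Ck_on_Suc_differentiable(2)[OF Suc.prems(1) assms(1) that])
  show ?case
  proof (rule Ck_on_SucI[OF assms(1)])
    show "((\<lambda>x. g (f x)) has_derivative (\<lambda>v. \<Sum>b\<in>Basis. (?f' x v \<bullet> b) *\<^sub>R ?g' (f x) b)) (at x)"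
      if "x \<in> S" for x
    proof -
      have "f x \<in> T" using that assms(3) by auto
      note g'[OF this]
      have "linear (?g' (f x))" using \<open>(g has_derivative _) _\<close> has_derivative_linear by blast
      then have "(\<Sum>b\<in>Basis. (w \<bullet> b) *\<^sub>R ?g' (f x) b) = ?g' (f x) w" for w
        by (simp add: linear_basis_expand[of "?g' (f x)" w])
      then show ?thesis
        using diff_chain_at[OF f'[OF that] \<open>(g has_derivative _) _\<close>] by (simp add: comp_def)
    qed
    have "Ck_on k f S" "\<And>b. Ck_on k (\<lambda>y. ?g' y b) T" "\<And>v. Ck_on k (\<lambda>x. ?f' x v) S"
      using Suc.prems Suc.prems[THEN Ck_on_SucD] by auto
    then show "Ck_on k (\<lambda>x. \<Sum>b\<in>Basis. (?f' x v \<bullet> b) *\<^sub>R ?g' (f x) b) S" for v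
      by (intro Ck_on_sum Ck_on_scaleR Ck_on_linear_compose[where L = "\<lambda>w. w \<bullet> _"]
          Suc.IH assms(1) bounded_linear_inner_left) auto
  qed
qed

lemma Ck_on_inverse: "Ck_on k inverse (- {0::real})"
proof (induction k)
  case 0
  then show ?case by (auto intro!: continuous_intros)
next
  case (Suc k)
  have o: "open (- {0::real})" by (simp add: open_Compl)
  show ?case
  proof (rule Ck_on_SucI[OF o])
    show "(inverse has_derivative (\<lambda>h. (inverse x * inverse x) * - h)) (at x)" if "x \<in> - {0}" for x :: real
      using has_derivative_inverse'[of x UNIV] that by (simp add: ac_simps)
    show "Ck_on k (\<lambda>x. (inverse x * inverse x) * - v) (- {0})" for v :: real
      by (rule Ck_on_mult[OF o Ck_on_mult[OF o Suc.IH Suc.IH] Ck_on_const[OF o]])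
  qed
qed

section \<open>Closure properties of smooth maps\<close>

lemma smooth_on_subset: "smooth_on S f \<Longrightarrow> T \<subseteq> S \<Longrightarrow> smooth_on T f"
  by (auto simp: smooth_on_def intro: Ck_on_subset)

lemma smooth_on_cong:
  "open S \<Longrightarrow> (\<And>x. x \<in> S \<Longrightarrow> f x = g x) \<Longrightarrow> smooth_on S f \<longleftrightarrow> smooth_on S g"
  unfolding smooth_on_def using Ck_on_cong by metis

lemma smooth_on_local:
  assumes "open S" "\<And>x. x \<in> S \<Longrightarrow> \<exists>T. open T \<and> x \<in> T \<and> smooth_on (T \<inter> S) f"
  shows "smooth_on S f"
  unfolding smooth_on_def by (intro allI Ck_on_local[OF assms(1)]) (use assms(2) in \<open>auto simp: smooth_on_def\<close>)

lemma smooth_on_const [simp]: "open S \<Longrightarrow> smooth_on S (\<lambda>x. c)"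
  by (simp add: smooth_on_def)

lemma smooth_on_bounded_linear: "open S \<Longrightarrow> bounded_linear f \<Longrightarrow> smooth_on S f"
  by (simp add: smooth_on_def Ck_on_bounded_linear)

lemma smooth_on_linear:
  fixes f :: "'a::euclidean_space \<Rightarrow> 'b::real_normed_vector"
  shows "open S \<Longrightarrow> linear f \<Longrightarrow> smooth_on S f"
  by (simp add: smooth_on_bounded_linear linear_conv_bounded_linear)

lemma smooth_on_add: "open S \<Longrightarrow> smooth_on S f \<Longrightarrow> smooth_on S g \<Longrightarrow> smooth_on S (\<lambda>x. f x + g x)"
  by (simp add: smooth_on_def Ck_on_add)

lemma smooth_on_scaleR: "open S \<Longrightarrow> smooth_on S f \<Longrightarrow> smooth_on S g \<Longrightarrow> smooth_on S (\<lambda>x. f x *\<^sub>R g x)"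
  by (simp add: smooth_on_def Ck_on_scaleR)

lemma smooth_on_mult:
  fixes f g :: "'a::euclidean_space \<Rightarrow> real"
  shows "open S \<Longrightarrow> smooth_on S f \<Longrightarrow> smooth_on S g \<Longrightarrow> smooth_on S (\<lambda>x. f x * g x)"
  by (simp add: smooth_on_def Ck_on_mult)

lemma smooth_on_linear_compose:
  "open S \<Longrightarrow> smooth_on S f \<Longrightarrow> bounded_linear L \<Longrightarrow> smooth_on S (\<lambda>x. L (f x))"
  by (simp add: smooth_on_def Ck_on_linear_compose)

lemma smooth_on_minus: "open S \<Longrightarrow> smooth_on S f \<Longrightarrow> smooth_on S (\<lambda>x. - f x)"
  by (simp add: smooth_on_linear_compose bounded_linear_minus bounded_linear_ident)

lemma smooth_on_diff: "open S \<Longrightarrow> smooth_on S f \<Longrightarrow> smooth_on S g \<Longrightarrow> smooth_on S (\<lambda>x. f x - g x)"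
  using smooth_on_add[OF _ _ smooth_on_minus] by fastforce

lemma smooth_on_sum:
  "open S \<Longrightarrow> (\<And>i. i \<in> J \<Longrightarrow> smooth_on S (f i)) \<Longrightarrow> smooth_on S (\<lambda>x. \<Sum>i\<in>J. f i x)"
  by (simp add: smooth_on_def Ck_on_sum)

lemma smooth_on_compose:
  fixes f :: "'a::euclidean_space \<Rightarrow> 'b::euclidean_space"
  shows "open S \<Longrightarrow> open T \<Longrightarrow> f ` S \<subseteq> T \<Longrightarrow> smooth_on S f \<Longrightarrow> smooth_on T g \<Longrightarrow> smooth_on S (\<lambda>x. g (f x))"
  unfolding smooth_on_def using Ck_on_compose by blast

lemma smooth_on_inverse:
  fixes f :: "'a::euclidean_space \<Rightarrow> real"
  assumes "open S" "smooth_on S f" "\<And>x. x \<in> S \<Longrightarrow> f x \<noteq> 0"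
  shows "smooth_on S (\<lambda>x. inverse (f x))"
  by (rule smooth_on_compose[where T = "- {0}"])
    (use assms in \<open>auto simp: smooth_on_def Ck_on_inverse\<close>)

lemma smooth_on_divide:
  fixes f g :: "'a::euclidean_space \<Rightarrow> real"
  assumes "open S" "smooth_on S f" "smooth_on S g" "\<And>x. x \<in> S \<Longrightarrow> g x \<noteq> 0"
  shows "smooth_on S (\<lambda>x. f x / g x)"
  unfolding divide_inverse by (intro smooth_on_mult smooth_on_inverse assms)

lemma smooth_on_continuous: "smooth_on S f \<Longrightarrow> continuous_on S f"
  unfolding smooth_on_def using Ck_on_continuous by blast

lemma smooth_on_derivative: "smooth_on S f \<Longrightarrow> smooth_on S (\<lambda>x. frechet_derivative f (at x) v)"
  unfolding smooth_on_def by (metis Ck_on.simps(2))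

lemma smooth_on_has_derivative:
  assumes "smooth_on S f" "open S" "x \<in> S"
  shows "(f has_derivative frechet_derivative f (at x)) (at x)"
  using assms Ck_on_Suc_differentiable(2)[of 0] unfolding smooth_on_def by blast

lemma smooth_on_frechet_linear:
  assumes "smooth_on S f" "open S" "x \<in> S"
  shows "linear (frechet_derivative f (at x))"
  using smooth_on_has_derivative[OF assms] has_derivative_linear by blast

text \<open>Smoothness of a family of linear maps is recorded on fixed vectors only; the basis
  expansion transfers it to a moving argument.\<close>

lemma smooth_on_linear_family:
  fixes L :: "'a::euclidean_space \<Rightarrow> 'b::euclidean_space \<Rightarrow> 'c::real_normed_vector"
  assumes "open S" "\<And>x. x \<in> S \<Longrightarrow> linear (L x)" "\<And>b. smooth_on S (\<lambda>x. L x b)" "smooth_on S f"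
  shows "smooth_on S (\<lambda>x. L x (f x))"
proof -
  have "smooth_on S (\<lambda>x. \<Sum>b\<in>Basis. (f x \<bullet> b) *\<^sub>R L x b)"
    by (intro smooth_on_sum smooth_on_scaleR smooth_on_linear_compose[where L = "\<lambda>w. w \<bullet> _"]
        assms bounded_linear_inner_left)
  then show ?thesis
    by (subst smooth_on_cong[OF assms(1)]) (use assms(2) in \<open>auto simp: linear_basis_expand[symmetric]\<close>)
qed

section \<open>Symmetry of second derivatives\<close>

lemma mixed_difference_mean_value:
  fixes f :: "'a::euclidean_space \<Rightarrow> real"
  assumes S: "open S" "smooth_on S f" and s: "0 < s"
    and mem: "\<And>a b. 0 \<le> a \<Longrightarrow> a \<le> s \<Longrightarrow> 0 \<le> b \<Longrightarrow> b \<le> s \<Longrightarrow> x + a *\<^sub>R v + b *\<^sub>R w \<in> S"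
  shows "\<exists>a b. 0 < a \<and> a < s \<and> 0 < b \<and> b < s \<and>
    f (x + s *\<^sub>R v + s *\<^sub>R w) - f (x + s *\<^sub>R v) - f (x + s *\<^sub>R w) + f x =
    s * s * frechet_derivative (\<lambda>y. frechet_derivative f (at y) v) (at (x + a *\<^sub>R v + b *\<^sub>R w)) w"
proof -
  let ?f' = "\<lambda>y. frechet_derivative f (at y)"
  have d: "((\<lambda>t. h (z + t *\<^sub>R u)) has_real_derivative frechet_derivative h (at (z + t *\<^sub>R u)) u) (at t)"
    if "smooth_on S h" "z + t *\<^sub>R u \<in> S" for h :: "'a \<Rightarrow> real" and z u t
  proof -
    note h = smooth_on_has_derivative[OF that(1) S(1) that(2)]
    have "((\<lambda>t. z + t *\<^sub>R u) has_derivative (\<lambda>t. t *\<^sub>R u)) (at t)"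
      by (auto intro!: derivative_eq_intros)
    from diff_chain_at[OF this h] show ?thesis
      using has_derivative_linear[OF h] by (simp add: has_field_derivative_def comp_def linear_scale mult.commute[of _ "frechet_derivative h (at (z + t *\<^sub>R u)) u"])
  qed
  \<comment> \<open>The mixed difference is the increment, along \<open>v\<close>, of the difference
    between \<open>f\<close> shifted by \<open>s\<close> in direction \<open>w\<close> and
    \<open>f\<close> itself. One mean value theorem in direction \<open>v\<close> and one in
    direction \<open>w\<close> produce the mixed derivative.\<close>
  have "((\<lambda>t. f ((x + s *\<^sub>R w) + t *\<^sub>R v) - f (x + t *\<^sub>R v)) has_real_derivative
      ?f' ((x + s *\<^sub>R w) + t *\<^sub>R v) v - ?f' (x + t *\<^sub>R v) v) (at t)" if "0 \<le> t" "t \<le> s" for t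
    using mem[OF that, of s] mem[OF that, of 0] s
    by (intro DERIV_diff d S(2)) (auto simp: algebra_simps)
  from MVT2[OF s this] obtain a where a: "0 < a" "a < s"
    and 1: "(f ((x + s *\<^sub>R w) + s *\<^sub>R v) - f (x + s *\<^sub>R v)) - (f (x + s *\<^sub>R w) - f x)
      = s * (?f' ((x + s *\<^sub>R w) + a *\<^sub>R v) v - ?f' (x + a *\<^sub>R v) v)"
    by auto
  have "((\<lambda>t. ?f' ((x + a *\<^sub>R v) + t *\<^sub>R w) v) has_real_derivative
      frechet_derivative (\<lambda>y. ?f' y v) (at ((x + a *\<^sub>R v) + t *\<^sub>R w)) w) (at t)" if "0 \<le> t" "t \<le> s" for t
    using mem[OF _ _ that, of a] a
    by (intro d smooth_on_derivative S(2)) (auto simp: algebra_simps)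
  from MVT2[OF s this] obtain b where b: "0 < b" "b < s"
    and 2: "?f' ((x + a *\<^sub>R v) + s *\<^sub>R w) v - ?f' (x + a *\<^sub>R v) v
      = s * frechet_derivative (\<lambda>y. ?f' y v) (at ((x + a *\<^sub>R v) + b *\<^sub>R w)) w"
    by auto
  have "(x + s *\<^sub>R w) + a *\<^sub>R v = (x + a *\<^sub>R v) + s *\<^sub>R w" "(x + s *\<^sub>R w) + s *\<^sub>R v = x + s *\<^sub>R v + s *\<^sub>R w"
    by (simp_all add: algebra_simps)
  with 1 2 have "f (x + s *\<^sub>R v + s *\<^sub>R w) - f (x + s *\<^sub>R v) - f (x + s *\<^sub>R w) + f x =
    s * s * frechet_derivative (\<lambda>y. ?f' y v) (at (x + a *\<^sub>R v + b *\<^sub>R w)) w"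
    by (simp add: algebra_simps)
  with a b show ?thesis by blast
qed

text \<open>The mixed difference is symmetric in \<open>v\<close> and \<open>w\<close>. Its two mean
  value expressions therefore coincide, at points arbitrarily close to \<open>x\<close>, and
  continuity of the second derivatives forces equality at \<open>x\<close>.\<close>

lemma second_derivative_symmetric_real:
  fixes f :: "'a::euclidean_space \<Rightarrow> real"
  assumes S: "open S" "smooth_on S f" and x: "x \<in> S"
  shows "frechet_derivative (\<lambda>y. frechet_derivative f (at y) v) (at x) w =
         frechet_derivative (\<lambda>y. frechet_derivative f (at y) w) (at x) v"
proof (rule ccontr)
  let ?D = "\<lambda>v w y. frechet_derivative (\<lambda>y. frechet_derivative f (at y) v) (at y) w"
  assume ne: "?D v w x \<noteq> ?D w v x"
  \<comment> \<open>Half the gap: values within \<open>e\<close> of the two different second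
    derivatives cannot be equal.\<close>
  define e where "e = \<bar>?D v w x - ?D w v x\<bar> / 2"
  have e: "e > 0" using ne by (simp add: e_def)
  have "isCont (?D v w) x" for v w
    using smooth_on_continuous[OF smooth_on_derivative[OF smooth_on_derivative[OF S(2)]]] S(1) x
    by (simp add: continuous_on_eq_continuous_at)
  then obtain r1 r2 where r1: "r1 > 0" "\<And>y. dist y x < r1 \<Longrightarrow> dist (?D v w y) (?D v w x) < e"
    and r2: "r2 > 0" "\<And>y. dist y x < r2 \<Longrightarrow> dist (?D w v y) (?D w v x) < e"
    using e unfolding continuous_at_eps_delta by (metis (no_types, lifting))
  obtain r3 where r3: "r3 > 0" "ball x r3 \<subseteq> S" using S(1) x open_contains_ball by blast
  define r where "r = min r1 (min r2 r3)"
  have r: "r > 0" using r1 r2 r3 by (simp add: r_def)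
  \<comment> \<open>Keeps the whole parallelogram inside the ball of radius \<open>r\<close>; the
    \<open>+ 1\<close> makes the denominator positive and the estimate strict.\<close>
  define s where "s = r / (norm v + norm w + 1)"
  have s: "s > 0" using r by (simp add: s_def add_nonneg_pos)
  have near: "dist (x + a *\<^sub>R v + b *\<^sub>R w) x < r" if "0 \<le> a" "a \<le> s" "0 \<le> b" "b \<le> s" for a b
  proof -
    have "dist (x + a *\<^sub>R v + b *\<^sub>R w) x = norm (a *\<^sub>R v + b *\<^sub>R w)"
      by (simp add: dist_norm)
    also have "\<dots> \<le> a * norm v + b * norm w"
      by (rule norm_triangle_le) (use that in simp)
    also have "\<dots> \<le> s * norm v + s * norm w"
      by (intro add_mono mult_right_mono) (use that in auto)
    also have "\<dots> < s * (norm v + norm w + 1)" using s by (simp add: algebra_simps)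
    also have "\<dots> = r"
      using add_nonneg_pos[of "norm v + norm w" 1] by (simp add: s_def)
    finally show ?thesis .
  qed
  have mem: "x + a *\<^sub>R v + b *\<^sub>R w \<in> S" if "0 \<le> a" "a \<le> s" "0 \<le> b" "b \<le> s" for a b
    using near[OF that] r3(2) by (auto simp: r_def dist_commute)
  have mem': "x + a *\<^sub>R w + b *\<^sub>R v \<in> S" if "0 \<le> a" "a \<le> s" "0 \<le> b" "b \<le> s" for a b
    using mem[OF that(3,4,1,2)] by (simp add: algebra_simps)
  from mixed_difference_mean_value[OF S s mem] obtain a b where ab: "0 < a" "a < s" "0 < b" "b < s"
    and 1: "f (x + s *\<^sub>R v + s *\<^sub>R w) - f (x + s *\<^sub>R v) - f (x + s *\<^sub>R w) + f x =
      s * s * ?D v w (x + a *\<^sub>R v + b *\<^sub>R w)" by blast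
  from mixed_difference_mean_value[OF S s mem'] obtain a' b' where ab': "0 < a'" "a' < s" "0 < b'" "b' < s"
    and 2: "f (x + s *\<^sub>R w + s *\<^sub>R v) - f (x + s *\<^sub>R w) - f (x + s *\<^sub>R v) + f x =
      s * s * ?D w v (x + a' *\<^sub>R w + b' *\<^sub>R v)" by blast
  have comm: "x + s *\<^sub>R w + s *\<^sub>R v = x + s *\<^sub>R v + s *\<^sub>R w" "x + a' *\<^sub>R w + b' *\<^sub>R v = x + b' *\<^sub>R v + a' *\<^sub>R w"
    by (simp_all add: algebra_simps)
  have "s * s * ?D v w (x + a *\<^sub>R v + b *\<^sub>R w) = s * s * ?D w v (x + b' *\<^sub>R v + a' *\<^sub>R w)"
    using 1 2 unfolding comm by linarith
  then have eq: "?D v w (x + a *\<^sub>R v + b *\<^sub>R w) = ?D w v (x + b' *\<^sub>R v + a' *\<^sub>R w)"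
    using s by simp
  have "dist (?D v w (x + a *\<^sub>R v + b *\<^sub>R w)) (?D v w x) < e"
    by (rule r1(2)) (use near[of a b] ab in \<open>simp add: r_def\<close>)
  moreover have "dist (?D w v (x + b' *\<^sub>R v + a' *\<^sub>R w)) (?D w v x) < e"
    by (rule r2(2)) (use near[of b' a'] ab' in \<open>simp add: r_def\<close>)
  ultimately show False
    unfolding eq e_def dist_real_def by (simp add: abs_if split: if_splits)
qed

lemma frechet_derivative_inner:
  assumes "smooth_on S f" "open S" "x \<in> S"
  shows "frechet_derivative (\<lambda>y. f y \<bullet> b) (at x) v = frechet_derivative f (at x) v \<bullet> b"
  using has_derivative_inner_left[OF smooth_on_has_derivative[OF assms], of b]
  by (metis frechet_derivative_at)

text \<open>The mean value theorem needs real values, so the claim is tested against each basis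
  vector \<open>b\<close>.\<close>

lemma second_derivative_symmetric:
  fixes f :: "'a::euclidean_space \<Rightarrow> 'b::euclidean_space"
  assumes S: "open S" "smooth_on S f" and x: "x \<in> S"
  shows "frechet_derivative (\<lambda>y. frechet_derivative f (at y) v) (at x) w =
         frechet_derivative (\<lambda>y. frechet_derivative f (at y) w) (at x) v"
proof (rule euclidean_eqI)
  fix b :: 'b
  have fb: "smooth_on S (\<lambda>y. f y \<bullet> b)"
    by (rule smooth_on_linear_compose[OF S bounded_linear_inner_left])
  have "frechet_derivative (\<lambda>y. frechet_derivative f (at y) v) (at x) w \<bullet> b =
      frechet_derivative (\<lambda>y. frechet_derivative (\<lambda>z. f z \<bullet> b) (at y) v) (at x) w" for v w
  proof -
    have "frechet_derivative (\<lambda>y. frechet_derivative f (at y) v) (at x) w \<bullet> b =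
        frechet_derivative (\<lambda>y. frechet_derivative f (at y) v \<bullet> b) (at x) w"
      by (rule frechet_derivative_inner[OF smooth_on_derivative[OF S(2)] S(1) x, symmetric])
    also have "frechet_derivative (\<lambda>y. frechet_derivative f (at y) v \<bullet> b) (at x) =
        frechet_derivative (\<lambda>y. frechet_derivative (\<lambda>z. f z \<bullet> b) (at y) v) (at x)"
    proof (rule frechet_derivative_at)
      have "smooth_on S (\<lambda>y. frechet_derivative f (at y) v \<bullet> b)"
        by (rule smooth_on_linear_compose[OF S(1) smooth_on_derivative[OF S(2)] bounded_linear_inner_left])
      then show "((\<lambda>y. frechet_derivative (\<lambda>z. f z \<bullet> b) (at y) v) has_derivative
          frechet_derivative (\<lambda>y. frechet_derivative f (at y) v \<bullet> b) (at x)) (at x)"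
        by (intro has_derivative_transform_within_open[OF smooth_on_has_derivative[OF _ S(1) x] S(1) x])
          (simp_all add: frechet_derivative_inner[OF S(2,1)])
    qed
    finally show ?thesis .
  qed
  then show "frechet_derivative (\<lambda>y. frechet_derivative f (at y) v) (at x) w \<bullet> b =
      frechet_derivative (\<lambda>y. frechet_derivative f (at y) w) (at x) v \<bullet> b"
    using second_derivative_symmetric_real[OF S(1) fb x] by simp
qed

lemma Ck_on_Pair:
  assumes "open S" "Ck_on k f S" "Ck_on k g S"
  shows "Ck_on k (\<lambda>x. (f x, g x)) S"
proof -
  have "Ck_on k (\<lambda>x. (f x, 0) + (0, g x)) S"
    by (intro Ck_on_add assms(1) Ck_on_linear_compose[where L = "\<lambda>s. (s, 0)", OF assms(1,2)]
        Ck_on_linear_compose[where L = "\<lambda>s. (0, s)", OF assms(1,3)]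
        bounded_linear_Pair bounded_linear_ident bounded_linear_zero)
  then show ?thesis by simp
qed

text \<open>Each product with a vector orthogonal to \<open>V\<close> vanishes along
  \<open>f\<close>, hence on its derivative; the double orthogonal complement of \<open>V\<close> is
  \<open>V\<close>.\<close>

lemma derivative_in_subspace:
  fixes f :: "real \<Rightarrow> 'b::euclidean_space"
  assumes "subspace V" "e > 0" "\<And>t. t \<in> {-e<..<e} \<Longrightarrow> f t \<in> V" "(f has_vector_derivative v) (at 0)"
  shows "v \<in> V"
proof -
  have "v \<bullet> w = 0" if w: "w \<in> orthogonal_comp V" for w
  proof -
    have "((\<lambda>t. f t \<bullet> w) has_derivative (\<lambda>t. (t *\<^sub>R v) \<bullet> w)) (at 0)"
      by (rule has_derivative_inner_left) (use assms(4) in \<open>simp add: has_vector_derivative_def\<close>)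
    moreover have "((\<lambda>t. f t \<bullet> w) has_derivative (\<lambda>t. 0)) (at 0)"
    proof (rule has_derivative_transform_within_open[OF _ open_greaterThanLessThan[of "-e" e]])
      show "((\<lambda>t. 0) has_derivative (\<lambda>t. 0)) (at 0)" by simp
      show "0 = f t \<bullet> w" if "t \<in> {-e<..<e}" for t
        using w assms(3)[OF that] by (simp add: orthogonal_comp_def orthogonal_def)
    qed (use assms(2) in auto)
    ultimately have "(\<lambda>t. (t *\<^sub>R v) \<bullet> w) = (\<lambda>t. 0)" by (rule has_derivative_unique)
    from fun_cong[OF this, of 1] show ?thesis by simp
  qed
  then have "v \<in> orthogonal_comp (orthogonal_comp V)"
    by (simp add: orthogonal_comp_def orthogonal_def inner_commute)
  then show ?thesis by (simp add: orthogonal_comp_self[OF assms(1)])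
qed

text \<open>A product rule for evaluation: the family \<open>L\<close> is differentiated on fixed
  basis vectors, the argument through the linear map \<open>L z\<close>.\<close>

lemma family_has_derivative:
  fixes L :: "'a::real_normed_vector \<Rightarrow> 'b::euclidean_space \<Rightarrow> 'c::real_normed_vector"
  assumes B: "open B" "z \<in> B" and lin: "\<And>y. y \<in> B \<Longrightarrow> linear (L y)"
    and L: "\<And>b. ((\<lambda>y. L y b) has_derivative L' b) (at z)" and f: "(f has_derivative f') (at z)"
  shows "((\<lambda>y. L y (f y)) has_derivative (\<lambda>w. (\<Sum>b\<in>Basis. (f z \<bullet> b) *\<^sub>R L' b w) + L z (f' w))) (at z)"
proof -
  have "((\<lambda>y. \<Sum>b\<in>Basis. (f y \<bullet> b) *\<^sub>R L y b) has_derivative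
      (\<lambda>w. \<Sum>b\<in>Basis. (f z \<bullet> b) *\<^sub>R L' b w + (f' w \<bullet> b) *\<^sub>R L z b)) (at z)"
    by (intro has_derivative_sum has_derivative_scaleR has_derivative_inner_left L f)
  then have "((\<lambda>y. L y (f y)) has_derivative
      (\<lambda>w. \<Sum>b\<in>Basis. (f z \<bullet> b) *\<^sub>R L' b w + (f' w \<bullet> b) *\<^sub>R L z b)) (at z)"
    by (rule has_derivative_transform_within_open[OF _ B]) (simp add: linear_basis_expand[OF lin, symmetric])
  then show ?thesis by (simp add: sum.distrib linear_basis_expand[OF lin[OF B(2)], symmetric])
qed

section \<open>Total differential equations\<close>

lemma linear_family_bounded:
  fixes L :: "'a::topological_space \<Rightarrow> 'b::euclidean_space \<Rightarrow> 'c::real_normed_vector"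
  assumes "compact K" "\<And>z. z \<in> K \<Longrightarrow> linear (L z)" "\<And>b. continuous_on K (\<lambda>z. L z b)"
  shows "\<exists>C>0. \<forall>z\<in>K. \<forall>v. norm (L z v) \<le> C * norm v"
proof -
  have "\<exists>C. \<forall>z\<in>K. norm (L z b) \<le> C" for b
    using compact_imp_bounded[OF compact_continuous_image[OF assms(3)[of b] assms(1)]]
    by (auto simp: bounded_iff)
  then obtain C where C: "\<And>b z. z \<in> K \<Longrightarrow> norm (L z b) \<le> C b" by metis
  \<comment> \<open>The coefficient of each basis vector is at most \<open>norm v\<close>, so the
    bounds on the basis add up; the \<open>+ 1\<close> ensures a positive constant.\<close>
  define B where "B = (\<Sum>b\<in>(Basis::'b set). \<bar>C b\<bar>) + 1"
  have "norm (L z v) \<le> B * norm v" if "z \<in> K" for z v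
  proof -
    have "norm (L z v) = norm (\<Sum>b\<in>Basis. (v \<bullet> b) *\<^sub>R L z b)"
      by (simp add: linear_basis_expand[OF assms(2)[OF that], of v])
    also have "\<dots> \<le> (\<Sum>b\<in>(Basis::'b set). \<bar>C b\<bar> * norm v)"
    proof (rule sum_norm_le)
      fix b :: 'b assume b: "b \<in> Basis"
      have "norm ((v \<bullet> b) *\<^sub>R L z b) = \<bar>v \<bullet> b\<bar> * norm (L z b)" by simp
      also have "\<dots> \<le> norm v * \<bar>C b\<bar>"
        by (intro mult_mono Basis_le_norm b) (use C[OF that, of b] in auto)
      finally show "norm ((v \<bullet> b) *\<^sub>R L z b) \<le> \<bar>C b\<bar> * norm v" by (simp add: mult.commute)
    qed
    also have "\<dots> \<le> B * norm v"
      unfolding B_def by (simp add: sum_distrib_right distrib_right)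
    finally show ?thesis .
  qed
  moreover have "B > 0" unfolding B_def by (simp add: add_nonneg_pos sum_nonneg)
  ultimately show ?thesis by blast
qed

lemma smooth_on_lipschitz:
  fixes f :: "'a::euclidean_space \<Rightarrow> 'b::real_normed_vector"
  assumes "open W" "smooth_on W f" "compact K" "convex K" "K \<subseteq> W"
  shows "\<exists>C>0. \<forall>z\<in>K. \<forall>z'\<in>K. norm (f z' - f z) \<le> C * norm (z' - z)"
proof -
  let ?f' = "\<lambda>z. frechet_derivative f (at z)"
  have "\<exists>C>0. \<forall>z\<in>K. \<forall>v. norm (?f' z v) \<le> C * norm v"
    using assms(5) smooth_on_frechet_linear[OF assms(2,1)]
      smooth_on_continuous[OF smooth_on_derivative[OF assms(2)]]
    by (intro linear_family_bounded assms(3)) (auto intro: continuous_on_subset)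
  then obtain C where C: "C > 0" "\<And>z v. z \<in> K \<Longrightarrow> norm (?f' z v) \<le> C * norm v" by blast
  have "norm (f z' - f z) \<le> C * norm (z' - z)" if "z \<in> K" "z' \<in> K" for z z'
  proof (rule differentiable_bound[OF assms(4)])
    show "(f has_derivative ?f' x) (at x within K)" if "x \<in> K" for x
      using smooth_on_has_derivative[OF assms(2,1)] assms(5) that by (blast intro: has_derivative_at_withinI)
    show "onorm (?f' x) \<le> C" if "x \<in> K" for x
      by (rule onorm_le) (rule C(2)[OF that])
  qed (use that in auto)
  with C(1) show ?thesis by blast
qed

text \<open>The modulus must not depend on the base point, because the linearisation is later made
  at all points \<open>p t\<close> of a ray simultaneously. Uniform continuity of the derivative on
  the compact \<open>K\<close> gives this.\<close>

lemma smooth_on_uniformly_differentiable: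
  fixes f :: "'a::euclidean_space \<Rightarrow> 'b::real_normed_vector"
  assumes W: "open W" "smooth_on W f" "compact K" "convex K" "K \<subseteq> W" and e: "e > 0"
  shows "\<exists>d>0. \<forall>z\<in>K. \<forall>z'\<in>K. norm (z' - z) < d \<longrightarrow>
    norm (f z' - f z - frechet_derivative f (at z) (z' - z)) \<le> e * norm (z' - z)"
proof -
  let ?f' = "\<lambda>z. frechet_derivative f (at z)"
  \<comment> \<open>The dimension: the error \<open>e\<close> is shared equally among the basis
    directions.\<close>
  define n where "n = real (card (Basis::'a set))"
  have n: "n > 0" by (simp add: n_def DIM_positive)
  have "\<exists>d>0. \<forall>z\<in>K. \<forall>z'\<in>K. dist z' z < d \<longrightarrow> dist (?f' z' b) (?f' z b) < e / n" for b
    using compact_uniformly_continuous[OF continuous_on_subset[OF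
      smooth_on_continuous[OF smooth_on_derivative[OF W(2), of b]] W(5)] W(3)] e n
    unfolding uniformly_continuous_on_def by (metis divide_pos_pos)
  then obtain d where d: "\<And>b. d b > 0"
    "\<And>b z z'. z \<in> K \<Longrightarrow> z' \<in> K \<Longrightarrow> dist z' z < d b \<Longrightarrow> dist (?f' z' b) (?f' z b) < e / n"
    by metis
  define d0 where "d0 = Min (d ` (Basis::'a set))"
  have d0: "d0 > 0" "\<And>b. b \<in> Basis \<Longrightarrow> d0 \<le> d b"
    using d(1) by (auto simp: d0_def)
  have lin: "linear (?f' z)" if "z \<in> K" for z
    using smooth_on_frechet_linear[OF W(2,1)] W(5) that by blast
  have close: "norm (?f' z' v - ?f' z v) \<le> e * norm v" if "z \<in> K" "z' \<in> K" "dist z' z < d0" for z z' v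
  proof -
    have "norm (?f' z' v - ?f' z v) = norm (\<Sum>b\<in>Basis. (v \<bullet> b) *\<^sub>R (?f' z' b - ?f' z b))"
      by (simp add: linear_basis_expand[OF lin[OF that(1)], of v] linear_basis_expand[OF lin[OF that(2)], of v]
          sum_subtractf algebra_simps)
    also have "\<dots> \<le> (\<Sum>b\<in>(Basis::'a set). norm v * (e / n))"
    proof (rule sum_norm_le)
      fix b :: 'a assume b: "b \<in> Basis"
      have "norm (?f' z' b - ?f' z b) \<le> e / n"
        using d(2)[OF that(1,2), of b] d0(2)[OF b] that(3) by (simp add: dist_norm)
      then have "\<bar>v \<bullet> b\<bar> * norm (?f' z' b - ?f' z b) \<le> norm v * (e / n)"
        by (intro mult_mono Basis_le_norm b) auto
      then show "norm ((v \<bullet> b) *\<^sub>R (?f' z' b - ?f' z b)) \<le> norm v * (e / n)" by simp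
    qed
    also have "\<dots> = e * norm v" using n by (simp add: n_def)
    finally show ?thesis .
  qed
  have "norm (f z' - f z - ?f' z (z' - z)) \<le> norm (z' - z) * e"
    if z: "z \<in> K" "z' \<in> K" "norm (z' - z) < d0" for z z'
  proof (rule differentiable_bound_linearization[where S = "K \<inter> ball z d0" and f' = ?f'])
    show "z + t *\<^sub>R (z' - z) \<in> K \<inter> ball z d0" if "t \<in> {0..1}" for t
    proof
      have "(1 - t) *\<^sub>R z + t *\<^sub>R z' \<in> K" using W(4) z that by (simp add: convexD)
      then show "z + t *\<^sub>R (z' - z) \<in> K" by (simp add: algebra_simps)
      have "t * norm (z' - z) \<le> 1 * norm (z' - z)" using that by (intro mult_right_mono) auto
      then show "z + t *\<^sub>R (z' - z) \<in> ball z d0"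
        using z(3) that by (simp add: dist_norm)
    qed
    show "(f has_derivative ?f' x) (at x within K \<inter> ball z d0)" if "x \<in> K \<inter> ball z d0" for x
      using smooth_on_has_derivative[OF W(2,1)] W(5) that by (blast intro: has_derivative_at_withinI)
    show "onorm (?f' x - ?f' z) \<le> e" if "x \<in> K \<inter> ball z d0" for x
      using close[OF z(1)] that by (intro onorm_le) (auto simp: dist_commute)
    show "z \<in> K \<inter> ball z d0" using z(1) d0(1) by simp
  qed
  then show ?thesis using d0(1) by (auto simp: mult.commute)
qed

text \<open>At \<open>z = (y, u)\<close> the prescribed derivative of the unknown function in
  direction \<open>a\<close> is \<open>G z a\<close>. The assumption \<open>int\<close> equates the
  two mixed second derivatives of a would-be solution, taken along the lifted directions
  \<open>(a, G z a)\<close> and \<open>(b, G z b)\<close>.\<close>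

locale total_differential_equation =
  fixes G :: "'a::euclidean_space \<times> real \<Rightarrow> 'a \<Rightarrow> real" and W :: "('a \<times> real) set"
  assumes W: "open W" "(0, 0) \<in> W"
    and lin: "z \<in> W \<Longrightarrow> linear (G z)"
    and smooth: "smooth_on W (\<lambda>z. G z a)"
    and int: "z \<in> W \<Longrightarrow> frechet_derivative (\<lambda>z. G z b) (at z) (a, G z a) =
      frechet_derivative (\<lambda>z. G z a) (at z) (b, G z b)"
begin

text \<open>\<open>B\<close> bounds the slope and \<open>L\<close> its dependence on position. Both
  estimates are homogeneous in the direction \<open>a\<close>, so that short rays turn them into
  small constants.\<close>

lemma constants:
  obtains R B L where "R > 0" "B > 0" "L > 0" "cball 0 R \<times> cball 0 R \<subseteq> W"
    "\<And>z a. z \<in> cball 0 R \<times> cball 0 R \<Longrightarrow> \<bar>G z a\<bar> \<le> B * norm a"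
    "\<And>z z' a. z \<in> cball 0 R \<times> cball 0 R \<Longrightarrow> z' \<in> cball 0 R \<times> cball 0 R \<Longrightarrow>
       \<bar>G z' a - G z a\<bar> \<le> L * norm a * norm (z' - z)"
proof -
  obtain A1 A2 where A: "open A1" "open A2" "(0, 0) \<in> A1 \<times> A2" "A1 \<times> A2 \<subseteq> W"
    using open_prod_elim[OF W] by metis
  then obtain r1 r2 where r: "r1 > 0" "cball 0 r1 \<subseteq> A1" "r2 > 0" "cball 0 r2 \<subseteq> A2"
    by (metis SigmaE2 open_contains_cball)
  define R where "R = min r1 r2"
  let ?K = "cball (0::'a) R \<times> cball (0::real) R"
  have R: "R > 0" using r by (simp add: R_def)
  have K: "?K \<subseteq> W" using r A(4) by (fastforce simp: R_def)
  have comp: "compact ?K" "convex ?K" by (auto intro: compact_Times convex_Times)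
  obtain B where B: "B > 0" "\<And>z a. z \<in> ?K \<Longrightarrow> norm (G z a) \<le> B * norm a"
    using linear_family_bounded[OF comp(1), of G] lin K
      continuous_on_subset[OF smooth_on_continuous[OF smooth] K] by blast
  obtain C where C: "\<And>b. C b > 0"
    "\<And>b z z'. z \<in> ?K \<Longrightarrow> z' \<in> ?K \<Longrightarrow> norm (G z' b - G z b) \<le> C b * norm (z' - z)"
    using smooth_on_lipschitz[OF W(1) smooth comp K] by metis
  define L where "L = (\<Sum>b\<in>(Basis::'a set). C b)"
  have L: "L > 0" unfolding L_def by (rule sum_pos) (auto simp: C(1))
  have "\<bar>G z' a - G z a\<bar> \<le> L * norm a * norm (z' - z)" if "z \<in> ?K" "z' \<in> ?K" for z z' a
  proof -
    have "linear (G z)" "linear (G z')" using that K lin by blast+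
    then have "\<bar>G z' a - G z a\<bar> = norm (\<Sum>b\<in>Basis. (a \<bullet> b) *\<^sub>R (G z' b - G z b))"
      by (simp add: linear_basis_expand[of "G z" a] linear_basis_expand[of "G z'" a] sum_subtractf algebra_simps)
    also have "\<dots> \<le> (\<Sum>b\<in>(Basis::'a set). C b * (norm a * norm (z' - z)))"
    proof (rule sum_norm_le)
      fix b :: 'a assume "b \<in> Basis"
      then have "\<bar>a \<bullet> b\<bar> * norm (G z' b - G z b) \<le> norm a * (C b * norm (z' - z))"
        using C(2)[OF that, of b] by (intro mult_mono Basis_le_norm) auto
      then show "norm ((a \<bullet> b) *\<^sub>R (G z' b - G z b)) \<le> C b * (norm a * norm (z' - z))"
        by (simp add: mult_ac abs_mult)
    qed
    also have "\<dots> = L * norm a * norm (z' - z)"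
      by (simp add: L_def sum_distrib_right mult.assoc)
    finally show ?thesis .
  qed
  with that[OF R B(1) L K] B(2) show ?thesis by auto
qed

lemma continuous_on_G:
  assumes "continuous_on S f" "continuous_on S g" "\<And>x. x \<in> S \<Longrightarrow> f x \<in> W"
  shows "continuous_on S (\<lambda>x. G (f x) (g x))"
proof -
  have "continuous_on S (\<lambda>x. G (f x) b)" for b
    using continuous_on_compose2[OF smooth_on_continuous[OF smooth] assms(1)] assms(3) by blast
  then have "continuous_on S (\<lambda>x. \<Sum>b\<in>Basis. (g x \<bullet> b) *\<^sub>R G (f x) b)"
    by (intro continuous_intros assms(2))
  then show ?thesis
    by (rule continuous_on_eq) (use lin assms(3) linear_basis_expand in metis)
qed

text \<open>On the ray through \<open>y\<close> the equation reads
  \<open>u(y) = \<integral> G(t y, u(t y)) y dt\<close> over \<open>{0..1}\<close>. As an operator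
  on functions of \<open>y\<close> this treats all rays at once and gives continuity of
  \<open>u\<close> along with its existence. The bound on \<open>B * r\<close> confines the values
  to half the cylinder, the one on \<open>L * r\<close> makes the operator a contraction with factor
  \<open>1 / 2\<close>.\<close>

lemma ray_solution:
  assumes R: "R > 0" "B > 0" "L > 0" and K: "cball 0 R \<times> cball 0 R \<subseteq> W"
    and B: "\<And>z a. z \<in> cball 0 R \<times> cball 0 R \<Longrightarrow> \<bar>G z a\<bar> \<le> B * norm a"
    and L: "\<And>z z' a. z \<in> cball 0 R \<times> cball 0 R \<Longrightarrow> z' \<in> cball 0 R \<times> cball 0 R \<Longrightarrow>
       \<bar>G z' a - G z a\<bar> \<le> L * norm a * norm (z' - z)"
    and r: "0 < r" "r \<le> R" "B * r \<le> R / 2" "L * r \<le> 1 / 2"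
  obtains u :: "'a \<Rightarrow> real" where "continuous_on UNIV u" "u 0 = 0" "\<And>y. \<bar>u y\<bar> \<le> R / 2"
    "\<And>y t. y \<in> cball 0 r \<Longrightarrow> t \<in> {0..1} \<Longrightarrow>
      ((\<lambda>t. u (t *\<^sub>R y)) has_real_derivative G (t *\<^sub>R y, u (t *\<^sub>R y)) y) (at t within {0..1})"
proof -
  \<comment> \<open>Clamping values by \<open>\<kappa>\<close> and projecting points by
    \<open>\<rho>\<close> make the operator total on bounded continuous functions of the whole
    space, so that the fixed point theorem for that type applies. Both maps are continuous, and
    \<open>\<kappa>\<close> does not enlarge distances.\<close>
  define \<kappa> where "\<kappa> s = max (- R) (min R s)" for s :: real
  define \<rho> where "\<rho> = closest_point (cball (0::'a) r)"
  define F where "F u y t = G (t *\<^sub>R \<rho> y, \<kappa> (u (t *\<^sub>R \<rho> y))) (\<rho> y)" for u y t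
  have \<rho>: "norm (\<rho> y) \<le> r" for y
    using closest_point_in_set[of "cball (0::'a) r" y] r(1) by (simp add: \<rho>_def)
  have \<rho>_id: "\<rho> y = y" if "y \<in> cball 0 r" for y
    using that by (simp add: \<rho>_def closest_point_self)
  have \<rho>_cont: "continuous_on S \<rho>" for S
    unfolding \<rho>_def by (rule continuous_on_closest_point) (use r(1) in auto)
  have \<kappa>: "\<bar>\<kappa> s\<bar> \<le> R" for s using R(1) by (auto simp: \<kappa>_def)
  have \<kappa>_lip: "\<bar>\<kappa> s - \<kappa> s'\<bar> \<le> \<bar>s - s'\<bar>" for s s' using R(1) by (auto simp: \<kappa>_def)
  have \<kappa>_cont: "continuous_on S \<kappa>" for S unfolding \<kappa>_def by (intro continuous_intros)
  have mem: "(t *\<^sub>R \<rho> y, \<kappa> s) \<in> cball 0 R \<times> cball 0 R" if "t \<in> {0..1}" for t y s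
  proof -
    have "norm (t *\<^sub>R \<rho> y) \<le> 1 * r" unfolding norm_scaleR
      using that \<rho>[of y] r(1) by (intro mult_mono) auto
    then show ?thesis using r(2) \<kappa>[of s] by simp
  qed
  have F_cont: "continuous_on (UNIV \<times> {0..1}) (\<lambda>(y, t). F u y t)" if "continuous_on UNIV u" for u
  proof -
    have 1: "continuous_on (UNIV \<times> {0..1}) (\<lambda>x. snd x *\<^sub>R \<rho> (fst x))"
      by (intro continuous_intros continuous_on_compose2[OF \<rho>_cont[of UNIV]]) auto
    show ?thesis
      unfolding F_def case_prod_beta
      by (intro continuous_on_G continuous_on_Pair 1 continuous_on_compose2[OF \<kappa>_cont[of UNIV]]
          continuous_on_compose2[OF that] continuous_on_compose2[OF \<rho>_cont[of UNIV] continuous_on_fst[OF continuous_on_id]])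
        (use mem K in auto)
  qed
  have F_cont_t: "continuous_on {0..1} (F u y)" if "continuous_on UNIV u" for u y
    using continuous_on_compose2[OF F_cont[OF that] continuous_on_Pair[OF continuous_on_const[of _ y] continuous_on_id], of "{0..1}"]
    by auto
  have F_bound: "norm (F u y t) \<le> R / 2" if "t \<in> {0..1}" for u y t
  proof -
    have "norm (F u y t) \<le> B * norm (\<rho> y)" unfolding F_def real_norm_def by (rule B[OF mem[OF that]])
    also have "\<dots> \<le> B * r" using \<rho> R(2) by simp
    finally show ?thesis using r(3) by simp
  qed
  define T where "T u y = integral {0..1} (F u y)" for u y
  have T_bound: "norm (T u y) \<le> R / 2" if "continuous_on UNIV u" for u y
    unfolding T_def using integral_bound[OF _ F_cont_t[OF that, of y] F_bound] by simp
  have T_cont: "T u \<in> bcontfun" if "continuous_on UNIV u" for u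
  proof (rule bcontfun_normI[OF _ T_bound[OF that]])
    show "continuous_on UNIV (T u)"
      unfolding T_def using integral_continuous_on_param[of UNIV 0 "1::real" "F u"] F_cont[OF that] by simp
  qed
  define \<Phi> where "\<Phi> u = Bcontfun (T (apply_bcontfun u))" for u
  have \<Phi>: "apply_bcontfun (\<Phi> u) = T (apply_bcontfun u)" for u
    unfolding \<Phi>_def by (rule Bcontfun_inverse[OF T_cont]) simp
  have "dist (\<Phi> u) (\<Phi> v) \<le> 1 / 2 * dist u v" for u v
  proof (rule dist_bound)
    fix y
    have cont: "continuous_on UNIV (apply_bcontfun w)" for w :: "'a \<Rightarrow>\<^sub>C real" by simp
    have "norm (F u y t - F v y t) \<le> 1 / 2 * dist u v" if "t \<in> {0..1}" for t
    proof -
      have "norm (F u y t - F v y t) \<le> L * norm (\<rho> y) *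
          norm ((t *\<^sub>R \<rho> y, \<kappa> (u (t *\<^sub>R \<rho> y))) - (t *\<^sub>R \<rho> y, \<kappa> (v (t *\<^sub>R \<rho> y))))"
        unfolding F_def real_norm_def by (rule L[OF mem[OF that] mem[OF that]])
      also have "\<dots> = L * norm (\<rho> y) * \<bar>\<kappa> (u (t *\<^sub>R \<rho> y)) - \<kappa> (v (t *\<^sub>R \<rho> y))\<bar>"
        by (simp add: norm_Pair)
      also have "\<dots> \<le> (L * r) * dist u v"
        using R(3) \<rho>[of y] r(1) order_trans[OF \<kappa>_lip dist_bounded[of u _ v, unfolded dist_real_def]]
        by (intro mult_mono) auto
      also have "\<dots> \<le> 1 / 2 * dist u v" by (rule mult_right_mono[OF r(4)]) simp
      finally show ?thesis .
    qed
    then have "norm (integral {0..1} (\<lambda>t. F u y t - F v y t)) \<le> 1 / 2 * dist u v * (1 - 0)"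
      by (intro integral_bound continuous_intros F_cont_t cont) auto
    also have "integral {0..1} (\<lambda>t. F u y t - F v y t) = T u y - T v y"
      unfolding T_def by (rule integral_diff) (auto intro!: integrable_continuous_real F_cont_t)
    finally show "dist (\<Phi> u y) (\<Phi> v y) \<le> 1 / 2 * dist u v" by (simp add: \<Phi> dist_norm)
  qed
  then obtain w where "\<Phi> w = w"
    using banach_fix_type[of "1 / 2" \<Phi>] by auto
  define u where "u = apply_bcontfun w"
  have u_cont: "continuous_on UNIV u" by (simp add: u_def)
  have fixp: "T u = u" using \<Phi>[of w] \<open>\<Phi> w = w\<close> by (simp add: u_def)
  have u_bound: "\<bar>u y\<bar> \<le> R / 2" for y using T_bound[OF u_cont, of y] fixp by simp
  \<comment> \<open>The fixed point stays within the clamp, so it solves the original equation on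
    the ball.\<close>
  have \<kappa>u: "\<kappa> (u y) = u y" for y using u_bound[of y] R(1) by (auto simp: \<kappa>_def)
  have int: "u y = integral {0..1} (\<lambda>t. G (t *\<^sub>R y, u (t *\<^sub>R y)) y)" if "y \<in> cball 0 r" for y
    using fun_cong[OF fixp, of y] \<rho>_id[OF that] by (simp add: T_def F_def[abs_def] \<kappa>u)
  have ray: "((\<lambda>t. u (t *\<^sub>R y)) has_real_derivative G (t *\<^sub>R y, u (t *\<^sub>R y)) y) (at t within {0..1})"
    if y: "y \<in> cball 0 r" and t: "t \<in> {0..1}" for y t
  proof -
    define f where "f t = G (t *\<^sub>R y, u (t *\<^sub>R y)) y" for t
    define J where "J s = integral {0..s} f" for s
    have f_cont: "continuous_on {0..1} f"
      using F_cont_t[OF u_cont, of y] \<rho>_id[OF y] by (simp add: F_def[abs_def] f_def[abs_def] \<kappa>u)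
    have J': "(J has_real_derivative f s) (at s within {0..1})" if "s \<in> {0..1}" for s
      unfolding J_def by (rule integral_has_real_derivative[OF f_cont that])
    \<comment> \<open>The integral equation concerns full rays only. As \<open>G\<close> is linear
      in the direction, substituting \<open>t * s\<close> for \<open>t\<close> turns the full
      integral for the point at parameter \<open>s\<close> into the integral for \<open>y\<close> up
      to \<open>s\<close>.\<close>
    have "u (s *\<^sub>R y) = J s" if s: "s \<in> {0..1}" for s
    proof -
      have "norm (s *\<^sub>R y) \<le> 1 * norm y" unfolding norm_scaleR using s by (intro mult_right_mono) auto
      then have sy: "s *\<^sub>R y \<in> cball 0 r" using y by simp
      have scale: "G (t *\<^sub>R s *\<^sub>R y, u (t *\<^sub>R s *\<^sub>R y)) (s *\<^sub>R y) = f (t * s) * s" if "t \<in> {0..1}" for t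
      proof -
        have "t * s \<in> {0..1}" using that s by (auto simp: mult_le_one)
        then have "linear (G ((t * s) *\<^sub>R y, u ((t * s) *\<^sub>R y)))"
          using mem[of "t * s" y "u ((t * s) *\<^sub>R y)"] K
          unfolding \<rho>_id[OF y] \<kappa>u by (blast intro: lin)
        then show ?thesis by (simp add: f_def linear_scale)
      qed
      have "u (s *\<^sub>R y) = integral {0..1} (\<lambda>t. f (t * s) * s)"
        unfolding int[OF sy] by (rule integral_cong) (rule scale)
      also have "\<dots> = J (1 * s) - J (0 * s)"
      proof (rule integral_unique[OF fundamental_theorem_of_calculus])
        fix t :: real assume t: "t \<in> {0..1}"
        have ts: "t * s \<in> {0..1}" using t s by (auto simp: mult_le_one)
        have "((\<lambda>t. t * s) has_real_derivative s) (at t within {0..1})"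
          by (auto intro!: derivative_eq_intros)
        moreover have "(J has_real_derivative f (t * s)) (at (t * s) within (\<lambda>t. t * s) ` {0..1})"
          by (rule DERIV_subset[OF J'[OF ts]]) (use s in \<open>auto simp: mult_le_one\<close>)
        ultimately have "((\<lambda>t. J (t * s)) has_real_derivative f (t * s) * s) (at t within {0..1})"
          using DERIV_image_chain[of J _ "\<lambda>t. t * s"] by (simp add: comp_def)
        then show "((\<lambda>t. J (t * s)) has_vector_derivative f (t * s) * s) (at t within {0..1})"
          by (simp add: has_real_derivative_iff_has_vector_derivative)
      qed simp
      finally show ?thesis by (simp add: J_def)
    qed
    then show ?thesis
      using has_field_derivative_transform_within[OF J'[OF t], of 1 "\<lambda>t. u (t *\<^sub>R y)"] t by (simp add: f_def)
  qed
  have "u 0 = 0"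
  proof -
    have "(0::'a) \<in> cball 0 r" using r(1) by simp
    note int[OF this]
    also have "integral {0..1} (\<lambda>t. G (t *\<^sub>R 0, u (t *\<^sub>R 0)) 0) = integral {0..1} (\<lambda>t::real. 0)"
    proof (rule integral_cong)
      fix t :: real assume t: "t \<in> {0..1}"
      have "(t *\<^sub>R 0, u (t *\<^sub>R 0)) \<in> W"
        using mem[OF t, of 0 "u (t *\<^sub>R 0)"] \<rho>_id[OF \<open>0 \<in> cball 0 r\<close>] K unfolding \<kappa>u by auto
      then show "G (t *\<^sub>R 0, u (t *\<^sub>R 0)) 0 = 0" by (rule linear_0[OF lin])
    qed
    finally show ?thesis by simp
  qed
  then show ?thesis using that u_cont u_bound ray by blast
qed

text \<open>For small \<open>h\<close>, the curve \<open>z\<close> follows \<open>u\<close> along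
  the ray through \<open>y + h\<close>, and \<open>v\<close>, built from the ray through
  \<open>y\<close>, is its expected first-order value. They agree at \<open>t = 0\<close>, and a
  bound of \<open>z - v\<close> by \<open>\<epsilon> * norm h\<close> at \<open>t = 1\<close> is
  precisely the differentiability of \<open>u\<close> at \<open>y\<close> with derivative
  \<open>G (y, u y)\<close>.\<close>

lemma solution:
  obtains r u where "r > 0" "u 0 = 0" "continuous_on UNIV u"
    "\<And>y. y \<in> ball 0 r \<Longrightarrow> (y, u y) \<in> W"
    "\<And>y. y \<in> ball 0 r \<Longrightarrow> (u has_derivative G (y, u y)) (at y)"
proof -
  obtain R B L where R: "R > 0" "B > 0" "L > 0" and K: "cball 0 R \<times> cball 0 R \<subseteq> W"
    and B: "\<And>z a. z \<in> cball 0 R \<times> cball 0 R \<Longrightarrow> \<bar>G z a\<bar> \<le> B * norm a"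
    and L: "\<And>z z' a. z \<in> cball 0 R \<times> cball 0 R \<Longrightarrow> z' \<in> cball 0 R \<times> cball 0 R \<Longrightarrow>
       \<bar>G z' a - G z a\<bar> \<le> L * norm a * norm (z' - z)"
    using constants by blast
  define K where "K = cball (0::'a) R \<times> cball (0::real) R"
  have KW: "K \<subseteq> W" using \<open>cball 0 R \<times> cball 0 R \<subseteq> W\<close> by (simp add: K_def)
  have K_comp: "compact K" "convex K" unfolding K_def by (auto intro: compact_Times convex_Times)
  define r where "r = min R (min (R / (2 * B)) (1 / (2 * L)))"
  have r: "r > 0" "r \<le> R" using R by (auto simp: r_def)
  have "r \<le> R / (2 * B)" "r \<le> 1 / (2 * L)" by (auto simp: r_def)
  then have r': "B * r \<le> R / 2" "L * r \<le> 1 / 2" using R by (auto simp: field_simps)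
  obtain u where u_cont: "continuous_on UNIV u" and u0: "u 0 = 0" and u_bound: "\<And>y. \<bar>u y\<bar> \<le> R / 2"
    and ray: "\<And>y t. y \<in> cball 0 r \<Longrightarrow> t \<in> {0..1} \<Longrightarrow>
      ((\<lambda>t. u (t *\<^sub>R y)) has_real_derivative G (t *\<^sub>R y, u (t *\<^sub>R y)) y) (at t within {0..1})"
    using ray_solution[OF R \<open>cball 0 R \<times> cball 0 R \<subseteq> W\<close> B L r r'] by blast
  have memK: "(t *\<^sub>R y, s) \<in> K" if "t \<in> {0..1}" "y \<in> cball 0 r" "\<bar>s\<bar> \<le> R" for t y s
  proof -
    have "norm (t *\<^sub>R y) \<le> 1 * r" unfolding norm_scaleR
      using that r(1) by (intro mult_mono) auto
    then show ?thesis using r(2) that(3) by (simp add: K_def)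
  qed
  have u_bound': "\<bar>u y\<bar> \<le> R" for y using u_bound[of y] R(1) by linarith
  have memW: "(y, u y) \<in> W" if "y \<in> ball 0 r" for y
    using memK[of 1 y "u y"] u_bound'[of y] that KW by auto
  have "(u has_derivative G (y, u y)) (at y)" if y: "y \<in> ball 0 r" for y
    unfolding has_derivative_at_alt
  proof (intro conjI allI impI)
    show "bounded_linear (G (y, u y))"
      using lin[OF memW[OF y]] by (simp add: linear_conv_bounded_linear)
    fix \<epsilon> :: real assume \<epsilon>: "\<epsilon> > 0"
    \<comment> \<open>\<open>c * norm h\<close> will bound the distance from \<open>p t\<close> to
      \<open>q t\<close>. The final error is \<open>2 * (c + 1) * e1 * norm h\<close>, which
      explains \<open>e1\<close>. The entries of \<open>d\<close> keep \<open>y + h\<close> in the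
      ball, \<open>v t\<close> within \<open>R\<close>, \<open>q t\<close> within \<open>d1\<close>
      of \<open>p t\<close>, and \<open>L * c * norm h\<close> at most \<open>e1\<close>.\<close>
    define c where "c = 1 + B"
    define e1 where "e1 = \<epsilon> / (2 * (c + 1))"
    have c: "c > 0" "c \<ge> 1" using R(2) by (auto simp: c_def)
    have e1: "e1 > 0" using \<epsilon> c by (simp add: e1_def)
    obtain d1 where d1: "d1 > 0" "\<And>z z'. z \<in> K \<Longrightarrow> z' \<in> K \<Longrightarrow> norm (z' - z) < d1 \<Longrightarrow>
        norm (G z' y - G z y - frechet_derivative (\<lambda>z. G z y) (at z) (z' - z)) \<le> e1 * norm (z' - z)"
      using smooth_on_uniformly_differentiable[OF W(1) smooth[of y] K_comp KW e1] by blast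
    define d where "d = min (r - norm y) (min (R / (2 * B)) (min (d1 / c) (e1 / (L * c))))"
    have d: "d > 0" using y R d1(1) e1 c by (simp add: d_def)
    have main: "norm (u (y + h) - u y - G (y, u y) h) \<le> \<epsilon> * norm h" if h: "norm h < d" for h
    proof -
      have "norm h < r - norm y" "norm h < R / (2 * B)" "norm h < d1 / c" "norm h < e1 / (L * c)"
        using h by (auto simp: d_def)
      then have h': "B * norm h \<le> R / 2" "c * norm h < d1" "L * c * norm h \<le> e1"
        and "norm h < r - norm y"
        using R c by (auto simp: field_simps)
      then have yh: "y + h \<in> cball 0 r" "y \<in> cball 0 r"
        using norm_triangle_ineq[of y h] y by auto
      define p where "p t = (t *\<^sub>R y, u (t *\<^sub>R y))" for t
      define v where "v t = u (t *\<^sub>R y) + t * G (p t) h" for t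
      define z where "z t = u (t *\<^sub>R (y + h))" for t
      define q where "q t = (t *\<^sub>R (y + h), v t)" for t
      define Z where "Z t = G (t *\<^sub>R (y + h), z t) (y + h)" for t
      (* v solves the equation of z up to o(h): by integrability, moving along y after h and along h after y
         agree to first order. *)
      define V where "V t = G (p t) y + (G (p t) h + t * frechet_derivative (\<lambda>z. G z h) (at (p t)) (y, G (p t) y))" for t
      have pK: "p t \<in> K" if "t \<in> {0..1}" for t
        unfolding p_def by (rule memK[OF that yh(2) u_bound'])
      have G_h: "\<bar>G (p t) h\<bar> \<le> B * norm h" if "t \<in> {0..1}" for t
        using B[of "p t" h] pK[OF that] by (simp add: K_def)
      have v_bound: "\<bar>v t\<bar> \<le> R" if t: "t \<in> {0..1}" for t
      proof -
        have "\<bar>t * G (p t) h\<bar> \<le> 1 * \<bar>G (p t) h\<bar>" unfolding abs_mult using t by (intro mult_right_mono) auto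
        then show ?thesis using G_h[OF t] u_bound[of "t *\<^sub>R y"] h'(1) unfolding v_def by linarith
      qed
      have qK: "q t \<in> K" if "t \<in> {0..1}" for t
        unfolding q_def by (rule memK[OF that yh(1) v_bound[OF that]])
      have zK: "(t *\<^sub>R (y + h), z t) \<in> K" if "t \<in> {0..1}" for t
        unfolding z_def by (rule memK[OF that yh(1) u_bound'])
      have z': "(z has_real_derivative Z t) (at t within {0..1})" if "t \<in> {0..1}" for t
        using ray[OF yh(1) that] by (simp add: z_def[abs_def] Z_def)
      have v': "(v has_real_derivative V t) (at t within {0..1})" if t: "t \<in> {0..1}" for t
      proof -
        note uy = ray[OF yh(2) t, folded p_def]
        have "(p has_derivative (\<lambda>s. (s *\<^sub>R y, G (p t) y * s))) (at t within {0..1})"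
          unfolding p_def[abs_def]
          by (intro has_derivative_Pair uy[unfolded p_def, THEN has_field_derivative_imp_has_derivative])
            (auto intro!: derivative_eq_intros)
        moreover have "((\<lambda>z. G z h) has_derivative frechet_derivative (\<lambda>z. G z h) (at (p t))) (at (p t))"
          using smooth_on_has_derivative[OF smooth W(1)] pK[OF t] KW by blast
        ultimately have "((\<lambda>t. G (p t) h) has_derivative
            (\<lambda>s. frechet_derivative (\<lambda>z. G z h) (at (p t)) (s *\<^sub>R y, G (p t) y * s))) (at t within {0..1})"
          by (rule has_derivative_compose)
        moreover have "frechet_derivative (\<lambda>z. G z h) (at (p t)) (s *\<^sub>R y, G (p t) y * s) =
            frechet_derivative (\<lambda>z. G z h) (at (p t)) (y, G (p t) y) * s" for s
          using linear_scale[OF smooth_on_frechet_linear[OF smooth W(1)], of "p t" h s "(y, G (p t) y)"] pK[OF t] KW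
          by (auto simp: mult.commute)
        ultimately have "((\<lambda>t. G (p t) h) has_real_derivative
            frechet_derivative (\<lambda>z. G z h) (at (p t)) (y, G (p t) y)) (at t within {0..1})"
          by (simp add: has_field_derivative_def)
        from DERIV_add[OF uy DERIV_mult[OF DERIV_ident this]] show ?thesis
          by (simp add: v_def[abs_def] V_def mult.commute)
      qed
      \<comment> \<open>The share \<open>c * e1 * norm h\<close> comes from linearising
        \<open>G _ y\<close> at \<open>p t\<close>, the share \<open>e1 * norm h\<close> from the
        change of \<open>G _ h\<close> between \<open>p t\<close> and \<open>q t\<close>.\<close>
      define E where "E = (c + 1) * e1 * norm h"
      have diff: "\<bar>Z t - V t\<bar> \<le> \<bar>z t - v t\<bar> / 2 + E" if t: "t \<in> {0..1}" for t
      proof -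
        have "\<bar>Z t - G (q t) (y + h)\<bar> \<le> L * norm (y + h) * norm ((t *\<^sub>R (y + h), z t) - q t)"
          unfolding Z_def using L[of "q t" "(t *\<^sub>R (y + h), z t)" "y + h"] qK[OF t] zK[OF t] by (simp add: K_def)
        also have "\<dots> = L * norm (y + h) * \<bar>z t - v t\<bar>" by (simp add: q_def norm_Pair)
        also have "\<dots> \<le> (1 / 2) * \<bar>z t - v t\<bar>"
        proof (rule mult_right_mono)
          have "L * norm (y + h) \<le> L * r" using yh R by simp
          then show "L * norm (y + h) \<le> 1 / 2" using r'(2) by simp
        qed simp
        finally have 1: "\<bar>Z t - G (q t) (y + h)\<bar> \<le> (1 / 2) * \<bar>z t - v t\<bar>" .
        have pW: "p t \<in> W" "q t \<in> W" using pK[OF t] qK[OF t] KW by auto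
        have qp: "q t - p t = t *\<^sub>R (h, G (p t) h)"
          by (simp add: q_def p_def v_def scaleR_add_right)
        have "norm (q t - p t) \<le> 1 * norm (h, G (p t) h)"
          unfolding qp norm_scaleR using t by (intro mult_right_mono) auto
        also have "\<dots> \<le> norm h + B * norm h"
          using norm_Pair_le[of h "G (p t) h"] G_h[OF t] by simp
        finally have n: "norm (q t - p t) \<le> c * norm h" by (simp add: c_def algebra_simps)
        have "frechet_derivative (\<lambda>z. G z y) (at (p t)) (q t - p t) =
            t * frechet_derivative (\<lambda>z. G z y) (at (p t)) (h, G (p t) h)"
          unfolding qp linear_scale[OF smooth_on_frechet_linear[OF smooth W(1) pW(1)]] by simp
        also have "\<dots> = t * frechet_derivative (\<lambda>z. G z h) (at (p t)) (y, G (p t) y)"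
          using int[OF pW(1), of y h] by simp
        finally have "G (q t) (y + h) - V t = (G (q t) y - G (p t) y - frechet_derivative (\<lambda>z. G z y) (at (p t)) (q t - p t))
            + (G (q t) h - G (p t) h)"
          using linear_add[OF lin[OF pW(2)], of y h] by (simp add: V_def)
        moreover have "\<bar>G (q t) y - G (p t) y - frechet_derivative (\<lambda>z. G z y) (at (p t)) (q t - p t)\<bar> \<le> e1 * norm (q t - p t)"
          using d1(2)[OF pK[OF t] qK[OF t]] n h'(2) by simp
        moreover have "\<bar>G (q t) h - G (p t) h\<bar> \<le> L * norm h * norm (q t - p t)"
          using L[of "p t" "q t" h] pK[OF t] qK[OF t] by (simp add: K_def)
        moreover have "e1 * norm (q t - p t) \<le> e1 * (c * norm h)" using n e1 by simp
        moreover have "L * norm h * norm (q t - p t) \<le> L * norm h * (c * norm h)"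
          using n R by (intro mult_left_mono) auto
        moreover have "L * norm h * (c * norm h) \<le> e1 * norm h"
          using mult_right_mono[OF h'(3), of "norm h"] by (simp add: mult_ac)
        ultimately have "\<bar>G (q t) (y + h) - V t\<bar> \<le> E" unfolding E_def by (simp add: algebra_simps)
        with 1 show ?thesis by linarith
      qed
      have w': "((\<lambda>t. z t - v t) has_real_derivative Z t - V t) (at t within {0..1})" if "t \<in> {0..1}" for t
        by (intro DERIV_diff z' v' that)
      \<comment> \<open>A maximum \<open>m\<close> replaces a Gronwall estimate:
        \<open>z - v\<close> starts at \<open>0\<close> and has slope at most
        \<open>m / 2 + E\<close> on the unit interval, so \<open>m \<le> m / 2 + E\<close>.\<close>
      have "continuous_on {0..1} (\<lambda>t. \<bar>z t - v t\<bar>)"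
        by (intro continuous_on_rabs DERIV_continuous_on[OF w'])
      then obtain t0 where t0: "t0 \<in> {0..1}" "\<And>t. t \<in> {0..1} \<Longrightarrow> \<bar>z t - v t\<bar> \<le> \<bar>z t0 - v t0\<bar>"
        using continuous_attains_sup[of "{0..1::real}" "\<lambda>t. \<bar>z t - v t\<bar>"] by auto
      define m where "m = \<bar>z t0 - v t0\<bar>"
      have "norm ((z t0 - v t0) - (z 0 - v 0)) \<le> (m / 2 + E) * norm (t0 - 0)"
      proof (rule field_differentiable_bound[of "{0..1}"])
        show "norm (Z t - V t) \<le> m / 2 + E" if "t \<in> {0..1}" for t
          using diff[OF that] t0(2)[OF that] by (simp add: m_def)
      qed (use w' t0(1) in auto)
      also have "z 0 - v 0 = 0" by (simp add: z_def v_def)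
      finally have "m \<le> (m / 2 + E) * t0" using t0(1) by (simp add: m_def)
      also have "\<dots> \<le> (m / 2 + E) * 1"
        using t0(1) e1 c by (intro mult_left_mono) (auto simp: m_def E_def)
      finally have "m \<le> 2 * E" by simp
      then have "\<bar>z 1 - v 1\<bar> \<le> 2 * E" using t0(2)[of 1] by (simp add: m_def)
      also have "2 * E = (2 * (c + 1)) * e1 * norm h" by (simp add: E_def)
      also have "(2 * (c + 1)) * e1 = \<epsilon>" using c unfolding e1_def by simp
      finally show ?thesis by (simp add: z_def v_def p_def algebra_simps)
    qed
    show "\<exists>d>0. \<forall>y'. norm (y' - y) < d \<longrightarrow> norm (u y' - u y - G (y, u y) (y' - y)) \<le> \<epsilon> * norm (y' - y)"
      using d main[of "_ - y"] by (intro exI[of _ d]) auto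
  qed
  then show ?thesis using that[OF r(1) u0 u_cont memW] by blast
qed

text \<open>Bootstrapping: if \<open>u\<close> is of class \<open>Ck_on k\<close>, so is its
  derivative \<open>G (y, u y)\<close> on fixed vectors, and \<open>u\<close> gains one
  order.\<close>

theorem smooth_solution:
  obtains r u where "r > 0" "u 0 = 0" "smooth_on (ball 0 r) u"
    "\<And>y. y \<in> ball 0 r \<Longrightarrow> (y, u y) \<in> W"
    "\<And>y. y \<in> ball 0 r \<Longrightarrow> (u has_derivative G (y, u y)) (at y)"
proof -
  obtain r u where r: "r > 0" and u: "u 0 = 0" "continuous_on UNIV u"
    and uW: "\<And>y. y \<in> ball 0 r \<Longrightarrow> (y, u y) \<in> W"
    and u': "\<And>y. y \<in> ball 0 r \<Longrightarrow> (u has_derivative G (y, u y)) (at y)"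
    using solution by blast
  have "Ck_on k u (ball 0 r)" for k
  proof (induction k)
    case 0
    show ?case using u(2) by (auto intro: continuous_on_subset)
  next
    case (Suc k)
    have "Ck_on k (\<lambda>y. (y, u y)) (ball 0 r)"
      by (intro Ck_on_Pair Suc.IH Ck_on_bounded_linear bounded_linear_ident open_ball)
    then have "Ck_on k (\<lambda>y. G (y, u y) v) (ball 0 r)" for v
      using smooth[of v] uW unfolding smooth_on_def
      by (intro Ck_on_compose[OF open_ball W(1), where g = "\<lambda>z. G z v"]) auto
    then show ?case by (intro Ck_on_SucI[OF open_ball u']) auto
  qed
  with that[OF r u(1) _ uW u'] show ?thesis by (simp add: smooth_on_def)
qed

end

section \<open>Charts, fields and tangent spaces\<close>

lemma chart_inv_left: "is_chart c \<Longrightarrow> p \<in> fst c \<Longrightarrow> chart_inv c (snd c p) = p"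
  unfolding is_chart_def homeomorphism_def by blast

lemma chart_inv_right: "is_chart c \<Longrightarrow> x \<in> snd c ` fst c \<Longrightarrow> snd c (chart_inv c x) = x"
  unfolding is_chart_def homeomorphism_def by blast

lemma chart_inv_mem: "is_chart c \<Longrightarrow> x \<in> snd c ` fst c \<Longrightarrow> chart_inv c x \<in> fst c"
  unfolding is_chart_def homeomorphism_def by blast

lemma chart_image_iff:
  assumes "is_chart c" "B \<subseteq> fst c"
  shows "x \<in> snd c ` B \<longleftrightarrow> x \<in> snd c ` fst c \<and> chart_inv c x \<in> B"
  using assms chart_inv_left[OF assms(1)] chart_inv_right[OF assms(1)] by (auto simp: image_iff subset_iff)

lemma open_chart_image:
  assumes "is_chart c" "open W"
  shows "open (snd c ` (W \<inter> fst c))"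
proof -
  have "snd c ` (W \<inter> fst c) = snd c ` fst c \<inter> chart_inv c -` W"
    using chart_image_iff[OF assms(1), of "W \<inter> fst c"] chart_inv_mem[OF assms(1)] by auto
  moreover have "open (snd c ` fst c \<inter> chart_inv c -` W)"
    using assms unfolding is_chart_def homeomorphism_def by (intro continuous_open_preimage) auto
  ultimately show ?thesis by simp
qed

lemma open_chart_preimage:
  assumes "is_chart c" "open B"
  shows "open (fst c \<inter> snd c -` B)"
  using assms unfolding is_chart_def homeomorphism_def by (intro continuous_open_preimage) auto

lemma field_extension_subset: "field_extension A K Y p Z \<Longrightarrow> K' \<subseteq> K \<Longrightarrow> field_extension A K' Y p Z"
  unfolding field_extension_def by blast

lemma smooth_field_along_subset: "smooth_field_along A K Y \<Longrightarrow> K' \<subseteq> K \<Longrightarrow> smooth_field_along A K' Y"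
  unfolding smooth_field_along_def field_extension_def by (meson Int_mono order_refl subset_iff)

section \<open>Change of charts and components of fields\<close>

definition transition_deriv :: "('m, 'e::euclidean_space) chart \<Rightarrow> ('m, 'e) chart \<Rightarrow> 'e \<Rightarrow> 'e \<Rightarrow> 'e" where
  "transition_deriv c d x = frechet_derivative (snd d \<circ> chart_inv c) (at x)"

text \<open>The field with components \<open>f\<close> in the chart \<open>c\<close>. The transition
  derivative occurs because a vector at \<open>p\<close> is stored by its components in the chart
  selected at \<open>p\<close>.\<close>

definition chart_field ::
    "('m, 'e::euclidean_space) chart set \<Rightarrow> ('m, 'e) chart \<Rightarrow> ('e \<Rightarrow> 'e) \<Rightarrow> 'm \<Rightarrow> 'e" where
  "chart_field A c f p = transition_deriv c (chart_at A p) (snd c p) (f (snd c p))"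

locale smooth_manifold =
  fixes A :: "('m::topological_space, 'e::euclidean_space) chart set"
  assumes atlas: "smooth_atlas A"
begin

text \<open>Slice charts are required to be compatible with the atlas, not to belong to it, so the
  calculus is developed for this larger class.\<close>

definition admissible :: "('m, 'e) chart \<Rightarrow> bool" where
  "admissible c \<longleftrightarrow> is_chart c \<and> (\<forall>d\<in>A. compatible c d)"

lemma admissible_is_chart: "admissible c \<Longrightarrow> is_chart c"
  by (simp add: admissible_def)

lemma atlas_admissible: "c \<in> A \<Longrightarrow> admissible c"
  using atlas by (auto simp: smooth_atlas_def admissible_def)

lemma chart_at: "chart_at A p \<in> A" "p \<in> fst (chart_at A p)"
proof -
  have "p \<in> (\<Union>c\<in>A. fst c)" using atlas by (simp add: smooth_atlas_def)
  then have "\<exists>c. c \<in> A \<and> p \<in> fst c" by blast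
  then show "chart_at A p \<in> A" "p \<in> fst (chart_at A p)"
    unfolding chart_at_def by (metis (mono_tags, lifting) someI_ex)+
qed

lemma admissible_chart_at: "admissible (chart_at A p)"
  by (rule atlas_admissible[OF chart_at(1)])

lemma open_fst: "admissible c \<Longrightarrow> open (fst c)"
  by (simp add: admissible_def is_chart_def)

lemma open_image: "admissible c \<Longrightarrow> open W \<Longrightarrow> open (snd c ` (W \<inter> fst c))"
  by (simp add: open_chart_image admissible_is_chart)

lemma open_overlap:
  assumes "admissible c" "admissible d"
  shows "open (snd c ` (fst c \<inter> fst d))"
  using open_image[OF assms(1) open_fst[OF assms(2)]] by (simp add: Int_commute)

text \<open>Two admissible charts are compatible with the atlas, but not with one another by
  definition. Near every point the transition factors through an atlas chart
  \<open>e\<close>.\<close>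

lemma transition_smooth:
  assumes c: "admissible c" and d: "admissible d"
  shows "smooth_on (snd c ` (fst c \<inter> fst d)) (snd d \<circ> chart_inv c)"
proof (rule smooth_on_local[OF open_overlap[OF c d]])
  fix x assume "x \<in> snd c ` (fst c \<inter> fst d)"
  then obtain p where p: "p \<in> fst c" "p \<in> fst d" "x = snd c p" by blast
  define e where "e = chart_at A p"
  have e: "e \<in> A" "p \<in> fst e" using chart_at by (auto simp: e_def)
  have ea: "admissible e" using atlas_admissible[OF e(1)] .
  define T where "T = snd c ` (fst c \<inter> fst d \<inter> fst e)"
  have T: "open T"
    using open_image[OF c open_Int[OF open_fst[OF d] open_fst[OF ea]]] by (simp add: T_def Int_ac)
  have ce: "smooth_on T (snd e \<circ> chart_inv c)"
    using c e(1) by (auto simp: admissible_def compatible_def T_def elim!: smooth_on_subset)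
  have ed: "smooth_on (snd e ` (fst e \<inter> fst d)) (snd d \<circ> chart_inv e)"
    using d e(1) by (auto simp: admissible_def compatible_def Int_commute)
  have img: "(snd e \<circ> chart_inv c) ` T \<subseteq> snd e ` (fst e \<inter> fst d)"
    using chart_inv_left[OF admissible_is_chart[OF c]] by (auto simp: T_def)
  have "smooth_on T (\<lambda>x. (snd d \<circ> chart_inv e) ((snd e \<circ> chart_inv c) x))"
    by (rule smooth_on_compose[OF T open_overlap[OF ea d] img ce ed])
  then have "smooth_on T (snd d \<circ> chart_inv c)"
    by (subst smooth_on_cong[OF T, of _ "\<lambda>x. (snd d \<circ> chart_inv e) ((snd e \<circ> chart_inv c) x)"])
      (auto simp: T_def chart_inv_left[OF admissible_is_chart[OF c]] chart_inv_left[OF admissible_is_chart[OF ea]])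
  then show "\<exists>T. open T \<and> x \<in> T \<and> smooth_on (T \<inter> snd c ` (fst c \<inter> fst d)) (snd d \<circ> chart_inv c)"
    using T p e(2) by (intro exI[of _ T]) (auto simp: T_def elim: smooth_on_subset)
qed

lemma transition_has_derivative:
  assumes "admissible c" "admissible d" "p \<in> fst c" "p \<in> fst d"
  shows "((snd d \<circ> chart_inv c) has_derivative transition_deriv c d (snd c p)) (at (snd c p))"
  unfolding transition_deriv_def
  by (rule smooth_on_has_derivative[OF transition_smooth open_overlap]) (use assms in auto)

lemma linear_transition_deriv:
  assumes "admissible c" "admissible d" "p \<in> fst c" "p \<in> fst d"
  shows "linear (transition_deriv c d (snd c p))"
  using transition_has_derivative[OF assms] has_derivative_linear by blast

lemma transition_deriv_chain:
  assumes "admissible c" "admissible d" "admissible e" "p \<in> fst c" "p \<in> fst d" "p \<in> fst e"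
  shows "transition_deriv d e (snd d p) (transition_deriv c d (snd c p) v) = transition_deriv c e (snd c p) v"
proof -
  note inv = chart_inv_left[OF admissible_is_chart]
  let ?T = "snd c ` ((fst d \<inter> fst e) \<inter> fst c)"
  have T: "open ?T" using open_image[OF assms(1)] open_fst assms(2,3) by blast
  have "((snd e \<circ> chart_inv d) has_derivative transition_deriv d e (snd d p)) (at ((snd d \<circ> chart_inv c) (snd c p)))"
    using transition_has_derivative[OF assms(2,3,5,6)] inv[OF assms(1,4)] by simp
  from diff_chain_at[OF transition_has_derivative[OF assms(1,2,4,5)] this]
  have "((snd e \<circ> chart_inv c) has_derivative transition_deriv d e (snd d p) \<circ> transition_deriv c d (snd c p)) (at (snd c p))"
    by (rule has_derivative_transform_within_open[OF _ T])
      (use assms(4-6) inv[OF assms(1)] inv[OF assms(2)] in auto)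
  from has_derivative_unique[OF this transition_has_derivative[OF assms(1,3,4,6)]]
  show ?thesis by (metis comp_apply)
qed

lemma transition_deriv_same:
  assumes "admissible c" "p \<in> fst c"
  shows "transition_deriv c c (snd c p) v = v"
proof -
  have "((\<lambda>x. x) has_derivative (\<lambda>v. v)) (at (snd c p))" by simp
  then have "((snd c \<circ> chart_inv c) has_derivative (\<lambda>v. v)) (at (snd c p))"
    by (rule has_derivative_transform_within_open[OF _ open_overlap[OF assms(1) assms(1)]])
      (use assms chart_inv_left[OF admissible_is_chart[OF assms(1)]] in auto)
  from has_derivative_unique[OF this transition_has_derivative[OF assms(1,1,2,2)]]
  show ?thesis by metis
qed

lemma tcoord_eq: "tcoord A c p v = transition_deriv (chart_at A p) c (snd (chart_at A p) p) v"
  by (simp add: tcoord_def transition_deriv_def)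

lemma linear_tcoord: "admissible c \<Longrightarrow> p \<in> fst c \<Longrightarrow> linear (tcoord A c p)"
  using linear_transition_deriv[OF admissible_chart_at _ chart_at(2)] unfolding tcoord_eq[abs_def] by simp

lemma tcoord_chart_at [simp]: "tcoord A (chart_at A p) p v = v"
  by (simp add: tcoord_eq transition_deriv_same admissible_chart_at chart_at(2))

lemma tcoord_change:
  assumes "admissible c" "admissible d" "p \<in> fst c" "p \<in> fst d"
  shows "tcoord A d p v = transition_deriv c d (snd c p) (tcoord A c p v)"
  unfolding tcoord_eq by (rule transition_deriv_chain[symmetric]) (simp_all add: assms admissible_chart_at chart_at(2))

lemma tcoord_chart_field:
  assumes "admissible c" "p \<in> fst c"
  shows "tcoord A c p (chart_field A c f p) = f (snd c p)"
  unfolding tcoord_eq chart_field_def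
  using transition_deriv_chain[OF assms(1) admissible_chart_at assms(1,2) chart_at(2) assms(2)]
  by (simp add: transition_deriv_same assms)

lemma tcoord_inverse:
  assumes "admissible c" "p \<in> fst c"
  shows "transition_deriv c (chart_at A p) (snd c p) (tcoord A c p v) = v"
  using tcoord_change[OF assms(1) admissible_chart_at assms(2) chart_at(2), of v] by simp

lemma tcoord_inj:
  assumes "admissible c" "p \<in> fst c" "tcoord A c p v = tcoord A c p w"
  shows "v = w"
  using tcoord_inverse[OF assms(1,2)] assms(3) by metis

lemma field_rep_chart: "admissible c \<Longrightarrow> p \<in> fst c \<Longrightarrow> field_rep A c X (snd c p) = tcoord A c p (X p)"
  by (simp add: field_rep_def chart_inv_left admissible_is_chart)

lemma field_rep_chart_field:
  assumes "admissible c" "x \<in> snd c ` fst c"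
  shows "field_rep A c (chart_field A c f) x = f x"
  using assms by (auto simp: field_rep_chart tcoord_chart_field)

text \<open>Components transform by the derivative of the coordinate change, itself a smooth family
  of linear maps.\<close>

lemma field_rep_transfer:
  assumes c: "admissible c" and d: "admissible d" and W: "open W"
    and X: "smooth_on (snd c ` (W \<inter> fst c)) (field_rep A c X)"
  shows "smooth_on (snd d ` (W \<inter> fst c \<inter> fst d)) (field_rep A d X)"
proof -
  define T where "T = snd d ` (W \<inter> fst c \<inter> fst d)"
  define \<eta> where "\<eta> = snd c \<circ> chart_inv d"
  note inv = chart_inv_left[OF admissible_is_chart]
  have T: "open T" unfolding T_def by (rule open_image[OF d open_Int[OF W open_fst[OF c]]])
  have \<eta>: "smooth_on T \<eta>"
    unfolding \<eta>_def T_def by (rule smooth_on_subset[OF transition_smooth[OF d c]]) auto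
  have "smooth_on T (\<lambda>y. transition_deriv c d (\<eta> y) (field_rep A c X (\<eta> y)))"
  proof (rule smooth_on_linear_family[where L = "\<lambda>y. transition_deriv c d (\<eta> y)", OF T])
    show "linear (transition_deriv c d (\<eta> y))" if "y \<in> T" for y
      using that linear_transition_deriv[OF c d] inv[OF d] by (auto simp: T_def \<eta>_def)
    show "smooth_on T (\<lambda>y. transition_deriv c d (\<eta> y) b)" for b
      unfolding transition_deriv_def
      by (rule smooth_on_compose[OF T open_overlap[OF c d] _ \<eta> smooth_on_derivative[OF transition_smooth[OF c d]]])
        (use inv[OF d] in \<open>auto simp: T_def \<eta>_def\<close>)
    show "smooth_on T (\<lambda>y. field_rep A c X (\<eta> y))"
      by (rule smooth_on_compose[OF T open_image[OF c W] _ \<eta> X])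
        (use inv[OF d] in \<open>auto simp: T_def \<eta>_def\<close>)
  qed
  moreover have "field_rep A d X y = transition_deriv c d (\<eta> y) (field_rep A c X (\<eta> y))" if "y \<in> T" for y
    using that inv[OF d] tcoord_change[OF c d] field_rep_chart[OF c] field_rep_chart[OF d]
    by (auto simp: T_def \<eta>_def)
  ultimately show ?thesis
    unfolding T_def[symmetric] by (subst smooth_on_cong[OF T]) auto
qed

lemma smooth_on_chart_local:
  assumes d: "admissible d" and W: "open W"
    and loc: "\<And>p. p \<in> W \<Longrightarrow> p \<in> fst d \<Longrightarrow> \<exists>B. open B \<and> p \<in> B \<and> smooth_on (snd d ` (B \<inter> fst d)) F"
  shows "smooth_on (snd d ` (W \<inter> fst d)) F"
proof (rule smooth_on_local[OF open_image[OF d W]])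
  fix x assume "x \<in> snd d ` (W \<inter> fst d)"
  then obtain p where p: "p \<in> W" "p \<in> fst d" "x = snd d p" by blast
  from loc[OF p(1,2)] obtain B where B: "open B" "p \<in> B" "smooth_on (snd d ` (B \<inter> fst d)) F" by blast
  show "\<exists>T. open T \<and> x \<in> T \<and> smooth_on (T \<inter> snd d ` (W \<inter> fst d)) F"
    by (rule exI[of _ "snd d ` (B \<inter> fst d)"])
      (use B p open_image[OF d B(1)] in \<open>auto elim: smooth_on_subset\<close>)
qed

lemma field_rep_smooth_local:
  assumes W: "open W" and d: "admissible d"
    and loc: "\<And>p. p \<in> W \<Longrightarrow> \<exists>c B. admissible c \<and> open B \<and> p \<in> B \<and> p \<in> fst c \<and>
      smooth_on (snd c ` (B \<inter> fst c)) (field_rep A c X)"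
  shows "smooth_on (snd d ` (W \<inter> fst d)) (field_rep A d X)"
proof (rule smooth_on_chart_local[OF d W])
  fix p assume p: "p \<in> W" "p \<in> fst d"
  obtain c B where c: "admissible c" "open B" "p \<in> B" "p \<in> fst c"
    "smooth_on (snd c ` (B \<inter> fst c)) (field_rep A c X)" using loc[OF p(1)] by blast
  show "\<exists>B. open B \<and> p \<in> B \<and> smooth_on (snd d ` (B \<inter> fst d)) (field_rep A d X)"
    using field_rep_transfer[OF c(1) d c(2,5)] c open_fst[OF c(1)] by (intro exI[of _ "B \<inter> fst c"]) auto
qed

text \<open>A single admissible chart around each point suffices; transfer between charts covers the
  rest of the atlas.\<close>

lemma smooth_field_localI:
  assumes "open W"
    and "\<And>p. p \<in> W \<Longrightarrow> \<exists>c B. admissible c \<and> open B \<and> p \<in> B \<and> p \<in> fst c \<and>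
      smooth_on (snd c ` (B \<inter> fst c)) (field_rep A c X)"
  shows "smooth_field A W X"
  unfolding smooth_field_def using field_rep_smooth_local[OF assms(1) atlas_admissible] assms(2) by blast

lemma smooth_field_chart:
  assumes "open W" "smooth_field A W X" "admissible c"
  shows "smooth_on (snd c ` (W \<inter> fst c)) (field_rep A c X)"
proof (rule field_rep_smooth_local[OF assms(1,3)])
  fix p assume "p \<in> W"
  then show "\<exists>c B. admissible c \<and> open B \<and> p \<in> B \<and> p \<in> fst c \<and>
      smooth_on (snd c ` (B \<inter> fst c)) (field_rep A c X)"
    using assms(1,2) chart_at[of p] admissible_chart_at[of p] unfolding smooth_field_def
    by (intro exI[of _ "chart_at A p"] exI[of _ W]) auto
qed

lemma smooth_fieldI_chart:
  assumes "open W" "admissible c" "W \<subseteq> fst c" "smooth_on (snd c ` W) (field_rep A c X)"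
  shows "smooth_field A W X"
proof (rule smooth_field_localI[OF assms(1)])
  fix p assume "p \<in> W"
  moreover have "W \<inter> fst c = W" using assms(3) by auto
  ultimately show "\<exists>c B. admissible c \<and> open B \<and> p \<in> B \<and> p \<in> fst c \<and> smooth_on (snd c ` (B \<inter> fst c)) (field_rep A c X)"
    using assms by (intro exI[of _ c] exI[of _ W]) auto
qed

lemma smooth_chart_field:
  assumes "open W" "admissible c" "W \<subseteq> fst c" "smooth_on (snd c ` W) f"
  shows "smooth_field A W (chart_field A c f)"
proof (rule smooth_fieldI_chart[OF assms(1-3)])
  have "open (snd c ` W)" using open_image[OF assms(2,1)] assms(3) by (simp add: Int_absorb2)
  then show "smooth_on (snd c ` W) (field_rep A c (chart_field A c f))"
    using assms(4) by (subst smooth_on_cong[of _ _ f]) (use assms(3) field_rep_chart_field[OF assms(2)] in auto)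
qed

section \<open>Smooth functions and algebraic operations on fields\<close>

lemma smooth_fun_transfer:
  assumes c: "admissible c" and d: "admissible d" and W: "open W"
    and f: "smooth_on (snd c ` (W \<inter> fst c)) (f \<circ> chart_inv c)"
  shows "smooth_on (snd d ` (W \<inter> fst c \<inter> fst d)) (f \<circ> chart_inv d)"
proof -
  note inv = chart_inv_left[OF admissible_is_chart]
  have T: "open (snd d ` (W \<inter> fst c \<inter> fst d))" by (rule open_image[OF d open_Int[OF W open_fst[OF c]]])
  have "smooth_on (snd d ` (W \<inter> fst c \<inter> fst d)) (\<lambda>y. (f \<circ> chart_inv c) ((snd c \<circ> chart_inv d) y))"
    by (rule smooth_on_compose[OF T open_image[OF c W] _ smooth_on_subset[OF transition_smooth[OF d c]] f])
      (auto simp: inv[OF d])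
  then show ?thesis
    by (subst smooth_on_cong[OF T, of _ "\<lambda>y. (f \<circ> chart_inv c) ((snd c \<circ> chart_inv d) y)"])
      (auto simp: inv[OF d] inv[OF c])
qed

lemma smooth_fun_chart:
  assumes W: "open W" "smooth_fun A W f" and d: "admissible d"
  shows "smooth_on (snd d ` (W \<inter> fst d)) (f \<circ> chart_inv d)"
proof (rule smooth_on_chart_local[OF d W(1)])
  fix p assume p: "p \<in> W" "p \<in> fst d"
  let ?c = "chart_at A p"
  have "smooth_on (snd ?c ` (W \<inter> fst ?c)) (f \<circ> chart_inv ?c)"
    using W(2) chart_at(1) by (simp add: smooth_fun_def)
  from smooth_fun_transfer[OF admissible_chart_at d W(1) this]
  show "\<exists>B. open B \<and> p \<in> B \<and> smooth_on (snd d ` (B \<inter> fst d)) (f \<circ> chart_inv d)"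
    using p chart_at(2) W(1) open_fst[OF admissible_chart_at] by (intro exI[of _ "W \<inter> fst ?c"]) auto
qed

lemma smooth_fun_subset: "smooth_fun A W f \<Longrightarrow> W' \<subseteq> W \<Longrightarrow> smooth_fun A W' f"
  unfolding smooth_fun_def by (meson Int_mono image_mono order_refl smooth_on_subset)

lemma smooth_field_subset: "smooth_field A W X \<Longrightarrow> W' \<subseteq> W \<Longrightarrow> smooth_field A W' X"
  unfolding smooth_field_def by (meson Int_mono image_mono order_refl smooth_on_subset)

lemma smooth_fun_const: "open W \<Longrightarrow> smooth_fun A W (\<lambda>p. k)"
  unfolding smooth_fun_def comp_def using open_image[OF atlas_admissible] by simp

lemma smooth_fun_add: "open W \<Longrightarrow> smooth_fun A W f \<Longrightarrow> smooth_fun A W h \<Longrightarrow> smooth_fun A W (\<lambda>p. f p + h p)"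
  unfolding smooth_fun_def comp_def using open_image[OF atlas_admissible] smooth_on_add by blast

lemma smooth_fun_mult: "open W \<Longrightarrow> smooth_fun A W f \<Longrightarrow> smooth_fun A W h \<Longrightarrow> smooth_fun A W (\<lambda>p. f p * h p)"
  unfolding smooth_fun_def comp_def using open_image[OF atlas_admissible] smooth_on_mult by blast

lemma smooth_fun_divide:
  assumes "open W" "smooth_fun A W f" "smooth_fun A W h" "\<And>p. p \<in> W \<Longrightarrow> h p \<noteq> 0"
  shows "smooth_fun A W (\<lambda>p. f p / h p)"
  unfolding smooth_fun_def comp_def
proof
  fix c assume c: "c \<in> A"
  note ca = atlas_admissible[OF c]
  show "smooth_on (snd c ` (W \<inter> fst c)) (\<lambda>x. f (chart_inv c x) / h (chart_inv c x))"
    using assms c by (intro smooth_on_divide open_image[OF ca])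
      (auto simp: smooth_fun_def comp_def chart_inv_left[OF admissible_is_chart[OF ca]])
qed

lemma smooth_field_add:
  assumes "open W" "smooth_field A W X" "smooth_field A W Y"
  shows "smooth_field A W (\<lambda>p. X p + Y p)"
  unfolding smooth_field_def
proof
  fix c assume c: "c \<in> A"
  note ca = atlas_admissible[OF c]
  have "smooth_on (snd c ` (W \<inter> fst c)) (\<lambda>x. field_rep A c X x + field_rep A c Y x)"
    using assms c by (intro smooth_on_add open_image[OF ca]) (auto simp: smooth_field_def)
  then show "smooth_on (snd c ` (W \<inter> fst c)) (field_rep A c (\<lambda>p. X p + Y p))"
    by (subst smooth_on_cong[OF open_image[OF ca assms(1)]])
      (auto simp: field_rep_chart[OF ca] linear_add[OF linear_tcoord[OF ca]])
qed

lemma smooth_field_scaleR: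
  assumes "open W" "smooth_fun A W f" "smooth_field A W X"
  shows "smooth_field A W (\<lambda>p. f p *\<^sub>R X p)"
  unfolding smooth_field_def
proof
  fix c assume c: "c \<in> A"
  note ca = atlas_admissible[OF c]
  have "smooth_on (snd c ` (W \<inter> fst c)) (\<lambda>x. (f \<circ> chart_inv c) x *\<^sub>R field_rep A c X x)"
    using assms c unfolding smooth_field_def smooth_fun_def by (intro smooth_on_scaleR open_image[OF ca]) blast+
  then show "smooth_on (snd c ` (W \<inter> fst c)) (field_rep A c (\<lambda>p. f p *\<^sub>R X p))"
    by (subst smooth_on_cong[OF open_image[OF ca assms(1)]])
      (auto simp: field_rep_chart[OF ca] linear_scale[OF linear_tcoord[OF ca]] chart_inv_left[OF admissible_is_chart[OF ca]])
qed

lemma field_through: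
  obtains W X where "open W" "p \<in> W" "smooth_field A W X" "X p = v"
proof
  let ?c = "chart_at A p"
  show "open (fst ?c)" "p \<in> fst ?c" using open_fst[OF admissible_chart_at] chart_at(2) by auto
  show "smooth_field A (fst ?c) (chart_field A ?c (\<lambda>x. v))"
    using open_image[OF admissible_chart_at[of p] open_fst[OF admissible_chart_at[of p]]]
    by (intro smooth_chart_field admissible_chart_at open_fst) auto
  show "chart_field A ?c (\<lambda>x. v) p = v"
    using tcoord_chart_field[OF admissible_chart_at chart_at(2), of p "\<lambda>x. v"] by simp
qed

section \<open>Tangent vectors as velocities of curves\<close>

lemma tangent_curve_chart:
  assumes "v \<in> tangent_space A K p"
  obtains \<gamma> e where "e > 0" "\<gamma> 0 = p" "\<gamma> ` {-e<..<e} \<subseteq> K \<inter> fst (chart_at A p)"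
    "smooth_on {-e<..<e} (snd (chart_at A p) \<circ> \<gamma>)"
    "((snd (chart_at A p) \<circ> \<gamma>) has_vector_derivative v) (at 0)"
  using assms unfolding tangent_space_def by blast

text \<open>Continuity of \<open>\<gamma>\<close> is available only in coordinates, so the
  neighbourhood \<open>W\<close> is pulled back through the chart.\<close>

lemma curve_eventually_in:
  assumes "admissible c" and e: "e > 0" and \<gamma>: "\<gamma> ` {-e<..<e::real} \<subseteq> fst c"
    and cont: "continuous_on {-e<..<e} (snd c \<circ> \<gamma>)" and W: "open W" "\<gamma> 0 \<in> W"
  obtains d where "0 < d" "d \<le> e" "\<gamma> ` {-d<..<d} \<subseteq> W"
proof -
  have "open ({-e<..<e} \<inter> (snd c \<circ> \<gamma>) -` (snd c ` (W \<inter> fst c)))"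
    by (rule continuous_open_preimage[OF cont _ open_image[OF assms(1) W(1)]]) simp
  moreover have "\<gamma> 0 \<in> fst c" using e \<gamma> by auto
  then have "0 \<in> {-e<..<e} \<inter> (snd c \<circ> \<gamma>) -` (snd c ` (W \<inter> fst c))" using e W(2) by simp
  ultimately obtain d where d: "d > 0" "ball 0 d \<subseteq> {-e<..<e} \<inter> (snd c \<circ> \<gamma>) -` (snd c ` (W \<inter> fst c))"
    using open_contains_ball by blast
  have "\<gamma> t \<in> W" if "t \<in> {-min d e<..<min d e}" for t
  proof -
    have "t \<in> ball 0 d" "t \<in> {-e<..<e}" using that by auto
    then have "snd c (\<gamma> t) \<in> snd c ` (W \<inter> fst c)" "\<gamma> t \<in> fst c" using d(2) \<gamma> by auto
    then obtain w where "w \<in> W \<inter> fst c" "snd c (\<gamma> t) = snd c w" "\<gamma> t \<in> fst c" by blast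
    then have "w = \<gamma> t" using chart_inv_left[OF admissible_is_chart[OF assms(1)]] by (metis IntE)
    then show ?thesis using \<open>w \<in> _\<close> by simp
  qed
  then have "\<gamma> ` {-min d e<..<min d e} \<subseteq> W" by blast
  then show ?thesis using that[of "min d e"] d(1) e by simp
qed

lemma tangent_space_mono: "K \<subseteq> K' \<Longrightarrow> tangent_space A K p \<subseteq> tangent_space A K' p"
  unfolding tangent_space_def by blast

lemma tangent_space_Int_open:
  assumes "open B" "p \<in> B"
  shows "tangent_space A (K \<inter> B) p = tangent_space A K p"
proof
  show "tangent_space A (K \<inter> B) p \<subseteq> tangent_space A K p" by (rule tangent_space_mono) simp
  show "tangent_space A K p \<subseteq> tangent_space A (K \<inter> B) p"
  proof
    fix v assume "v \<in> tangent_space A K p"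
    then obtain \<gamma> e where \<gamma>: "e > 0" "\<gamma> 0 = p" "\<gamma> ` {-e<..<e} \<subseteq> K \<inter> fst (chart_at A p)"
      "smooth_on {-e<..<e} (snd (chart_at A p) \<circ> \<gamma>)"
      "((snd (chart_at A p) \<circ> \<gamma>) has_vector_derivative v) (at 0)"
      by (rule tangent_curve_chart)
    obtain d where d: "0 < d" "d \<le> e" "\<gamma> ` {-d<..<d} \<subseteq> B"
      using curve_eventually_in[OF admissible_chart_at \<gamma>(1) _ smooth_on_continuous[OF \<gamma>(4)] assms(1)] \<gamma>(2,3) assms(2)
      by blast
    have "{-d<..<d} \<subseteq> {-e<..<e}" using d by auto
    then show "v \<in> tangent_space A (K \<inter> B) p"
      using \<gamma> d smooth_on_subset[OF \<gamma>(4)] unfolding tangent_space_def by blast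
  qed
qed

text \<open>A vector tangent to \<open>K\<close> is the velocity of a curve in \<open>K\<close>,
  along which the two functions coincide. This is why extensions off \<open>M\<close> may be chosen
  freely.\<close>

lemma vec_deriv_tangent_cong:
  assumes W: "open W" "p \<in> W" and f: "smooth_fun A W f" and h: "smooth_fun A W h"
    and K: "\<And>q. q \<in> K \<inter> W \<Longrightarrow> f q = h q" and v: "v \<in> tangent_space A K p"
  shows "vec_deriv A p v f = vec_deriv A p v h"
proof -
  let ?c = "chart_at A p"
  have "v \<in> tangent_space A (K \<inter> W) p" using v tangent_space_Int_open[OF W] by simp
  then obtain \<gamma> e where \<gamma>: "e > 0" "\<gamma> 0 = p" "\<gamma> ` {-e<..<e} \<subseteq> (K \<inter> W) \<inter> fst ?c"
    "smooth_on {-e<..<e} (snd ?c \<circ> \<gamma>)" "((snd ?c \<circ> \<gamma>) has_vector_derivative v) (at 0)"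
    by (rule tangent_curve_chart)
  have chain: "((f \<circ> chart_inv ?c \<circ> (snd ?c \<circ> \<gamma>)) has_derivative
      (\<lambda>t. frechet_derivative (f \<circ> chart_inv ?c) (at (snd ?c p)) (t *\<^sub>R v))) (at 0)"
    if "smooth_fun A W f" for f
  proof -
    have "(f \<circ> chart_inv ?c has_derivative frechet_derivative (f \<circ> chart_inv ?c) (at (snd ?c p))) (at ((snd ?c \<circ> \<gamma>) 0))"
      using smooth_on_has_derivative[OF smooth_fun_chart[OF W(1) that admissible_chart_at]
          open_image[OF admissible_chart_at W(1)]] W(2) chart_at(2) \<gamma>(2) by simp
    from diff_chain_at[OF \<gamma>(5)[unfolded has_vector_derivative_def] this] show ?thesis by (simp add: comp_def)
  qed
  have "((f \<circ> chart_inv ?c \<circ> (snd ?c \<circ> \<gamma>)) has_derivative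
      (\<lambda>t. frechet_derivative (h \<circ> chart_inv ?c) (at (snd ?c p)) (t *\<^sub>R v))) (at 0)"
  proof (rule has_derivative_transform_within_open[OF chain[OF h] open_greaterThanLessThan[of "-e" e]])
    show "(h \<circ> chart_inv ?c \<circ> (snd ?c \<circ> \<gamma>)) t = (f \<circ> chart_inv ?c \<circ> (snd ?c \<circ> \<gamma>)) t" if "t \<in> {-e<..<e}" for t
      using \<gamma>(3) that K chart_inv_left[OF admissible_is_chart[OF admissible_chart_at]] by (auto simp: image_subset_iff)
  qed (use \<gamma>(1) in auto)
  from fun_cong[OF has_derivative_unique[OF chain[OF f] this], of 1]
  show ?thesis by (simp add: vec_deriv_def)
qed

lemma vec_deriv_const [simp]: "vec_deriv A p v (\<lambda>q. k) = 0"
  by (simp add: vec_deriv_def comp_def)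

text \<open>In coordinates, a curve in the slice has its velocity in \<open>V\<close>. Conversely,
  the straight coordinate segment in direction \<open>tcoord A c p v\<close> remains in
  \<open>V\<close> and realises \<open>v\<close>.\<close>

lemma tangent_space_slice:
  assumes c: "admissible c" and p: "p \<in> K" "p \<in> fst c" and V: "subspace V"
    and slice: "snd c ` (fst c \<inter> K) = snd c ` fst c \<inter> V"
  shows "tangent_space A K p = {v. tcoord A c p v \<in> V}"
proof (intro set_eqI iffI)
  let ?a = "chart_at A p"
  note inv = chart_inv_left[OF admissible_is_chart]
  note ca = admissible_chart_at[of p]
  fix v assume "v \<in> tangent_space A K p"
  then have "v \<in> tangent_space A (K \<inter> fst c) p" using tangent_space_Int_open[OF open_fst[OF c] p(2)] by simp
  then obtain \<gamma> e where \<gamma>: "e > 0" "\<gamma> 0 = p" "\<gamma> ` {-e<..<e} \<subseteq> (K \<inter> fst c) \<inter> fst ?a"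
    "smooth_on {-e<..<e} (snd ?a \<circ> \<gamma>)" "((snd ?a \<circ> \<gamma>) has_vector_derivative v) (at 0)"
    by (rule tangent_curve_chart)
  have "((snd c \<circ> chart_inv ?a) has_derivative tcoord A c p) (at ((snd ?a \<circ> \<gamma>) 0))"
    using transition_has_derivative[OF ca c chart_at(2) p(2)] \<gamma>(2) by (simp add: tcoord_eq[abs_def])
  from diff_chain_at[OF \<gamma>(5)[unfolded has_vector_derivative_def] this]
  have "((snd c \<circ> chart_inv ?a \<circ> (snd ?a \<circ> \<gamma>)) has_vector_derivative tcoord A c p v) (at 0)"
    unfolding has_vector_derivative_def by (simp add: comp_def linear_scale[OF linear_tcoord[OF c p(2)]])
  moreover have "(snd c \<circ> chart_inv ?a \<circ> (snd ?a \<circ> \<gamma>)) t \<in> V" if "t \<in> {-e<..<e}" for t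
  proof -
    have "\<gamma> t \<in> K" "\<gamma> t \<in> fst c" "\<gamma> t \<in> fst ?a" using \<gamma>(3) that by auto
    then show ?thesis using inv[OF ca] slice by auto
  qed
  ultimately have "tcoord A c p v \<in> V" using derivative_in_subspace[OF V \<gamma>(1)] by blast
  then show "v \<in> {v. tcoord A c p v \<in> V}" by simp
next
  let ?a = "chart_at A p"
  note inv = chart_inv_left[OF admissible_is_chart]
  note ca = admissible_chart_at[of p]
  fix v assume "v \<in> {v. tcoord A c p v \<in> V}"
  then have v: "tcoord A c p v \<in> V" by simp
  define l where "l t = snd c p + t *\<^sub>R tcoord A c p v" for t :: real
  define T where "T = snd c ` (fst c \<inter> fst ?a)"
  have T: "open T" unfolding T_def by (rule open_overlap[OF c ca])
  have lc: "continuous_on UNIV l" unfolding l_def by (intro continuous_intros)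
  have "open (l -` T)" using continuous_open_preimage[OF lc open_UNIV T] by simp
  moreover have "0 \<in> l -` T" using p(2) chart_at(2) by (auto simp: l_def T_def)
  ultimately obtain e where e: "e > 0" "ball 0 e \<subseteq> l -` T" using open_contains_ball by blast
  define \<gamma> where "\<gamma> t = chart_inv c (l t)" for t
  have lT: "l t \<in> T" if "t \<in> {-e<..<e}" for t
  proof -
    have "t \<in> ball 0 e" using that by auto
    then show ?thesis using e(2) by blast
  qed
  have pV: "snd c p \<in> V" using slice p by auto
  have \<gamma>_mem: "\<gamma> t \<in> K \<inter> fst ?a" if "t \<in> {-e<..<e}" for t
  proof -
    have lt: "l t \<in> snd c ` fst c" "\<gamma> t \<in> fst ?a"
      using lT[OF that] by (auto simp: T_def \<gamma>_def inv[OF c])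
    have "l t \<in> V" unfolding l_def by (intro subspace_add subspace_scale V pV v)
    then obtain q where "q \<in> fst c \<inter> K" "l t = snd c q" using slice lt by blast
    then show ?thesis using lt(2) inv[OF c] by (simp add: \<gamma>_def)
  qed
  have l': "(l has_vector_derivative tcoord A c p v) (at 0)"
    unfolding l_def by (auto intro!: derivative_eq_intros)
  have eq: "snd ?a \<circ> \<gamma> = (\<lambda>t. (snd ?a \<circ> chart_inv c) (l t))" by (auto simp: \<gamma>_def)
  have ls: "smooth_on {-e<..<e} l" unfolding l_def
    by (intro smooth_on_add smooth_on_const smooth_on_linear open_greaterThanLessThan linearI)
      (auto simp: algebra_simps)
  have "smooth_on {-e<..<e} (snd ?a \<circ> \<gamma>)"
    unfolding eq by (rule smooth_on_compose[OF _ T _ ls transition_smooth[OF c ca, folded T_def]]) (use lT in auto)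
  moreover have "((snd ?a \<circ> \<gamma>) has_vector_derivative v) (at 0)"
  proof -
    have "((snd ?a \<circ> chart_inv c) has_derivative transition_deriv c ?a (snd c p)) (at (l 0))"
      using transition_has_derivative[OF c ca p(2) chart_at(2)] by (simp add: l_def)
    from diff_chain_at[OF l'[unfolded has_vector_derivative_def] this]
    show ?thesis unfolding has_vector_derivative_def eq
      by (simp add: comp_def linear_scale[OF linear_transition_deriv[OF c ca p(2) chart_at(2)]] tcoord_inverse[OF c p(2)])
  qed
  moreover have "\<gamma> 0 = p" by (simp add: \<gamma>_def l_def inv[OF c p(2)])
  moreover have "\<gamma> ` {-e<..<e} \<subseteq> K \<inter> fst ?a" using \<gamma>_mem by blast
  ultimately show "v \<in> tangent_space A K p" unfolding tangent_space_def using e(1) by blast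
qed

lemma slice_tangent_dim:
  assumes c: "admissible c" and p: "p \<in> K" "p \<in> fst c" and V: "subspace V"
    and slice: "snd c ` (fst c \<inter> K) = snd c ` fst c \<inter> V"
  shows "subspace (tangent_space A K p)" "dim (tangent_space A K p) = dim V"
proof -
  let ?f = "transition_deriv c (chart_at A p) (snd c p)"
  have lin: "linear ?f" by (rule linear_transition_deriv[OF c admissible_chart_at p(2) chart_at(2)])
  have tr: "tcoord A c p (?f v) = v" for v
    using tcoord_chart_field[OF c p(2), of "\<lambda>_. v"] by (simp add: chart_field_def)
  have eq: "tangent_space A K p = ?f ` V"
    unfolding tangent_space_slice[OF c p V slice]
  proof (intro set_eqI iffI)
    show "v \<in> ?f ` V" if "v \<in> {v. tcoord A c p v \<in> V}" for v
      using that tcoord_inverse[OF c p(2), of v] by (metis imageI mem_Collect_eq)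
  qed (auto simp: tr)
  have "inj ?f" by (rule inj_on_inverseI[where g = "tcoord A c p"]) (rule tr)
  then show "dim (tangent_space A K p) = dim V"
    unfolding eq by (intro dim_image_eq lin) (auto intro: inj_on_subset)
  show "subspace (tangent_space A K p)" unfolding eq by (rule linear_subspace_image[OF lin V])
qed

lemma tangent_space_mem: "v \<in> tangent_space A K p \<Longrightarrow> p \<in> K"
  using tangent_curve_chart[of v K p] by (metis IntD1 greaterThanLessThan_iff image_subset_iff neg_less_0_iff_less)

lemma open_smooth_fun_nonzero:
  assumes W: "open W" and f: "smooth_fun A W f"
  shows "open {m \<in> W. f m \<noteq> 0}"
proof (subst open_subopen, intro ballI)
  fix p assume p: "p \<in> {m \<in> W. f m \<noteq> 0}"
  let ?c = "chart_at A p"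
  note inv = chart_inv_left[OF admissible_is_chart[OF admissible_chart_at[of p]]]
  let ?B = "snd ?c ` (W \<inter> fst ?c) \<inter> (f \<circ> chart_inv ?c) -` (- {0})"
  have "open ?B"
    by (rule continuous_open_preimage[OF smooth_on_continuous[OF smooth_fun_chart[OF W f admissible_chart_at]]
          open_image[OF admissible_chart_at W]]) (simp add: open_Compl)
  then have "open (fst ?c \<inter> snd ?c -` ?B)"
    by (rule open_chart_preimage[OF admissible_is_chart[OF admissible_chart_at]])
  moreover have "p \<in> fst ?c \<inter> snd ?c -` ?B" using p chart_at(2) inv by auto
  moreover have "fst ?c \<inter> snd ?c -` ?B \<subseteq> {m \<in> W. f m \<noteq> 0}"
  proof
    fix m assume "m \<in> fst ?c \<inter> snd ?c -` ?B"
    then have m: "m \<in> fst ?c" "f (chart_inv ?c (snd ?c m)) \<noteq> 0" "snd ?c m \<in> snd ?c ` (W \<inter> fst ?c)" by auto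
    then obtain m' where m': "m' \<in> W" "m' \<in> fst ?c" "snd ?c m = snd ?c m'" by blast
    from arg_cong[OF m'(3), of "chart_inv ?c"] have "m = m'" by (simp only: inv m(1) m'(2))
    then show "m \<in> {m \<in> W. f m \<noteq> 0}" using m' m(2) inv[OF m(1)] by simp
  qed
  ultimately show "\<exists>T. open T \<and> p \<in> T \<and> T \<subseteq> {m \<in> W. f m \<noteq> 0}" by blast
qed

text \<open>Differentiating the transformation rule of components leaves a term with second
  derivatives of the coordinate change. Their symmetry moves \<open>X p\<close> into the direction
  of differentiation, the form in which the terms of two fields can be compared in a
  bracket.\<close>

lemma field_rep_derivative:
  assumes c: "admissible c" and W: "open W" "p \<in> W" "p \<in> fst c" and X: "smooth_field A W X"
  defines "a \<equiv> chart_at A p"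
  shows "frechet_derivative (field_rep A c X) (at (snd c p)) (tcoord A c p w) =
    frechet_derivative (\<lambda>y. transition_deriv a c y w) (at (snd a p)) (X p) +
    tcoord A c p (frechet_derivative (field_rep A a X) (at (snd a p)) w)"
proof -
  note inv = chart_inv_left[OF admissible_is_chart]
  have a: "admissible a" "p \<in> fst a" unfolding a_def by (simp_all add: admissible_chart_at chart_at(2))
  define \<eta> where "\<eta> = snd c \<circ> chart_inv a"
  let ?D = "\<lambda>y v. frechet_derivative \<eta> (at y) v"
  have D_eq: "transition_deriv a c y = ?D y" for y by (simp add: transition_deriv_def \<eta>_def)
  define T where "T = snd a ` ((W \<inter> fst c) \<inter> fst a)"
  have T: "open T" "snd a p \<in> T"
    unfolding T_def using open_image[OF a(1)] W open_fst[OF c] a(2) by auto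
  have \<eta>: "smooth_on T \<eta>"
    unfolding \<eta>_def T_def by (rule smooth_on_subset[OF transition_smooth[OF a(1) c]]) auto
  have Xa: "smooth_on T (field_rep A a X)"
    unfolding T_def by (rule smooth_on_subset[OF smooth_field_chart[OF W(1) X a(1)]]) auto
  have z: "field_rep A a X (snd a p) = X p" using field_rep_chart[OF a] by (simp add: a_def)
  have "((\<lambda>y. ?D y (field_rep A a X y)) has_derivative
      (\<lambda>w. (\<Sum>b\<in>Basis. (X p \<bullet> b) *\<^sub>R frechet_derivative (\<lambda>y. ?D y b) (at (snd a p)) w) +
        ?D (snd a p) (frechet_derivative (field_rep A a X) (at (snd a p)) w))) (at (snd a p))"
    unfolding z[symmetric]
    by (rule family_has_derivative[OF T smooth_on_frechet_linear[OF \<eta> T(1)]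
          smooth_on_has_derivative[OF smooth_on_derivative[OF \<eta>] T] smooth_on_has_derivative[OF Xa T]])
  note 1 = this
  have "((field_rep A c X \<circ> \<eta>) has_derivative
      frechet_derivative (field_rep A c X) (at (snd c p)) \<circ> ?D (snd a p)) (at (snd a p))"
  proof (rule diff_chain_at)
    show "(\<eta> has_derivative ?D (snd a p)) (at (snd a p))" by (rule smooth_on_has_derivative[OF \<eta> T])
    show "(field_rep A c X has_derivative frechet_derivative (field_rep A c X) (at (snd c p))) (at (\<eta> (snd a p)))"
      using smooth_on_has_derivative[OF smooth_field_chart[OF W(1) X c] open_image[OF c W(1)]] W
      by (simp add: \<eta>_def inv[OF a])
  qed
  then have "((\<lambda>y. ?D y (field_rep A a X y)) has_derivative
      frechet_derivative (field_rep A c X) (at (snd c p)) \<circ> ?D (snd a p)) (at (snd a p))"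
  proof (rule has_derivative_transform_within_open[OF _ T])
    fix y assume "y \<in> T"
    then obtain q where q: "q \<in> fst c" "q \<in> fst a" "y = snd a q" by (auto simp: T_def)
    then show "(field_rep A c X \<circ> \<eta>) y = ?D y (field_rep A a X y)"
      using tcoord_change[OF a(1) c q(2,1)]
      by (simp add: \<eta>_def[symmetric] D_eq[symmetric] field_rep_chart[OF c] field_rep_chart[OF a(1)])
        (simp add: \<eta>_def inv[OF a(1)] field_rep_chart[OF c])
  qed
  from fun_cong[OF has_derivative_unique[OF this 1], of w]
  have "(frechet_derivative (field_rep A c X) (at (snd c p)) \<circ> ?D (snd a p)) w =
      (\<Sum>b\<in>Basis. (X p \<bullet> b) *\<^sub>R frechet_derivative (\<lambda>y. ?D y b) (at (snd a p)) w) +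
        ?D (snd a p) (frechet_derivative (field_rep A a X) (at (snd a p)) w)"
    .
  also have "(\<Sum>b\<in>Basis. (X p \<bullet> b) *\<^sub>R frechet_derivative (\<lambda>y. ?D y b) (at (snd a p)) w) =
      (\<Sum>b\<in>Basis. (X p \<bullet> b) *\<^sub>R frechet_derivative (\<lambda>y. ?D y w) (at (snd a p)) b)"
    by (simp add: second_derivative_symmetric[OF T(1) \<eta> T(2), of _ w])
  also have "\<dots> = frechet_derivative (\<lambda>y. ?D y w) (at (snd a p)) (X p)"
    by (rule linear_basis_expand[OF smooth_on_frechet_linear[OF smooth_on_derivative[OF \<eta>] T], symmetric])
  finally show ?thesis
    by (simp add: tcoord_eq a_def[symmetric] D_eq)
qed

text \<open>\<open>lie_bracket\<close> is computed in the selected chart. The second-derivative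
  terms of \<open>X\<close> and \<open>Y\<close> are equal by symmetry and cancel, so the coordinate
  formula holds in every admissible chart, in particular in a slice chart.\<close>

lemma tcoord_lie_bracket:
  assumes c: "admissible c" and W: "open W" "p \<in> W" "p \<in> fst c"
    and X: "smooth_field A W X" and Y: "smooth_field A W Y"
  shows "tcoord A c p (lie_bracket A X Y p) =
    frechet_derivative (field_rep A c Y) (at (snd c p)) (tcoord A c p (X p)) -
    frechet_derivative (field_rep A c X) (at (snd c p)) (tcoord A c p (Y p))"
proof -
  let ?a = "chart_at A p"
  let ?\<eta> = "snd c \<circ> chart_inv ?a"
  have sym: "frechet_derivative (\<lambda>y. transition_deriv ?a c y v) (at (snd ?a p)) w =
      frechet_derivative (\<lambda>y. transition_deriv ?a c y w) (at (snd ?a p)) v" for v w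
    unfolding transition_deriv_def
    by (rule second_derivative_symmetric[OF open_overlap transition_smooth])
      (use admissible_chart_at c W chart_at(2) in auto)
  show ?thesis
    unfolding lie_bracket_def Let_def
    by (simp add: field_rep_derivative[OF c W X] field_rep_derivative[OF c W Y]
        sym[of "X p" "Y p"] linear_diff[OF linear_tcoord[OF c W(3)]])
qed

text \<open>A straightening map of coordinate space becomes a chart of the manifold. This is how an
  integral manifold obtains the slice chart that \<open>submanifold\<close> requires; the formula
  for \<open>tcoord\<close> then identifies its tangent space.\<close>

lemma admissible_compose:
  assumes c: "admissible c" and Q: "open Q" "Q \<subseteq> snd c ` fst c" and R: "open R"
    and \<Phi>: "smooth_on Q \<Phi>" "\<And>x. x \<in> Q \<Longrightarrow> \<Phi> x \<in> R" and \<Psi>: "smooth_on R \<Psi>" "\<And>z. z \<in> R \<Longrightarrow> \<Psi> z \<in> Q"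
    and inverse: "\<And>x. x \<in> Q \<Longrightarrow> \<Psi> (\<Phi> x) = x" "\<And>z. z \<in> R \<Longrightarrow> \<Phi> (\<Psi> z) = z"
  defines "c' \<equiv> (fst c \<inter> snd c -` Q, \<lambda>m. \<Phi> (snd c m))"
  shows "admissible c'" "snd c' ` fst c' = R" "\<And>z. z \<in> R \<Longrightarrow> chart_inv c' z = chart_inv c (\<Psi> z)"
    "\<And>m v. m \<in> fst c' \<Longrightarrow> tcoord A c' m v = frechet_derivative \<Phi> (at (snd c m)) (tcoord A c m v)"
proof -
  note cc = admissible_is_chart[OF c]
  have invQ: "snd c (chart_inv c x) = x" "chart_inv c x \<in> fst c" if "x \<in> Q" for x
    using chart_inv_right[OF cc] chart_inv_mem[OF cc] that Q(2) by auto
  have mem: "chart_inv c (\<Psi> z) \<in> fst c'" "snd c' (chart_inv c (\<Psi> z)) = z" if "z \<in> R" for z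
    using invQ[OF \<Psi>(2)[OF that]] inverse(2)[OF that] \<Psi>(2)[OF that] by (auto simp: c'_def)
  show img: "snd c' ` fst c' = R"
    using mem \<Phi>(2) by (force simp: c'_def)
  have inj: "inj_on (snd c') (fst c')"
  proof (rule inj_onI)
    fix m m' assume m: "m \<in> fst c'" "m' \<in> fst c'" "snd c' m = snd c' m'"
    then have "snd c m = snd c m'" using inverse(1) by (auto simp: c'_def) metis
    then show "m = m'" using m chart_inv_left[OF cc] by (auto simp: c'_def) metis
  qed
  show inv: "chart_inv c' z = chart_inv c (\<Psi> z)" if "z \<in> R" for z
    unfolding chart_inv_def[of c'] using inv_into_f_f[OF inj mem(1)[OF that]] mem(2)[OF that] by simp
  have open': "open (fst c')" unfolding c'_def fst_conv by (rule open_chart_preimage[OF cc Q(1)])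
  have \<Phi>_cont: "continuous_on Q \<Phi>" and \<Psi>_cont: "continuous_on R \<Psi>" using \<Phi>(1) \<Psi>(1) smooth_on_continuous by auto
  have cont: "continuous_on (fst c) (snd c)" "continuous_on (snd c ` fst c) (chart_inv c)"
    using cc by (auto simp: is_chart_def homeomorphism_def)
  have chart': "is_chart c'"
    unfolding is_chart_def img
  proof (intro conjI open' R homeomorphismI)
    show "continuous_on (fst c') (snd c')"
      unfolding c'_def by (auto intro!: continuous_on_compose2[OF \<Phi>_cont] continuous_on_subset[OF cont(1)])
    have "continuous_on R (\<lambda>z. chart_inv c (\<Psi> z))"
      by (rule continuous_on_compose2[OF cont(2) \<Psi>_cont]) (use \<Psi>(2) Q(2) in auto)
    then show "continuous_on R (chart_inv c')" by (rule continuous_on_eq) (simp add: inv)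
    show "snd c' ` fst c' \<subseteq> R" using img by simp
    show "chart_inv c' ` R \<subseteq> fst c'" using inv mem by auto
    show "chart_inv c' (snd c' m) = m" if "m \<in> fst c'" for m
      using that inv_into_f_f[OF inj that] by (simp add: chart_inv_def[of c'])
    show "snd c' (chart_inv c' z) = z" if "z \<in> R" for z using inv mem that by simp
  qed
  have compat: "compatible c' d" if d: "d \<in> A" for d
    unfolding compatible_def
  proof
    note da = atlas_admissible[OF d]
    have o: "open (snd c' ` (fst c' \<inter> fst d))"
      using open_chart_image[OF chart' open_fst[OF da]] by (simp add: Int_commute)
    have "smooth_on (snd c' ` (fst c' \<inter> fst d)) (\<lambda>z. (snd d \<circ> chart_inv c) (\<Psi> z))"
    proof (rule smooth_on_compose[OF o open_overlap[OF c da] _ _ transition_smooth[OF c da]])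
      show "\<Psi> ` snd c' ` (fst c' \<inter> fst d) \<subseteq> snd c ` (fst c \<inter> fst d)"
        using inverse(1) by (auto simp: c'_def)
      show "smooth_on (snd c' ` (fst c' \<inter> fst d)) \<Psi>"
        by (rule smooth_on_subset[OF \<Psi>(1)]) (use img in auto)
    qed
    then show "smooth_on (snd c' ` (fst c' \<inter> fst d)) (snd d \<circ> chart_inv c')"
      by (subst smooth_on_cong[OF o, of _ "\<lambda>z. (snd d \<circ> chart_inv c) (\<Psi> z)"]) (use inv img in auto)
    have o': "open (snd d ` (fst c' \<inter> fst d))" by (rule open_image[OF da open'])
    have "smooth_on (snd d ` (fst c' \<inter> fst d)) (\<lambda>y. \<Phi> ((snd c \<circ> chart_inv d) y))"
    proof (rule smooth_on_compose[OF o' Q(1) _ _ \<Phi>(1)])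
      show "(snd c \<circ> chart_inv d) ` snd d ` (fst c' \<inter> fst d) \<subseteq> Q"
        using chart_inv_left[OF admissible_is_chart[OF da]] by (auto simp: c'_def)
      show "smooth_on (snd d ` (fst c' \<inter> fst d)) (snd c \<circ> chart_inv d)"
        by (rule smooth_on_subset[OF transition_smooth[OF da c]]) (auto simp: c'_def)
    qed
    then show "smooth_on (snd d ` (fst c' \<inter> fst d)) (snd c' \<circ> chart_inv d)"
      by (simp add: c'_def comp_def)
  qed
  show adm: "admissible c'" using chart' compat by (simp add: admissible_def)
  show "tcoord A c' m v = frechet_derivative \<Phi> (at (snd c m)) (tcoord A c m v)" if m: "m \<in> fst c'" for m v
  proof -
    have mc: "m \<in> fst c" "snd c m \<in> Q" using m by (auto simp: c'_def)
    have "(\<Phi> has_derivative frechet_derivative \<Phi> (at (snd c m))) (at (snd c m))"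
      by (rule smooth_on_has_derivative[OF \<Phi>(1) Q(1) mc(2)])
    then have "(snd c' \<circ> chart_inv c has_derivative frechet_derivative \<Phi> (at (snd c m))) (at (snd c m))"
      by (rule has_derivative_transform_within_open[OF _ Q(1) mc(2)]) (use invQ in \<open>auto simp: c'_def\<close>)
    then have "transition_deriv c c' (snd c m) = frechet_derivative \<Phi> (at (snd c m))"
      using transition_has_derivative[OF c adm mc(1) m] has_derivative_unique by blast
    then show ?thesis using tcoord_change[OF c adm mc(1) m] by simp
  qed
qed

end

section \<open>Null hypersurfaces with a screen distribution\<close>

locale semi_riemannian_manifold = smooth_manifold A
  for A :: "('m::topological_space, 'e::euclidean_space) chart set" +
  fixes g :: "'m \<Rightarrow> 'e \<Rightarrow> 'e \<Rightarrow> real" and D :: "'m \<Rightarrow> 'e \<Rightarrow> ('m \<Rightarrow> 'e) \<Rightarrow> 'e" and q :: nat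
  assumes metric: "semi_riemannian_metric A g q"
    and connection: "levi_civita A g D"
begin

lemma g_bilinear: "bilinear (g p)"
  and g_sym: "g p v w = g p w v"
  using metric unfolding semi_riemannian_metric_def by auto

lemma g_nondegenerate: "(\<And>w. g p v w = 0) \<Longrightarrow> v = 0"
  using metric unfolding semi_riemannian_metric_def nondegenerate_on_def by blast

lemmas g_simps =
  bilinear_ladd[OF g_bilinear] bilinear_radd[OF g_bilinear]
  bilinear_lsub[OF g_bilinear] bilinear_rsub[OF g_bilinear]
  bilinear_lmul[OF g_bilinear] bilinear_rmul[OF g_bilinear]
  bilinear_lneg[OF g_bilinear] bilinear_rneg[OF g_bilinear]
  bilinear_lzero[OF g_bilinear] bilinear_rzero[OF g_bilinear]

lemma g_eqI: "(\<And>w. g p v w = g p v' w) \<Longrightarrow> v = v'"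
  using g_nondegenerate[of p "v - v'"] by (simp add: g_simps)

lemma g_polarization:
  assumes "subspace V" "\<And>v. v \<in> V \<Longrightarrow> g p v v = 0" "v \<in> V" "w \<in> V"
  shows "g p v w = 0"
proof -
  have "g p (v + w) (v + w) = 0" by (intro assms subspace_add)
  then show ?thesis using assms(2)[OF assms(3)] assms(2)[OF assms(4)] g_sym[of p w v] by (simp add: g_simps)
qed

lemma smooth_g: "open W \<Longrightarrow> smooth_field A W X \<Longrightarrow> smooth_field A W Y \<Longrightarrow> smooth_fun A W (\<lambda>p. g p (X p) (Y p))"
  using metric unfolding semi_riemannian_metric_def by blast

context
  fixes W X Y
  assumes W: "open W" "smooth_field A W X" "smooth_field A W Y"
begin

lemmas connection_laws =
  connection[unfolded levi_civita_def, THEN spec[of _ W], THEN spec[of _ X], THEN spec[of _ Y],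
    THEN mp, OF conjI[OF W(1) conjI[OF W(2,3)]]]

lemma D_smooth: "smooth_field A W (\<lambda>p. D p (X p) Y)"
  by (rule connection_laws[THEN conjunct2, THEN conjunct2, THEN conjunct2, THEN conjunct2, THEN conjunct1])

lemma D_torsion: "p \<in> W \<Longrightarrow> D p (X p) Y - D p (Y p) X = lie_bracket A X Y p"
  by (rule connection_laws[THEN conjunct2, THEN conjunct2, THEN conjunct2, THEN conjunct2, THEN conjunct2,
        THEN conjunct1, THEN bspec])

lemma D_metric:
  "p \<in> W \<Longrightarrow> vec_deriv A p v (\<lambda>q. g q (X q) (Y q)) = g p (D p v X) (Y p) + g p (X p) (D p v Y)"
  by (rule connection_laws[THEN conjunct2, THEN conjunct2, THEN conjunct2, THEN conjunct2, THEN conjunct2,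
        THEN conjunct2, THEN bspec, THEN spec])

end

text \<open>Constancy along \<open>K\<close> is enough, as \<open>v\<close> is tangent to
  \<open>K\<close>. This is the source of the formulas that move a derivative from a field to
  \<open>\<xi>\<close> or \<open>N\<close>.\<close>

lemma covariant_derivative_constant_product:
  assumes W: "open W" "p \<in> W" and X: "smooth_field A W X" and Y: "smooth_field A W Y"
    and k: "\<And>q. q \<in> K \<inter> W \<Longrightarrow> g q (X q) (Y q) = k" and v: "v \<in> tangent_space A K p"
  shows "g p (D p v X) (Y p) + g p (X p) (D p v Y) = 0"
  using D_metric[OF W(1) X Y W(2), of v]
    vec_deriv_tangent_cong[OF W smooth_g[OF W(1) X Y] smooth_fun_const[OF W(1)] k v] by simp

text \<open>Nondegeneracy reduces the claim to products with a vector \<open>w\<close>. Extending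
  \<open>w\<close> to a field turns these into derivatives of functions that agree along
  \<open>K\<close>.\<close>

lemma D_tangent_cong:
  assumes W: "open W" "p \<in> W" and X: "smooth_field A W X" and Y: "smooth_field A W Y"
    and eq: "\<And>q. q \<in> K \<inter> W \<Longrightarrow> X q = Y q" and v: "v \<in> tangent_space A K p"
  shows "D p v X = D p v Y"
proof (rule g_eqI)
  fix w
  obtain W' Z where Z: "open W'" "p \<in> W'" "smooth_field A W' Z" "Z p = w" by (rule field_through)
  define U where "U = W \<inter> W'"
  have U: "open U" "p \<in> U" using W Z by (auto simp: U_def)
  have s: "smooth_field A U X" "smooth_field A U Y" "smooth_field A U Z"
    using X Y Z(3) smooth_field_subset unfolding U_def by (blast intro: Int_lower1 Int_lower2)+
  have "vec_deriv A p v (\<lambda>q. g q (X q) (Z q)) = vec_deriv A p v (\<lambda>q. g q (Y q) (Z q))"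
    by (rule vec_deriv_tangent_cong[OF U smooth_g[OF U(1) s(1,3)] smooth_g[OF U(1) s(2,3)] _ v])
      (use eq in \<open>auto simp: U_def\<close>)
  moreover have "X p = Y p" using eq W(2) tangent_space_mem[OF v] by blast
  ultimately show "g p (D p v X) w = g p (D p v Y) w"
    by (simp add: D_metric[OF U(1) s(1,3) U(2)] D_metric[OF U(1) s(2,3) U(2)] Z(4))
qed

text \<open>Frees \<open>cov_along\<close> from its choice operator: any extension computes it in
  tangent directions.\<close>

lemma cov_along_eq:
  assumes Z: "field_extension A K Y p Z" and v: "v \<in> tangent_space A K p"
  shows "cov_along A D K p v Y = D p v Z"
proof -
  define Z' where "Z' = (SOME Z. field_extension A K Y p Z)"
  have "field_extension A K Y p Z'" unfolding Z'_def by (rule someI[of "field_extension A K Y p", OF Z])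
  then obtain W' where W': "open W'" "p \<in> W'" "smooth_field A W' Z'" "\<And>q. q \<in> K \<inter> W' \<Longrightarrow> Z' q = Y q"
    unfolding field_extension_def by blast
  obtain W where W: "open W" "p \<in> W" "smooth_field A W Z" "\<And>q. q \<in> K \<inter> W \<Longrightarrow> Z q = Y q"
    using Z unfolding field_extension_def by blast
  have "D p v Z' = D p v Z"
    by (rule D_tangent_cong[of "W \<inter> W'" _ _ _ K])
      (use W W' v in \<open>auto intro: smooth_field_subset\<close>)
  then show ?thesis by (simp add: cov_along_def Z'_def)
qed

end

locale null_hypersurface_with_screen = semi_riemannian_manifold A g D q
  for A :: "('m::topological_space, 'e::euclidean_space) chart set" and g D q +
  fixes M :: "'m set" and S :: "'m \<Rightarrow> 'e set" and n :: nat
  assumes dim: "DIM('e) = n + 2"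
    and null: "null_hypersurface A g M"
    and screen: "screen_distribution A g M S"
begin

lemma slice_chart:
  assumes "p \<in> M"
  obtains c V where "admissible c" "p \<in> fst c" "subspace V" "dim V = n + 1"
    "snd c ` (fst c \<inter> M) = snd c ` fst c \<inter> V"
proof -
  have "submanifold A (n + 1) M" using null dim by (simp add: null_hypersurface_def)
  then show ?thesis using assms that unfolding submanifold_def admissible_def by blast
qed

lemma tangent_M:
  assumes "p \<in> M"
  shows "subspace (tangent_space A M p)" "dim (tangent_space A M p) = n + 1"
proof -
  obtain c V where c: "admissible c" "p \<in> fst c" "subspace V" "dim V = n + 1"
    "snd c ` (fst c \<inter> M) = snd c ` fst c \<inter> V" using slice_chart[OF assms] by blast
  show "subspace (tangent_space A M p)" "dim (tangent_space A M p) = n + 1"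
    using slice_tangent_dim[OF c(1) assms c(2,3,5)] c(4) by auto
qed

lemma screen_facts:
  assumes "p \<in> M"
  shows "subspace (S p)" "dim (S p) = n" "S p \<subseteq> tangent_space A M p" "nondegenerate_on (g p) (S p)"
    "S p \<inter> normal_space A g M p = {0}"
    "{s + r | s r. s \<in> S p \<and> r \<in> normal_space A g M p} = tangent_space A M p"
proof -
  have "smooth_distribution A M n S" using screen dim by (simp add: screen_distribution_def)
  then obtain W E where "p \<in> W" "\<forall>q\<in>M \<inter> W. S q = span ((\<lambda>i::nat. E i q) ` {..<n}) \<and> dim (S q) = n"
    using assms unfolding smooth_distribution_def by blast
  then have "S p = span ((\<lambda>i::nat. E i p) ` {..<n})" "dim (S p) = n" using assms by blast+
  then show "subspace (S p)" "dim (S p) = n" by simp_all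
  show "S p \<subseteq> tangent_space A M p"
    using \<open>smooth_distribution A M n S\<close> assms unfolding smooth_distribution_def by blast
qed (use screen assms in \<open>unfold screen_distribution_def, blast+\<close>)

lemma normal_subset_tangent: "p \<in> M \<Longrightarrow> r \<in> normal_space A g M p \<Longrightarrow> r \<in> tangent_space A M p"
  using screen_facts(6)[of p] subspace_0[OF screen_facts(1)[of p]] by force

text \<open>Fields with constant components in a slice chart are tangent to \<open>M\<close> and commute.\<close>

lemma tangent_fields:
  assumes "p \<in> M"
  obtains W X where "open W" "p \<in> W" "\<And>m v. smooth_field A W (X m v)" "\<And>m v. m \<in> W \<Longrightarrow> X m v m = v"
    "\<And>m v m'. m \<in> M \<inter> W \<Longrightarrow> v \<in> tangent_space A M m \<Longrightarrow> m' \<in> M \<inter> W \<Longrightarrow> X m v m' \<in> tangent_space A M m'"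
    "\<And>m v w. m \<in> W \<Longrightarrow> D m v (X m w) = D m w (X m v)"
proof -
  obtain c V where c: "admissible c" "p \<in> fst c" and V: "subspace V" "dim V = n + 1"
    and slice: "snd c ` (fst c \<inter> M) = snd c ` fst c \<inter> V" by (rule slice_chart[OF assms])
  have oi: "open (snd c ` fst c)" using open_image[OF c(1) open_fst[OF c(1)]] by simp
  define X where "X m v = chart_field A c (\<lambda>_. tcoord A c m v)" for m v
  have smooth: "smooth_field A (fst c) (X m v)" for m v
    unfolding X_def using oi by (intro smooth_chart_field open_fst c(1)) auto
  have Xm: "X m v m = v" if "m \<in> fst c" for m v
    by (rule tcoord_inj[OF c(1) that]) (simp add: X_def tcoord_chart_field[OF c(1) that])
  have tangent: "X m v m' \<in> tangent_space A M m'"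
    if "m \<in> M \<inter> fst c" "v \<in> tangent_space A M m" "m' \<in> M \<inter> fst c" for m v m'
    using that tangent_space_slice[OF c(1) _ _ V(1) slice, of m] tangent_space_slice[OF c(1) _ _ V(1) slice, of m']
    by (simp add: X_def tcoord_chart_field[OF c(1)])
  have commute: "D m v (X m w) = D m w (X m v)" if m: "m \<in> fst c" for m v w
  proof -
    have "frechet_derivative (field_rep A c (X m v)) (at (snd c m)) w = 0" for v w
    proof -
      have "(field_rep A c (X m v) has_derivative (\<lambda>w. 0)) (at (snd c m))"
      proof (rule has_derivative_transform_within_open[OF _ oi])
        show "((\<lambda>_. tcoord A c m v) has_derivative (\<lambda>w. 0)) (at (snd c m))" by simp
      qed (use m field_rep_chart_field[OF c(1)] in \<open>auto simp: X_def\<close>)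
      then show ?thesis using frechet_derivative_at by metis
    qed
    then have "tcoord A c m (lie_bracket A (X m v) (X m w) m) = tcoord A c m 0"
      using tcoord_lie_bracket[OF c(1) open_fst[OF c(1)] m m smooth smooth]
      by (simp add: linear_0[OF linear_tcoord[OF c(1) m]])
    then have "lie_bracket A (X m v) (X m w) m = 0" by (rule tcoord_inj[OF c(1) m])
    then show ?thesis
      using D_torsion[OF open_fst[OF c(1)] smooth[of m v] smooth[of m w] m] by (simp add: Xm[OF m])
  qed
  show ?thesis by (rule that[OF open_fst[OF c(1)] c(2) smooth Xm tangent commute])
qed

end

locale null_pair_domain = null_hypersurface_with_screen A g D q M S n
  for A :: "('m::topological_space, 'e::euclidean_space) chart set" and g D q M S n +
  fixes U :: "'m set" and \<xi> N :: "'m \<Rightarrow> 'e"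
  assumes pair: "null_pair A g M S U \<xi> N"
begin

lemma U_open: obtains B where "open B" "U = M \<inter> B"
  using pair unfolding null_pair_def openin_open by blast

lemma U_subset: "p \<in> U \<Longrightarrow> p \<in> M"
  using U_open by blast

lemma tangent_U: "p \<in> U \<Longrightarrow> tangent_space A U p = tangent_space A M p"
  using U_open tangent_space_Int_open by (metis IntD2)

lemma pair_facts:
  assumes "p \<in> U"
  shows "\<xi> p \<in> normal_space A g M p" "\<xi> p \<noteq> 0" "g p (\<xi> p) (N p) = 1" "g p (N p) (\<xi> p) = 1"
    "g p (N p) (N p) = 0" "\<And>v. v \<in> S p \<Longrightarrow> g p (N p) v = 0" "\<And>v. v \<in> S p \<Longrightarrow> g p v (N p) = 0"
proof -
  show "\<xi> p \<in> normal_space A g M p" "\<xi> p \<noteq> 0" "g p (\<xi> p) (N p) = 1" "g p (N p) (N p) = 0"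
    and *: "\<And>v. v \<in> S p \<Longrightarrow> g p (N p) v = 0"
    using pair[unfolded null_pair_def, THEN conjunct2, THEN conjunct2, THEN conjunct2, THEN bspec, OF assms]
    by simp_all
  then show "g p (N p) (\<xi> p) = 1" using g_sym[of p "N p" "\<xi> p"] by simp
  show "g p v (N p) = 0" if "v \<in> S p" for v using *[OF that] g_sym[of p v "N p"] by simp
qed

text \<open>The hyperplane orthogonal to \<open>\<xi>\<close> contains the tangent space and misses
  \<open>N\<close>, so both have dimension \<open>n + 1\<close>. Tangency becomes one linear
  equation.\<close>

lemma tangent_eq:
  assumes "p \<in> U"
  shows "tangent_space A M p = {v. g p v (\<xi> p) = 0}"
proof -
  let ?H = "{v. g p v (\<xi> p) = 0}"
  note p = U_subset[OF assms]
  have H: "subspace ?H" by (auto simp: subspace_def g_simps)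
  have sub: "tangent_space A M p \<subseteq> ?H"
    using pair_facts(1)[OF assms] g_sym by (auto simp: normal_space_def)
  have "N p \<notin> ?H" using pair_facts(4)[OF assms] by simp
  then have "?H \<noteq> UNIV" by blast
  then have "dim ?H < DIM('e)"
    using dim_subset_UNIV[of ?H] dim_eq_full[of ?H] span_eq_iff[of ?H] H by (metis le_neq_implies_less)
  then have "dim ?H \<le> dim (tangent_space A M p)" using dim tangent_M[OF p] by simp
  then show ?thesis using subspace_dim_equal[OF tangent_M(1)[OF p] H sub] by simp
qed

lemma xi_facts:
  assumes "p \<in> U"
  shows "\<xi> p \<in> tangent_space A M p" "g p (\<xi> p) (\<xi> p) = 0"
    "\<And>v. v \<in> tangent_space A M p \<Longrightarrow> g p v (\<xi> p) = 0" "\<And>v. v \<in> tangent_space A M p \<Longrightarrow> g p (\<xi> p) v = 0"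
    "\<And>v. v \<in> S p \<Longrightarrow> g p v (\<xi> p) = 0"
proof -
  show *: "\<xi> p \<in> tangent_space A M p"
    by (rule normal_subset_tangent[OF U_subset[OF assms] pair_facts(1)[OF assms]])
  show **: "g p v (\<xi> p) = 0" if "v \<in> tangent_space A M p" for v
    using that tangent_eq[OF assms] by simp
  show "g p (\<xi> p) (\<xi> p) = 0" by (rule **[OF *])
  show "g p (\<xi> p) v = 0" if "v \<in> tangent_space A M p" for v
    using **[OF that] g_sym[of p v "\<xi> p"] by simp
  show "g p v (\<xi> p) = 0" if "v \<in> S p" for v
    using ** that screen_facts(3)[OF U_subset[OF assms]] by blast
qed

text \<open>The radical component of a tangent vector orthogonal to \<open>N\<close> is orthogonal
  to \<open>N\<close> and to the tangent space, which together span everything; hence it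
  vanishes.\<close>

lemma screen_eq:
  assumes "p \<in> U"
  shows "S p = {v \<in> tangent_space A M p. g p v (N p) = 0}"
proof (intro equalityI subsetI)
  note p = U_subset[OF assms]
  show "v \<in> {v \<in> tangent_space A M p. g p v (N p) = 0}" if "v \<in> S p" for v
    using that screen_facts(3)[OF p] pair_facts(7)[OF assms] by auto
  fix v assume v: "v \<in> {v \<in> tangent_space A M p. g p v (N p) = 0}"
  then obtain s r where sr: "v = s + r" "s \<in> S p" "r \<in> normal_space A g M p"
    using screen_facts(6)[OF p] by blast
  have rN: "g p r (N p) = 0" using v sr pair_facts(7)[OF assms sr(2)] by (simp add: g_simps)
  have "g p r w = 0" for w
  proof -
    have "w - g p w (\<xi> p) *\<^sub>R N p \<in> tangent_space A M p"
      unfolding tangent_eq[OF assms] by (simp add: g_simps pair_facts[OF assms])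
    then have "g p r (w - g p w (\<xi> p) *\<^sub>R N p) = 0" using sr(3) by (auto simp: normal_space_def)
    then show ?thesis using rN by (simp add: g_simps)
  qed
  then have "r = 0" by (rule g_nondegenerate)
  then show "v \<in> S p" using sr by simp
qed

lemma screen_part:
  assumes "p \<in> U" "v \<in> tangent_space A M p"
  shows "v - g p v (N p) *\<^sub>R \<xi> p \<in> S p"
  unfolding screen_eq[OF assms(1)]
  using assms xi_facts(1)[OF assms(1)] tangent_M(1)[OF U_subset[OF assms(1)]]
  by (auto simp: g_simps pair_facts[OF assms(1)] subspace_diff subspace_scale)

lemma screen_proj_screen:
  assumes "p \<in> U" "v \<in> S p"
  shows "screen_proj A g M S p v = v"
  unfolding screen_proj_def
proof (rule the_equality)
  note p = U_subset[OF assms(1)]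
  show "v \<in> S p \<and> v - v \<in> normal_space A g M p" using assms by (simp add: normal_space_def g_simps)
  fix s assume s: "s \<in> S p \<and> v - s \<in> normal_space A g M p"
  then have "v - s \<in> S p \<inter> normal_space A g M p" using assms(2) screen_facts(1)[OF p] by (simp add: subspace_diff)
  then show "s = v" using screen_facts(5)[OF p] by simp
qed

text \<open>Both forms are defined through derivatives of \<open>\<xi>\<close> and \<open>N\<close>,
  hence on vectors rather than fields. \<open>D_xi\<close> and \<open>D_N\<close> recover them from
  derivatives of tangent and of screen fields.\<close>

definition B :: "'m \<Rightarrow> 'e \<Rightarrow> 'e \<Rightarrow> real" where
  "B p v w = - g p (cov_along A D U p v \<xi>) w"

definition C :: "'m \<Rightarrow> 'e \<Rightarrow> 'e \<Rightarrow> real" where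
  "C p v w = - g p (cov_along A D U p v N) w"

text \<open>One neighbourhood serves both sections, and its trace on \<open>M\<close> lies in
  \<open>U\<close>, so that inside it fields along \<open>M\<close> and along \<open>U\<close> need
  not be distinguished.\<close>

lemma extension:
  assumes "p \<in> U"
  obtains W \<Xi> \<nu> where "open W" "p \<in> W" "smooth_field A W \<Xi>" "smooth_field A W \<nu>"
    "\<And>m. m \<in> M \<inter> W \<Longrightarrow> m \<in> U \<and> \<Xi> m = \<xi> m \<and> \<nu> m = N m"
    "\<And>v. v \<in> tangent_space A M p \<Longrightarrow> cov_along A D U p v \<xi> = D p v \<Xi> \<and> cov_along A D U p v N = D p v \<nu>"
proof -
  obtain \<Xi> \<nu> where e: "field_extension A U \<xi> p \<Xi>" "field_extension A U N p \<nu>"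
    using pair assms unfolding null_pair_def smooth_field_along_def by blast
  obtain W1 where W1: "open W1" "p \<in> W1" "smooth_field A W1 \<Xi>" "\<And>q. q \<in> U \<inter> W1 \<Longrightarrow> \<Xi> q = \<xi> q"
    using e(1) unfolding field_extension_def by blast
  obtain W2 where W2: "open W2" "p \<in> W2" "smooth_field A W2 \<nu>" "\<And>q. q \<in> U \<inter> W2 \<Longrightarrow> \<nu> q = N q"
    using e(2) unfolding field_extension_def by blast
  obtain O1 where O1: "open O1" "U = M \<inter> O1" by (rule U_open)
  show ?thesis
  proof (rule that[of "W1 \<inter> W2 \<inter> O1" \<Xi> \<nu>])
    show "cov_along A D U p v \<xi> = D p v \<Xi> \<and> cov_along A D U p v N = D p v \<nu>" if "v \<in> tangent_space A M p" for v
      using cov_along_eq[OF e(1)] cov_along_eq[OF e(2)] that tangent_U[OF assms] by auto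
  qed (use W1 W2 O1 assms in \<open>auto intro: smooth_field_subset\<close>)
qed

text \<open>Differentiates \<open>g(Z, \<xi>) = 0\<close>. The set \<open>K\<close> may be
  \<open>M\<close> or an integral manifold; in the second case \<open>Z\<close> is known to be
  tangent to \<open>M\<close> only along \<open>K\<close>.\<close>

lemma D_xi:
  assumes p: "p \<in> U" and K: "K \<subseteq> M" "v \<in> tangent_space A K p" and Z: "open W" "p \<in> W" "smooth_field A W Z"
    and tangent: "\<And>m. m \<in> K \<inter> W \<Longrightarrow> Z m \<in> tangent_space A M m"
  shows "g p (D p v Z) (\<xi> p) = B p v (Z p)"
proof -
  obtain W' \<Xi> \<nu> where e: "open W'" "p \<in> W'" "smooth_field A W' \<Xi>"
    "\<And>m. m \<in> M \<inter> W' \<Longrightarrow> m \<in> U \<and> \<Xi> m = \<xi> m \<and> \<nu> m = N m"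
    "\<And>v. v \<in> tangent_space A M p \<Longrightarrow> cov_along A D U p v \<xi> = D p v \<Xi> \<and> cov_along A D U p v N = D p v \<nu>"
    using extension[OF p] by metis
  have v: "v \<in> tangent_space A M p" using tangent_space_mono[OF K(1)] K(2) by blast
  have "g p (D p v Z) (\<Xi> p) + g p (Z p) (D p v \<Xi>) = 0"
  proof (rule covariant_derivative_constant_product[of "W \<inter> W'" _ _ _ K, OF _ _ _ _ _ K(2)])
    show "g m (Z m) (\<Xi> m) = 0" if m: "m \<in> K \<inter> (W \<inter> W')" for m
    proof -
      have "m \<in> M \<inter> W'" "m \<in> K \<inter> W" using m K(1) by blast+
      then show ?thesis using e(4) tangent xi_facts(3) by metis
    qed
  qed (use Z e(1-3) in \<open>auto intro: smooth_field_subset\<close>)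
  moreover have "\<Xi> p = \<xi> p" using e(2,4) U_subset[OF p] by blast
  ultimately show ?thesis using e(5)[OF v] by (simp add: B_def g_sym[of p "Z p" "D p v \<Xi>"])
qed

text \<open>Differentiates \<open>g(Z, N) = 0\<close>, which is why \<open>Z\<close> has to lie in
  the screen along \<open>K\<close>.\<close>

lemma D_N:
  assumes p: "p \<in> U" and K: "K \<subseteq> M" "v \<in> tangent_space A K p" and Z: "open W" "p \<in> W" "smooth_field A W Z"
    and tangent: "\<And>m. m \<in> K \<inter> W \<Longrightarrow> Z m \<in> S m"
  shows "g p (D p v Z) (N p) = C p v (Z p)"
proof -
  obtain W' \<Xi> \<nu> where e: "open W'" "p \<in> W'" "smooth_field A W' \<nu>"
    "\<And>m. m \<in> M \<inter> W' \<Longrightarrow> m \<in> U \<and> \<Xi> m = \<xi> m \<and> \<nu> m = N m"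
    "\<And>v. v \<in> tangent_space A M p \<Longrightarrow> cov_along A D U p v \<xi> = D p v \<Xi> \<and> cov_along A D U p v N = D p v \<nu>"
    using extension[OF p] by metis
  have v: "v \<in> tangent_space A M p" using tangent_space_mono[OF K(1)] K(2) by blast
  have "g p (D p v Z) (\<nu> p) + g p (Z p) (D p v \<nu>) = 0"
  proof (rule covariant_derivative_constant_product[of "W \<inter> W'" _ _ _ K, OF _ _ _ _ _ K(2)])
    show "g m (Z m) (\<nu> m) = 0" if m: "m \<in> K \<inter> (W \<inter> W')" for m
    proof -
      have "m \<in> M \<inter> W'" "m \<in> K \<inter> W" using m K(1) by blast+
      then show ?thesis using e(4) tangent pair_facts(7) by metis
    qed
  qed (use Z e(1-3) in \<open>auto intro: smooth_field_subset\<close>)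
  moreover have "\<nu> p = N p" using e(2,4) U_subset[OF p] by blast
  ultimately show ?thesis using e(5)[OF v] by (simp add: C_def g_sym[of p "Z p" "D p v \<nu>"])
qed

text \<open>Extending both vectors by commuting tangent fields removes the bracket from the torsion
  identity; the two derivatives are then equal, and their products with \<open>\<xi>\<close> are the
  two sides.\<close>

lemma B_sym:
  assumes p: "p \<in> U" and v: "v \<in> tangent_space A M p" and w: "w \<in> tangent_space A M p"
  shows "B p v w = B p w v"
proof -
  obtain W X where X: "open W" "p \<in> W" "\<And>m v. smooth_field A W (X m v)" "\<And>m v. m \<in> W \<Longrightarrow> X m v m = v"
    "\<And>m v m'. m \<in> M \<inter> W \<Longrightarrow> v \<in> tangent_space A M m \<Longrightarrow> m' \<in> M \<inter> W \<Longrightarrow> X m v m' \<in> tangent_space A M m'"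
    "\<And>m v w. m \<in> W \<Longrightarrow> D m v (X m w) = D m w (X m v)"
    by (rule tangent_fields[OF U_subset[OF p]]) blast
  have pW: "p \<in> M \<inter> W" using X(2) U_subset[OF p] by blast
  have "g p (D p v (X p w)) (\<xi> p) = B p v w"
    using D_xi[OF p order_refl v X(1,2) X(3) X(5)[OF pW w]] X(4)[OF X(2)] by simp
  moreover have "g p (D p w (X p v)) (\<xi> p) = B p w v"
    using D_xi[OF p order_refl w X(1,2) X(3) X(5)[OF pW v]] X(4)[OF X(2)] by simp
  ultimately show ?thesis using X(6)[OF X(2)] by simp
qed

text \<open>Differentiates \<open>g(\<xi>, \<xi>) = 0\<close>; the second equation follows by
  symmetry.\<close>

lemma B_xi:
  assumes p: "p \<in> U" and v: "v \<in> tangent_space A M p"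
  shows "B p v (\<xi> p) = 0" "B p (\<xi> p) v = 0"
proof -
  obtain W \<Xi> \<nu> where e: "open W" "p \<in> W" "smooth_field A W \<Xi>"
    "\<And>m. m \<in> M \<inter> W \<Longrightarrow> m \<in> U \<and> \<Xi> m = \<xi> m \<and> \<nu> m = N m"
    "\<And>v. v \<in> tangent_space A M p \<Longrightarrow> cov_along A D U p v \<xi> = D p v \<Xi> \<and> cov_along A D U p v N = D p v \<nu>"
    using extension[OF p] by metis
  have "g p (D p v \<Xi>) (\<Xi> p) + g p (\<Xi> p) (D p v \<Xi>) = 0"
    by (rule covariant_derivative_constant_product[OF e(1,2,3,3) _ v]) (use e(4) xi_facts(2) in auto)
  moreover have "\<Xi> p = \<xi> p" using e(2,4) U_subset[OF p] by blast
  ultimately show "B p v (\<xi> p) = 0" using e(5)[OF v] g_sym[of p "\<xi> p" "D p v \<Xi>"] by (simp add: B_def)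
  then show "B p (\<xi> p) v = 0" using B_sym[OF p v xi_facts(1)[OF p]] by simp
qed

lemma B_linear:
  assumes p: "p \<in> U"
  shows "B p v (a *\<^sub>R w + b *\<^sub>R w') = a * B p v w + b * B p v w'"
  by (simp add: B_def g_simps)

text \<open>Pairing with \<open>\<xi>\<close> annihilates exactly the tangent space and sends
  \<open>N\<close> to \<open>1\<close>.\<close>

lemma the_transversal_coefficient:
  assumes "p \<in> U"
  shows "(THE b. x - b *\<^sub>R N p \<in> tangent_space A U p) = g p x (\<xi> p)"
  unfolding tangent_U[OF assms] tangent_eq[OF assms]
  by (rule the_equality) (auto simp: g_simps pair_facts[OF assms])

lemma gauss_B_eq:
  assumes p: "p \<in> U" and v: "v \<in> tangent_space A M p" and Y: "smooth_tangent_field A U Y"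
  shows "gauss_B A D U N p v Y = B p v (Y p)"
proof -
  obtain Z where Z: "field_extension A U Y p Z"
    using Y p unfolding smooth_tangent_field_def smooth_field_along_def by blast
  then obtain W where W: "open W" "p \<in> W" "smooth_field A W Z" "\<And>q. q \<in> U \<inter> W \<Longrightarrow> Z q = Y q"
    unfolding field_extension_def by blast
  have vU: "v \<in> tangent_space A U p" using v tangent_U[OF p] by simp
  have "g p (D p v Z) (\<xi> p) = B p v (Z p)"
    by (rule D_xi[OF p _ vU W(1-3)])
      (use W(4) Y U_subset tangent_U in \<open>auto simp: smooth_tangent_field_def\<close>)
  then show ?thesis
    unfolding gauss_B_def the_transversal_coefficient[OF p] cov_along_eq[OF Z vU] using W(2,4) p by simp
qed

lemma shape_N_product:
  assumes "p \<in> U" "w \<in> S p"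
  shows "g p (shape_N A g D U \<xi> N p v) w = C p v w"
  by (simp add: shape_N_def C_def g_simps pair_facts(6)[OF assms])

text \<open>The derivative of \<open>\<xi>\<close> has no \<open>N\<close>-part because
  \<open>B(v, \<xi>) = 0\<close>, and multiples of \<open>\<xi>\<close> are invisible to the
  screen.\<close>

lemma shape_xi_product:
  assumes p: "p \<in> U" and v: "v \<in> tangent_space A M p" and w: "w \<in> S p"
  shows "g p (shape_xi A g D U \<xi> N p v) w = B p v w"
proof -
  have "gauss_B A D U N p v \<xi> = 0"
    unfolding gauss_B_def the_transversal_coefficient[OF p] using B_xi(1)[OF p v] by (simp add: B_def)
  moreover have "g p (\<xi> p) w = 0" using w xi_facts(5)[OF p] g_sym by metis
  ultimately show ?thesis by (simp add: shape_xi_def gauss_conn_def B_def g_simps)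
qed

lemma quasi_conformal_C:
  assumes qc: "screen_quasi_conformal_on A g D M S U \<xi> N \<phi> \<psi>" and p: "p \<in> U" and v: "v \<in> S p" and w: "w \<in> S p"
  shows "C p v w = \<phi> p * B p v w + \<psi> p * g p v w"
proof -
  have vT: "v \<in> tangent_space A M p" using v screen_facts(3)[OF U_subset[OF p]] by blast
  have "shape_N A g D U \<xi> N p v = \<phi> p *\<^sub>R shape_xi A g D U \<xi> N p v + \<psi> p *\<^sub>R v"
    using qc p vT screen_proj_screen[OF p v] unfolding screen_quasi_conformal_on_def by simp
  then show ?thesis
    using shape_N_product[OF p w, of v] shape_xi_product[OF p vT w] by (simp add: g_simps)
qed

end

section \<open>Integrability of the screen distribution\<close>

lemma orthogonal_projection_exists:
  fixes V :: "'a::euclidean_space set"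
  assumes V: "subspace V"
  obtains \<pi> where "linear \<pi>" "\<And>v. \<pi> v \<in> V" "\<And>v. v \<in> V \<Longrightarrow> \<pi> v = v"
    "\<And>e. (\<And>v. v \<in> V \<Longrightarrow> e \<bullet> v = 0) \<Longrightarrow> \<pi> e = 0"
proof -
  obtain B where B: "B \<subseteq> V" "pairwise orthogonal B" "\<And>x. x \<in> B \<Longrightarrow> norm x = 1" "independent B" "span B = V"
    using orthonormal_basis_subspace[OF V] by metis
  have fin: "finite B" using B(4) by (simp add: independent_imp_finite)
  define \<pi> where "\<pi> v = (\<Sum>b\<in>B. (v \<bullet> b) *\<^sub>R b)" for v
  have lin: "linear \<pi>"
    by (rule linearI) (simp_all add: \<pi>_def inner_add_left scaleR_add_left sum.distrib scaleR_sum_right)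
  have mem: "\<pi> v \<in> V" for v
    unfolding \<pi>_def using B(1) V by (intro subspace_sum subspace_scale) auto
  have basis: "\<pi> b = b" if b: "b \<in> B" for b
  proof -
    have "\<pi> b = (\<Sum>b'\<in>B. if b' = b then b else 0)"
      unfolding \<pi>_def
    proof (rule sum.cong[OF refl])
      fix b' assume b': "b' \<in> B"
      show "(b \<bullet> b') *\<^sub>R b' = (if b' = b then b else 0)"
      proof (cases "b' = b")
        case True
        then show ?thesis using B(3)[OF b] by (simp add: dot_square_norm)
      next
        case False
        then show ?thesis using B(2) b b' by (auto simp: pairwise_def orthogonal_def)
      qed
    qed
    then show ?thesis using b fin by simp
  qed
  have "\<pi> v = v" if "v \<in> V" for v
    using linear_eq_on[OF lin linear_id, of v B] that basis B(5) by simp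
  moreover have "\<pi> e = 0" if "\<And>v. v \<in> V \<Longrightarrow> e \<bullet> v = 0" for e
    unfolding \<pi>_def using that B(1) by (intro sum.neutral) auto
  ultimately show ?thesis using that lin mem by blast
qed

text \<open>Coordinate form of the Frobenius theorem in codimension one: inside \<open>V\<close>, the distribution
  \<open>w = \<pi> w + G x w *\<^sub>R e\<close> of graphs over \<open>V\<^sub>0\<close> is integrated by the graph of a solution \<open>u\<close> of
  \<open>du = G\<close>, and \<open>\<Phi>\<close> straightens this graph.\<close>

lemma graph_distribution_integrable:
  fixes V V0 :: "'e::euclidean_space set" and G :: "'e \<Rightarrow> 'e \<Rightarrow> real"
  assumes Q0: "open Q0" "x0 \<in> Q0" "x0 \<in> V" and V: "subspace V" "V0 \<subseteq> V" "e \<in> V"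
    and \<pi>: "linear \<pi>" "\<And>v. \<pi> v \<in> V0" "\<And>v. v \<in> V0 \<Longrightarrow> \<pi> v = v" "\<pi> e = 0"
    and G: "\<And>x. x \<in> Q0 \<Longrightarrow> linear (G x)" "\<And>a. smooth_on Q0 (\<lambda>x. G x a)" "\<And>x a. G x (\<pi> a) = G x a"
    and int: "\<And>x a b. x \<in> Q0 \<Longrightarrow> x \<in> V \<Longrightarrow>
      frechet_derivative (\<lambda>x. G x b) (at x) (\<pi> a + G x a *\<^sub>R e) =
      frechet_derivative (\<lambda>x. G x a) (at x) (\<pi> b + G x b *\<^sub>R e)"
  obtains r Q \<Phi> \<Psi> where "r > 0" "open Q" "x0 \<in> Q" "Q \<subseteq> Q0" "\<Phi> x0 = 0"
    "smooth_on Q \<Phi>" "smooth_on (ball 0 r) \<Psi>" "\<And>x. x \<in> Q \<Longrightarrow> \<Phi> x \<in> ball 0 r" "\<And>z. z \<in> ball 0 r \<Longrightarrow> \<Psi> z \<in> Q"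
    "\<And>x. \<Psi> (\<Phi> x) = x" "\<And>z. \<Phi> (\<Psi> z) = z" "\<And>z. z \<in> V0 \<Longrightarrow> \<Psi> z \<in> V"
    "\<And>x w. x \<in> Q \<Longrightarrow> \<Phi> x \<in> V0 \<Longrightarrow> frechet_derivative \<Phi> (at x) w \<in> V0 \<Longrightarrow> w = \<pi> w + G x w *\<^sub>R e"
proof -
  \<comment> \<open>The unknown is a function on the whole model space, since \<open>V0\<close> is
    not a type; \<open>\<pi>\<close> makes directions outside \<open>V0\<close> ineffective. As
    \<open>x0 \<in> V\<close>, the values of \<open>f\<close> stay in \<open>V\<close>, where
    integrability is known.\<close>
  define f where "f z = x0 + (\<pi> (fst z) + snd z *\<^sub>R e)" for z :: "'e \<times> real"
  have lin: "linear (\<lambda>z. \<pi> (fst z) + snd z *\<^sub>R e)"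
    by (rule linearI) (simp_all add: linear_add[OF \<pi>(1)] linear_scale[OF \<pi>(1)] algebra_simps)
  have f_cont: "continuous_on UNIV f"
    unfolding f_def
    by (rule continuous_on_add[OF continuous_on_const]) (use lin in \<open>simp add: linear_continuous_on linear_conv_bounded_linear\<close>)
  define W where "W = f -` Q0"
  have W: "open W" "(0, 0) \<in> W"
    using continuous_open_preimage[OF f_cont open_UNIV Q0(1)] Q0(2) by (auto simp: W_def f_def linear_0[OF \<pi>(1)])
  have f_smooth: "smooth_on W f"
    unfolding f_def by (intro smooth_on_add smooth_on_const smooth_on_linear W(1) lin)
  have f': "(f has_derivative (\<lambda>z. \<pi> (fst z) + snd z *\<^sub>R e)) (at z)" for z
  proof -
    have "((\<lambda>z. \<pi> (fst z) + snd z *\<^sub>R e) has_derivative (\<lambda>z. \<pi> (fst z) + snd z *\<^sub>R e)) (at z)"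
      using lin by (simp add: linear_imp_has_derivative)
    from has_derivative_add[OF has_derivative_const[of x0] this] show ?thesis by (simp add: f_def[abs_def])
  qed
  have fV: "f z \<in> V" for z
    unfolding f_def using Q0(3) V \<pi>(2) by (intro subspace_add subspace_scale) auto
  have G': "frechet_derivative (\<lambda>z. G (f z) b) (at z) d =
      frechet_derivative (\<lambda>x. G x b) (at (f z)) (\<pi> (fst d) + snd d *\<^sub>R e)" if "z \<in> W" for z b d
  proof -
    have "((\<lambda>x. G x b) has_derivative frechet_derivative (\<lambda>x. G x b) (at (f z))) (at (f z))"
      using smooth_on_has_derivative[OF G(2) Q0(1)] that by (simp add: W_def)
    from diff_chain_at[OF f' this] show ?thesis
      by (simp add: frechet_derivative_at[symmetric] comp_def)
  qed
  interpret total_differential_equation "\<lambda>z. G (f z)" W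
  proof (rule total_differential_equation.intro)
    show "smooth_on W (\<lambda>z. G (f z) a)" for a
      by (rule smooth_on_compose[OF W(1) Q0(1) _ f_smooth G(2)]) (auto simp: W_def)
    show "frechet_derivative (\<lambda>z. G (f z) b) (at z) (a, G (f z) a) =
      frechet_derivative (\<lambda>z. G (f z) a) (at z) (b, G (f z) b)" if "z \<in> W" for z a b
      using int[of "f z"] that fV by (simp add: G' W_def)
    show "linear (G (f z))" if "z \<in> W" for z using G(1) that by (simp add: W_def)
  qed (rule W)+
  obtain r u where r: "r > 0" and u0: "u 0 = 0" and u: "smooth_on (ball 0 r) u"
    and uW: "\<And>y. y \<in> ball 0 r \<Longrightarrow> (y, u y) \<in> W"
    and u': "\<And>y. y \<in> ball 0 r \<Longrightarrow> (u has_derivative G (f (y, u y))) (at y)"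
    by (rule smooth_solution) blast
  \<comment> \<open>Up to translation, a shear in direction \<open>e\<close> that flattens the graph
    of \<open>u\<close>. As \<open>\<pi> e = 0\<close>, the shear does not affect the argument of
    \<open>u\<close>, so \<open>\<Phi>\<close> and \<open>\<Psi>\<close> are inverse to each other
    everywhere.\<close>
  define \<Phi> where "\<Phi> x = (x - x0) - u (\<pi> (x - x0)) *\<^sub>R e" for x
  define \<Psi> where "\<Psi> z = x0 + z + u (\<pi> z) *\<^sub>R e" for z
  have \<pi>\<Phi>: "\<pi> (\<Phi> x) = \<pi> (x - x0)" for x
    by (simp add: \<Phi>_def linear_diff[OF \<pi>(1)] linear_scale[OF \<pi>(1)] \<pi>(4))
  have \<pi>\<Psi>: "\<pi> (\<Psi> z - x0) = \<pi> z" for z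
    by (simp add: \<Psi>_def linear_add[OF \<pi>(1)] linear_scale[OF \<pi>(1)] \<pi>(4))
  have inv1: "\<Psi> (\<Phi> x) = x" for x by (simp add: \<Psi>_def \<pi>\<Phi>) (simp add: \<Phi>_def)
  have inv2: "\<Phi> (\<Psi> z) = z" for z by (simp add: \<Phi>_def \<pi>\<Psi>) (simp add: \<Psi>_def)
  have \<pi>_cont: "continuous_on T (\<lambda>x. \<pi> x)" for T
    using \<pi>(1) by (simp add: linear_continuous_on linear_conv_bounded_linear)
  define D1 where "D1 = (\<lambda>x. \<pi> (x - x0)) -` ball 0 r"
  define D2 where "D2 = \<pi> -` ball 0 r"
  have D1: "open D1" unfolding D1_def
    by (rule open_vimage) (auto intro!: continuous_on_compose2[OF \<pi>_cont[of UNIV]] continuous_intros)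
  have D2: "open D2" unfolding D2_def by (rule open_vimage[OF open_ball \<pi>_cont])
  have s1: "smooth_on D1 (\<lambda>x. x - x0)"
    by (intro smooth_on_diff smooth_on_const smooth_on_linear D1 linear_ident)
  have s2: "smooth_on D1 (\<lambda>x. \<pi> (x - x0))"
    by (rule smooth_on_linear_compose[OF D1 s1]) (use \<pi>(1) in \<open>simp add: linear_conv_bounded_linear\<close>)
  have "smooth_on D1 (\<lambda>x. u (\<pi> (x - x0)))"
    by (rule smooth_on_compose[OF D1 open_ball _ s2 u]) (auto simp: D1_def)
  then have \<Phi>: "smooth_on D1 \<Phi>" unfolding \<Phi>_def
    by (intro smooth_on_diff[OF D1 s1] smooth_on_scaleR D1 smooth_on_const)
  have s3: "smooth_on D2 (\<lambda>x. u (\<pi> x))"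
    by (rule smooth_on_compose[OF D2 open_ball _ smooth_on_linear[OF D2 \<pi>(1)] u]) (auto simp: D2_def)
  have \<Psi>: "smooth_on D2 \<Psi>" unfolding \<Psi>_def
    by (intro smooth_on_add smooth_on_scaleR D2 smooth_on_const s3 smooth_on_linear[OF _ linear_ident])
  have "open (D2 \<inter> \<Psi> -` Q0)" by (rule continuous_open_preimage[OF smooth_on_continuous[OF \<Psi>] D2 Q0(1)])
  moreover have "0 \<in> D2 \<inter> \<Psi> -` Q0" using r Q0(2) u0 by (simp add: D2_def \<Psi>_def linear_0[OF \<pi>(1)])
  \<comment> \<open>Small enough for \<open>\<Psi>\<close> to be smooth on the ball and to map it
    into \<open>Q0\<close>; \<open>Q\<close> is the matching domain of
    \<open>\<Phi>\<close>.\<close>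
  ultimately obtain r' where r': "r' > 0" "ball 0 r' \<subseteq> D2 \<inter> \<Psi> -` Q0" using open_contains_ball by blast
  define Q where "Q = D1 \<inter> \<Phi> -` ball 0 r'"
  have Q: "open Q" unfolding Q_def
    by (rule continuous_open_preimage[OF smooth_on_continuous[OF \<Phi>] D1 open_ball])
  have \<Phi>0: "\<Phi> x0 = 0" using u0 by (simp add: \<Phi>_def linear_0[OF \<pi>(1)])
  show ?thesis
  proof (rule that[OF r'(1) Q])
    show "x0 \<in> Q" using r r'(1) \<Phi>0 by (simp add: Q_def D1_def linear_0[OF \<pi>(1)])
    show "Q \<subseteq> Q0"
    proof
      fix x assume "x \<in> Q"
      then have "\<Psi> (\<Phi> x) \<in> Q0" using r'(2) by (auto simp: Q_def)
      then show "x \<in> Q0" by (simp add: inv1)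
    qed
    show "smooth_on Q \<Phi>" by (rule smooth_on_subset[OF \<Phi>]) (simp add: Q_def)
    show "smooth_on (ball 0 r') \<Psi>" by (rule smooth_on_subset[OF \<Psi>]) (use r'(2) in blast)
    show "\<Psi> z \<in> Q" if "z \<in> ball 0 r'" for z
    proof -
      have "\<pi> z \<in> ball 0 r" using that r'(2) by (auto simp: D2_def)
      then show ?thesis using that by (simp add: Q_def D1_def \<pi>\<Psi> inv2)
    qed
    show "\<Psi> z \<in> V" if "z \<in> V0" for z
      unfolding \<Psi>_def using Q0(3) V that by (intro subspace_add subspace_scale) auto
    fix x w assume x: "x \<in> Q" "\<Phi> x \<in> V0" and w: "frechet_derivative \<Phi> (at x) w \<in> V0"
    define y where "y = \<pi> (x - x0)"
    have y: "y \<in> ball 0 r" using x(1) by (simp add: Q_def D1_def y_def)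
    have \<Phi>y: "\<Phi> x = y" using \<pi>(3)[OF x(2)] \<pi>\<Phi> by (simp add: y_def)
    have "\<pi> y = y" using \<pi>(3)[OF x(2)] \<Phi>y by simp
    \<comment> \<open>The condition \<open>\<Phi> x \<in> V0\<close> puts \<open>x\<close> on the
      graph, and there the derivative of \<open>u\<close> at \<open>\<pi> (x - x0)\<close> is
      \<open>G x\<close> itself.\<close>
    then have "x = f (y, u y)" using inv1[of x] \<Phi>y by (simp add: \<Psi>_def f_def add.assoc)
    then have u'y: "(u has_derivative G x) (at (\<pi> (x - x0)))" using u'[OF y] by (simp add: y_def)
    have "((\<lambda>x. x - x0) has_derivative (\<lambda>v. v)) (at x)"
      by (auto intro!: derivative_eq_intros)
    then have "((\<lambda>x. \<pi> (x - x0)) has_derivative \<pi>) (at x)"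
      using diff_chain_at[OF _ linear_imp_has_derivative[OF \<pi>(1)]] by (fastforce simp: comp_def)
    from diff_chain_at[OF this u'y] have "((\<lambda>x. u (\<pi> (x - x0))) has_derivative (\<lambda>v. G x v)) (at x)"
      by (simp add: comp_def G(3))
    then have "(\<Phi> has_derivative (\<lambda>v. v - G x v *\<^sub>R e)) (at x)"
      unfolding \<Phi>_def by (auto intro!: derivative_eq_intros)
    then have w0: "w - G x w *\<^sub>R e \<in> V0" using w frechet_derivative_at by metis
    have "w - G x w *\<^sub>R e = \<pi> (w - G x w *\<^sub>R e)" using \<pi>(3)[OF w0] by simp
    also have "\<dots> = \<pi> w" by (simp add: linear_diff[OF \<pi>(1)] linear_scale[OF \<pi>(1)] \<pi>(4))
    finally show "w = \<pi> w + G x w *\<^sub>R e" by (simp add: algebra_simps)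
  qed (auto simp: \<Phi>0 inv1 inv2 Q_def)
qed

context null_pair_domain
begin

text \<open>Besides the integral manifold it delivers screen fields on \<open>W\<close> through
  every vector of \<open>S p\<close>. Second fundamental forms are evaluated on fields, so these are
  what gives access to arbitrary screen vectors.\<close>

lemma screen_integral_manifold:
  assumes C_sym: "\<And>p v w. p \<in> U \<Longrightarrow> v \<in> S p \<Longrightarrow> w \<in> S p \<Longrightarrow> C p v w = C p w v" and p: "p \<in> U"
  obtains P W where "integral_manifold A M n S P" "p \<in> P" "open W" "P \<subseteq> W"
    "\<And>v. v \<in> S p \<Longrightarrow> \<exists>X. smooth_field A W X \<and> X p = v \<and> (\<forall>m\<in>M \<inter> W. X m \<in> S m)"
proof -
  note pM = U_subset[OF p]
  obtain c V where c: "admissible c" "p \<in> fst c" and V: "subspace V" "dim V = n + 1"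
    and slice: "snd c ` (fst c \<inter> M) = snd c ` fst c \<inter> V" by (rule slice_chart[OF pM])
  note inv = chart_inv_left[OF admissible_is_chart[OF c(1)]]
  have tangent_iff: "v \<in> tangent_space A M m \<longleftrightarrow> tcoord A c m v \<in> V" if "m \<in> M" "m \<in> fst c" for m v
    using tangent_space_slice[OF c(1) that V(1) slice] by simp
  obtain W1 \<Xi> \<nu> where W1: "open W1" "p \<in> W1" and \<nu>: "smooth_field A W1 \<nu>"
    and \<nu>N: "\<And>m. m \<in> M \<inter> W1 \<Longrightarrow> m \<in> U \<and> \<Xi> m = \<xi> m \<and> \<nu> m = N m"
    by (rule extension[OF p]) blast
  \<comment> \<open>Turns components in \<open>c\<close> into stored tangent vectors; inverse to
    \<open>tcoord A c m\<close>.\<close>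
  define t where "t m = transition_deriv c (chart_at A m) (snd c m)" for m
  have t_lin: "linear (t m)" if "m \<in> fst c" for m
    unfolding t_def by (rule linear_transition_deriv[OF c(1) admissible_chart_at that chart_at(2)])
  have chart_field_t: "chart_field A c f m = t m (f (snd c m))" for f m by (simp add: chart_field_def t_def)
  have tcoord_t: "tcoord A c m (t m w) = w" if "m \<in> fst c" for m w
    using tcoord_chart_field[OF c(1) that, of "\<lambda>_. w"] by (simp add: chart_field_t)
  have t_tcoord: "t m (tcoord A c m v) = v" if "m \<in> fst c" for m v
    using tcoord_inverse[OF c(1) that] by (simp add: t_def)
  define O0 where "O0 = snd c ` (W1 \<inter> fst c)"
  have O0: "open O0" unfolding O0_def by (rule open_image[OF c(1) W1(1)])
  \<comment> \<open>The form \<open>g(_, N)\<close> in coordinates. The extension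
    \<open>\<nu>\<close> makes it smooth on an open set; at points of \<open>V\<close> its kernel
    within \<open>V\<close> is the screen.\<close>
  define \<theta> where "\<theta> x w = g (chart_inv c x) (t (chart_inv c x) w) (\<nu> (chart_inv c x))" for x w
  have \<theta>_chart: "\<theta> (snd c m) w = g m (t m w) (\<nu> m)" if "m \<in> fst c" for m w
    by (simp add: \<theta>_def inv[OF that])
  have \<theta>_lin: "linear (\<theta> x)" if x: "x \<in> O0" for x
  proof -
    obtain m where m: "m \<in> fst c" "x = snd c m" using x by (auto simp: O0_def)
    show ?thesis unfolding m(2)
      by (rule linearI) (simp_all add: \<theta>_chart[OF m(1)] linear_add[OF t_lin[OF m(1)]] linear_scale[OF t_lin[OF m(1)]] g_simps)
  qed
  have \<theta>_smooth: "smooth_on O0 (\<lambda>x. \<theta> x w)" for w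
  proof -
    have o: "open (W1 \<inter> fst c)" using W1(1) open_fst[OF c(1)] by blast
    have "smooth_field A (W1 \<inter> fst c) (chart_field A c (\<lambda>_. w))"
      using open_image[OF c(1) W1(1)] by (intro smooth_chart_field o c(1)) auto
    from smooth_fun_chart[OF o smooth_g[OF o this smooth_field_subset[OF \<nu>]] c(1)]
    show ?thesis by (simp add: O0_def \<theta>_def chart_field_t comp_def Int_assoc)
  qed
  define V0 where "V0 = tcoord A c p ` S p"
  have V0: "subspace V0" unfolding V0_def
    by (rule linear_subspace_image[OF linear_tcoord[OF c] screen_facts(1)[OF pM]])
  have "inj (tcoord A c p)" by (rule injI) (rule tcoord_inj[OF c])
  then have V0_dim: "dim V0 = n" unfolding V0_def
    using dim_image_eq[OF linear_tcoord[OF c], of "S p"] screen_facts(2)[OF pM] by (auto intro: inj_on_subset)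
  have V0V: "V0 \<subseteq> V" using screen_facts(3)[OF pM] tangent_iff[OF pM c(2)] by (auto simp: V0_def)
  have "V0 \<noteq> V" using V0_dim V(2) by auto
  then have "span V0 \<subset> span V" using V0V V0 V(1) by (metis psubsetI span_eq_iff)
  \<comment> \<open>A direction of \<open>V\<close> missing from the screen at \<open>p\<close>.
    Taking it Euclidean-orthogonal to \<open>V0\<close> lets the orthogonal projection onto
    \<open>V0\<close> kill it.\<close>
  then obtain e where e: "e \<noteq> 0" "e \<in> V" "\<And>v. v \<in> V0 \<Longrightarrow> e \<bullet> v = 0"
    using orthogonal_to_subspace_exists_gen[of V0 V] V0 V(1) span_eq_iff unfolding orthogonal_def by metis
  obtain \<pi> where \<pi>: "linear \<pi>" "\<And>v. \<pi> v \<in> V0" "\<And>v. v \<in> V0 \<Longrightarrow> \<pi> v = v" "\<pi> e = 0"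
    using orthogonal_projection_exists[OF V0] e(3) by metis
  \<comment> \<open>Where \<open>\<theta> x e \<noteq> 0\<close>, the kernel can be written as a
    graph over \<open>V0\<close>.\<close>
  define Q0 where "Q0 = O0 \<inter> (\<lambda>x. \<theta> x e) -` (- {0})"
  have Q0: "open Q0" unfolding Q0_def
    by (rule continuous_open_preimage[OF smooth_on_continuous[OF \<theta>_smooth] O0]) (simp add: open_Compl)
  have pW1: "\<nu> p = N p" using \<nu>N pM W1(2) by blast
  have x0V: "snd c p \<in> V" using slice pM c(2) by auto
  have x0Q: "snd c p \<in> Q0"
  proof -
    have "\<theta> (snd c p) e \<noteq> 0"
    proof
      assume "\<theta> (snd c p) e = 0"
      then have "g p (t p e) (N p) = 0" by (simp add: \<theta>_chart[OF c(2)] pW1)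
      moreover have "t p e \<in> tangent_space A M p" using tangent_iff[OF pM c(2)] e(2) by (simp add: tcoord_t[OF c(2)])
      ultimately have "t p e \<in> S p" by (simp add: screen_eq[OF p])
      then have "tcoord A c p (t p e) \<in> V0" unfolding V0_def by (rule imageI)
      then have "e \<bullet> e = 0" using e(3) by (simp add: tcoord_t[OF c(2)])
      then show False using e(1) by simp
    qed
    then show ?thesis using W1(2) c(2) by (auto simp: Q0_def O0_def)
  qed
  have Q0_O0: "x \<in> O0" "\<theta> x e \<noteq> 0" if "x \<in> Q0" for x using that by (auto simp: Q0_def)
  \<comment> \<open>The unique slope for which \<open>\<pi> a + G x a *\<^sub>R e\<close> lies in
    the kernel of \<open>\<theta> x\<close>.\<close>
  define G where "G x a = - \<theta> x (\<pi> a) / \<theta> x e" for x a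
  have G_lin: "linear (G x)" if "x \<in> Q0" for x
    using \<theta>_lin[OF Q0_O0(1)[OF that]]
    by (intro linearI) (simp_all add: G_def linear_add[OF \<pi>(1)] linear_scale[OF \<pi>(1)] linear_add linear_scale add_divide_distrib diff_divide_distrib)
  have G_smooth: "smooth_on Q0 (\<lambda>x. G x a)" for a
    unfolding G_def using Q0_O0
    by (intro smooth_on_divide smooth_on_minus smooth_on_subset[OF \<theta>_smooth] Q0) auto
  have G_\<pi>: "G x (\<pi> a) = G x a" for x a by (simp add: G_def \<pi>)
  define W where "W = fst c \<inter> snd c -` Q0"
  have W: "open W" unfolding W_def by (rule open_chart_preimage[OF admissible_is_chart[OF c(1)] Q0])
  have W_W1: "m \<in> W1" "m \<in> fst c" "snd c m \<in> Q0" if "m \<in> W" for m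
  proof -
    show m: "m \<in> fst c" "snd c m \<in> Q0" using that by (auto simp: W_def)
    then have "snd c m \<in> snd c ` (W1 \<inter> fst c)" using Q0_O0(1) unfolding O0_def by blast
    then obtain m' where m': "m' \<in> W1" "m' \<in> fst c" "snd c m = snd c m'" by blast
    from arg_cong[OF m'(3), of "chart_inv c"] have "m = m'" by (simp only: inv m(1) m'(2))
    then show "m \<in> W1" using m'(1) by simp
  qed
  have c_mem: "x \<in> snd c ` fst c" if "x \<in> Q0" for x using Q0_O0(1)[OF that] by (auto simp: O0_def)
  define X where "X a = chart_field A c (\<lambda>x. \<pi> a + G x a *\<^sub>R e)" for a
  have X_smooth: "smooth_field A W (X a)" for a
    unfolding X_def
  proof (rule smooth_chart_field[OF W c(1)])
    have "smooth_on Q0 (\<lambda>x. \<pi> a + G x a *\<^sub>R e)"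
      by (intro smooth_on_add smooth_on_const smooth_on_scaleR G_smooth Q0)
    then show "smooth_on (snd c ` W) (\<lambda>x. \<pi> a + G x a *\<^sub>R e)"
      by (rule smooth_on_subset) (auto simp: W_def)
  qed (simp add: W_def)
  have X_coord: "tcoord A c m (X a m) = \<pi> a + G (snd c m) a *\<^sub>R e" if "m \<in> W" for m a
    by (simp add: X_def tcoord_chart_field[OF c(1) W_W1(2)[OF that]])
  have X_S: "X a m \<in> S m" if m: "m \<in> M \<inter> W" for m a
  proof -
    have mW: "m \<in> W" "m \<in> M" using m by auto
    note mc = W_W1[OF mW(1)]
    have mU: "m \<in> U" "\<nu> m = N m" using \<nu>N mW(2) mc(1) by blast+
    have "X a m \<in> tangent_space A M m"
      unfolding tangent_iff[OF mW(2) mc(2)] X_coord[OF mW(1)]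
      using V0V \<pi>(2) e(2) V(1) by (intro subspace_add subspace_scale) auto
    moreover have "g m (X a m) (N m) = \<theta> (snd c m) (\<pi> a + G (snd c m) a *\<^sub>R e)"
      by (simp add: \<theta>_chart[OF mc(2)] X_def chart_field_t mU(2))
    moreover have "\<dots> = 0"
      using Q0_O0(2)[OF mc(3)] \<theta>_lin[OF Q0_O0(1)[OF mc(3)]] by (simp add: linear_diff linear_scale G_def)
    ultimately show ?thesis by (simp add: screen_eq[OF mU(1)])
  qed
  have integrability: "frechet_derivative (\<lambda>x. G x b) (at x) (\<pi> a + G x a *\<^sub>R e) =
      frechet_derivative (\<lambda>x. G x a) (at x) (\<pi> b + G x b *\<^sub>R e)" if x: "x \<in> Q0" "x \<in> V" for x a b
  proof -
    have "x \<in> snd c ` (fst c \<inter> M)" using slice c_mem[OF x(1)] x(2) by blast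
    then obtain m where m: "m \<in> fst c" "m \<in> M" "x = snd c m" by blast
    have mW: "m \<in> W" using m x(1) by (simp add: W_def)
    have mU: "m \<in> U" "\<nu> m = N m" using \<nu>N m(2) W_W1(1)[OF mW] by blast+
    have XS: "X a m \<in> S m" for a using X_S m(2) mW by blast
    have DN: "g m (D m (X a m) (X b)) (N m) = C m (X a m) (X b m)" for a b
      by (rule D_N[OF mU(1) order_refl _ W mW X_smooth X_S]) (use XS screen_facts(3)[OF m(2)] in blast)+
    have rep': "frechet_derivative (field_rep A c (X a)) (at x) w = frechet_derivative (\<lambda>x. G x a) (at x) w *\<^sub>R e" for a w
    proof -
      have "((\<lambda>x. \<pi> a + G x a *\<^sub>R e) has_derivative (\<lambda>w. frechet_derivative (\<lambda>x. G x a) (at x) w *\<^sub>R e)) (at x)"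
        by (auto intro!: derivative_eq_intros smooth_on_has_derivative[OF G_smooth Q0 x(1)])
      then have "(field_rep A c (X a) has_derivative (\<lambda>w. frechet_derivative (\<lambda>x. G x a) (at x) w *\<^sub>R e)) (at x)"
        by (rule has_derivative_transform_within_open[OF _ Q0 x(1)])
          (simp add: X_def field_rep_chart_field[OF c(1) c_mem])
      then show ?thesis using frechet_derivative_at by metis
    qed
    \<comment> \<open>The defect of integrability. Only the \<open>e\<close>-components of the
      fields vary, so their bracket has components \<open>\<kappa> *\<^sub>R e\<close> and product
      \<open>\<kappa> * \<theta> x e\<close> with \<open>N\<close>. The torsion identity and the
      symmetry of \<open>C\<close> make this product vanish.\<close>
    define \<kappa> where "\<kappa> = frechet_derivative (\<lambda>x. G x b) (at x) (\<pi> a + G x a *\<^sub>R e) -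
      frechet_derivative (\<lambda>x. G x a) (at x) (\<pi> b + G x b *\<^sub>R e)"
    have "tcoord A c m (lie_bracket A (X a) (X b) m) = \<kappa> *\<^sub>R e"
      unfolding tcoord_lie_bracket[OF c(1) W mW m(1) X_smooth X_smooth] X_coord[OF mW] m(3)[symmetric] rep' \<kappa>_def
      by (simp add: algebra_simps)
    then have "lie_bracket A (X a) (X b) m = t m (\<kappa> *\<^sub>R e)" using t_tcoord[OF m(1)] by metis
    then have "g m (lie_bracket A (X a) (X b) m) (N m) = \<kappa> * \<theta> x e"
      by (simp add: m(3) \<theta>_chart[OF m(1)] mU(2) linear_scale[OF t_lin[OF m(1)]] g_simps)
    moreover have "g m (lie_bracket A (X a) (X b) m) (N m) = 0"
      unfolding D_torsion[OF W X_smooth X_smooth mW, symmetric]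
      using C_sym[OF mU(1) XS[of a] XS[of b]] by (simp add: g_simps DN)
    ultimately show ?thesis using Q0_O0(2)[OF x(1)] by (simp add: \<kappa>_def)
  qed
  show ?thesis
  proof (rule graph_distribution_integrable[OF Q0 x0Q x0V V(1) V0V e(2) \<pi> G_lin G_smooth G_\<pi> integrability])
    fix r :: real and Q \<Phi> \<Psi>
    assume r: "0 < r" and Q: "open Q" "snd c p \<in> Q" "Q \<subseteq> Q0" and \<Phi>0: "\<Phi> (snd c p) = 0"
      and smooth: "smooth_on Q \<Phi>" "smooth_on (ball 0 r) \<Psi>"
      and \<Phi>: "\<And>x. x \<in> Q \<Longrightarrow> \<Phi> x \<in> ball 0 r" and \<Psi>: "\<And>z. z \<in> ball 0 r \<Longrightarrow> \<Psi> z \<in> Q"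
      and inverse: "\<And>x. \<Psi> (\<Phi> x) = x" "\<And>z. \<Phi> (\<Psi> z) = z" and \<Psi>V: "\<And>z. z \<in> V0 \<Longrightarrow> \<Psi> z \<in> V"
      and \<Phi>': "\<And>x w. x \<in> Q \<Longrightarrow> \<Phi> x \<in> V0 \<Longrightarrow> frechet_derivative \<Phi> (at x) w \<in> V0 \<Longrightarrow> w = \<pi> w + G x w *\<^sub>R e"
    define c' where "c' = (fst c \<inter> snd c -` Q, \<lambda>m. \<Phi> (snd c m))"
    have Qc: "Q \<subseteq> snd c ` fst c" using Q(3) c_mem by blast
    have inverse_on: "\<And>x. x \<in> Q \<Longrightarrow> \<Psi> (\<Phi> x) = x" "\<And>z. z \<in> ball 0 r \<Longrightarrow> \<Phi> (\<Psi> z) = z"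
      using inverse by simp_all
    note straightened = admissible_compose[OF c(1) Q(1) Qc open_ball smooth(1) \<Phi> smooth(2) \<Psi> inverse_on, folded c'_def]
    have comp: "admissible c'" "snd c' ` fst c' = ball 0 r"
      by (rule straightened(1); assumption) (rule straightened(2); assumption)
    have tcoord': "tcoord A c' m v = frechet_derivative \<Phi> (at (snd c m)) (tcoord A c m v)" if "m \<in> fst c'" for m v
      using that by (rule straightened(4)[rotated -1])
    define P where "P = {m \<in> fst c'. snd c' m \<in> V0}"
    have P_iff: "m \<in> P \<longleftrightarrow> m \<in> fst c \<and> snd c m \<in> Q \<and> \<Phi> (snd c m) \<in> V0" for m by (auto simp: P_def c'_def)
    have PM: "P \<subseteq> M"
    proof
      fix m assume "m \<in> P"
      then have m: "m \<in> fst c" "\<Phi> (snd c m) \<in> V0" by (simp_all add: P_iff)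
      then have "snd c m \<in> snd c ` (fst c \<inter> M)" using slice \<Psi>V[OF m(2)] inverse(1) by auto
      then obtain m' where m': "m' \<in> fst c" "m' \<in> M" "snd c m = snd c m'" by blast
      from arg_cong[OF m'(3), of "chart_inv c"] have "m = m'" by (simp only: inv m(1) m'(1))
      then show "m \<in> M" using m'(2) by simp
    qed
    have pP: "p \<in> P" using c(2) Q(2) \<Phi>0 subspace_0[OF V0] by (simp add: P_iff)
    have PW: "P \<subseteq> W" using Q(3) by (auto simp: P_iff W_def)
    have slice': "snd c' ` (fst c' \<inter> P) = snd c' ` fst c' \<inter> V0" by (auto simp: P_def)
    \<comment> \<open>A convex set in the new coordinates, which yields connectedness.\<close>
    have "P = chart_inv c' ` (ball 0 r \<inter> V0)"
    proof (intro equalityI subsetI)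
      fix m assume m: "m \<in> P"
      then have "m = chart_inv c' (snd c' m)" "snd c' m \<in> ball 0 r \<inter> V0"
        using chart_inv_left[OF admissible_is_chart[OF comp(1)]] comp(2) by (auto simp: P_def)
      then show "m \<in> chart_inv c' ` (ball 0 r \<inter> V0)" by (rule image_eqI)
    next
      fix m assume "m \<in> chart_inv c' ` (ball 0 r \<inter> V0)"
      then obtain z where z: "z \<in> ball 0 r" "z \<in> V0" "m = chart_inv c' z" by blast
      have "z \<in> snd c' ` fst c'" using z(1) comp(2) by simp
      then show "m \<in> P"
        using chart_inv_right[OF admissible_is_chart[OF comp(1)], of z]
          chart_inv_mem[OF admissible_is_chart[OF comp(1)], of z] z
        by (simp add: P_def)
    qed
    moreover have "connected (chart_inv c' ` (ball 0 r \<inter> V0))"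
    proof (rule connected_continuous_image)
      show "continuous_on (ball 0 r \<inter> V0) (chart_inv c')"
        using comp(1,2) by (auto simp: admissible_def is_chart_def homeomorphism_def intro: continuous_on_subset)
      show "connected (ball 0 r \<inter> V0)"
        by (intro convex_connected convex_Int convex_ball subspace_imp_convex V0)
    qed
    ultimately have "connected P" by simp
    moreover have "submanifold A n P"
      unfolding submanifold_def
    proof
      fix m assume "m \<in> P"
      then show "\<exists>c V. is_chart c \<and> (\<forall>d\<in>A. compatible c d) \<and> m \<in> fst c \<and> subspace V \<and> dim V = n \<and>
          snd c ` (fst c \<inter> P) = snd c ` fst c \<inter> V"
        using comp(1) V0 V0_dim slice' by (intro exI[of _ c'] exI[of _ V0]) (auto simp: admissible_def P_def)
    qed
    \<comment> \<open>Both spaces have dimension \<open>n\<close>, so one inclusion suffices: every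
      tangent vector of \<open>P\<close> is a value of some \<open>X a\<close>.\<close>
    moreover have "tangent_space A P m = S m" if m: "m \<in> P" for m
    proof (rule subspace_dim_equal)
      have mc: "m \<in> fst c'" "m \<in> M" "m \<in> W" "m \<in> fst c" "snd c m \<in> Q" "\<Phi> (snd c m) \<in> V0"
        using m PM PW by (auto simp: P_def P_iff c'_def)
      have mU: "m \<in> U" using \<nu>N mc(2) W_W1(1)[OF mc(3)] by blast
      show "subspace (tangent_space A P m)" "subspace (S m)"
        using slice_tangent_dim(1)[OF comp(1) m mc(1) V0 slice'] screen_facts(1)[OF mc(2)] by auto
      show "dim (S m) \<le> dim (tangent_space A P m)"
        using slice_tangent_dim(2)[OF comp(1) m mc(1) V0 slice'] screen_facts(2)[OF mc(2)] V0_dim by simp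
      show "tangent_space A P m \<subseteq> S m"
      proof
        fix v assume "v \<in> tangent_space A P m"
        then have "tcoord A c' m v \<in> V0" using tangent_space_slice[OF comp(1) m mc(1) V0 slice'] by simp
        then have "tcoord A c m v = \<pi> (tcoord A c m v) + G (snd c m) (tcoord A c m v) *\<^sub>R e"
          using \<Phi>'[OF mc(5,6)] tcoord'[OF mc(1)] by simp
        then have "tcoord A c m (X (tcoord A c m v) m) = tcoord A c m v" using X_coord[OF mc(3)] by simp
        then have "X (tcoord A c m v) m = v" by (rule tcoord_inj[OF c(1) mc(4)])
        then show "v \<in> S m" using X_S[of m "tcoord A c m v"] mc by simp
      qed
    qed
    ultimately have "integral_manifold A M n S P"
      using PM pP by (auto simp: integral_manifold_def)
    moreover have "\<exists>X. smooth_field A W X \<and> X p = v \<and> (\<forall>m\<in>M \<inter> W. X m \<in> S m)" if v: "v \<in> S p" for v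
    proof -
      let ?a = "tcoord A c p v"
      have a: "?a \<in> V0" using v by (simp add: V0_def)
      have "\<theta> (snd c p) ?a = 0"
        by (simp add: \<theta>_chart[OF c(2)] t_tcoord[OF c(2)] pW1 pair_facts(7)[OF p v])
      then have "tcoord A c p (X ?a p) = ?a"
        using X_coord[of p ?a] pP PW by (auto simp: \<pi>(3)[OF a] G_def)
      then have "X ?a p = v" by (rule tcoord_inj[OF c])
      then show ?thesis using X_smooth X_S by blast
    qed
    ultimately show thesis using that pP W PW by blast
  qed
qed

end

section \<open>Umbilicity\<close>

context null_hypersurface_with_screen
begin

text \<open>By polarization, a form vanishing on the diagonal vanishes on the subspace, against
  nondegeneracy of a nonzero screen. The number \<open>g p v v\<close> later serves as a
  divisor.\<close>

lemma screen_nonnull_vector: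
  assumes "p \<in> M" "n > 0"
  obtains v where "v \<in> S p" "g p v v \<noteq> 0"
proof (rule ccontr)
  assume "\<not> thesis"
  then have "g p v v = 0" if "v \<in> S p" for v using that \<open>\<And>v. v \<in> S p \<Longrightarrow> g p v v \<noteq> 0 \<Longrightarrow> thesis\<close> by blast
  then have "g p v w = 0" if "v \<in> S p" "w \<in> S p" for v w
    using g_polarization[OF screen_facts(1)[OF assms(1)]] that by blast
  then have "S p \<subseteq> {0}" using screen_facts(4)[OF assms(1)] unfolding nondegenerate_on_def by blast
  then have "dim (S p) = 0" by (metis dim_eq_0)
  then show False using screen_facts(2)[OF assms(1)] assms(2) by simp
qed

text \<open>The value at \<open>m\<close> of the mean curvature field of every umbilical integral manifold through \<open>m\<close>.\<close>

definition umbilical_normal :: "'m \<Rightarrow> 'e \<Rightarrow> bool" where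
  "umbilical_normal m h \<longleftrightarrow> (\<forall>w\<in>S m. g m h w = 0) \<and>
     (\<forall>P X Y. integral_manifold A M n S P \<and> m \<in> P \<and> smooth_tangent_field A P X \<and> smooth_tangent_field A P Y \<longrightarrow>
        second_fundamental_form A g D P X Y m = g m (X m) (Y m) *\<^sub>R h)"

text \<open>Strengthens integrability by smooth screen fields through every vector at
  \<open>p\<close>, defined on a neighbourhood of a whole integral manifold.\<close>

definition locally_integrable :: bool where
  "locally_integrable \<longleftrightarrow> (\<forall>p\<in>M. \<exists>P W. integral_manifold A M n S P \<and> p \<in> P \<and> open W \<and> P \<subseteq> W \<and>
     (\<forall>v\<in>S p. \<exists>X. smooth_field A W X \<and> X p = v \<and> (\<forall>m\<in>M \<inter> W. X m \<in> S m)))"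

lemma integral_manifold_facts:
  assumes "integral_manifold A M n S P"
  shows "P \<subseteq> M" "\<And>m. m \<in> P \<Longrightarrow> tangent_space A P m = S m"
  using assms unfolding integral_manifold_def by blast+

lemma smooth_tangent_field_restrict:
  assumes "integral_manifold A M n S P" "open W" "P \<subseteq> W" "smooth_field A W X" "\<And>m. m \<in> M \<inter> W \<Longrightarrow> X m \<in> S m"
  shows "smooth_tangent_field A P X"
  unfolding smooth_tangent_field_def smooth_field_along_def field_extension_def
  using assms integral_manifold_facts[OF assms(1)] by blast

lemma locally_integrableE:
  assumes "locally_integrable" "p \<in> M"
  obtains P where "integral_manifold A M n S P" "p \<in> P"
    "\<And>v. v \<in> S p \<Longrightarrow> \<exists>X. smooth_tangent_field A P X \<and> X p = v"
proof -
  obtain P W where PW: "integral_manifold A M n S P" "p \<in> P" "open W" "P \<subseteq> W"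
    and X: "\<forall>v\<in>S p. \<exists>X. smooth_field A W X \<and> X p = v \<and> (\<forall>m\<in>M \<inter> W. X m \<in> S m)"
    using assms(1)[unfolded locally_integrable_def, THEN bspec, OF assms(2)] by (elim exE conjE)
  show ?thesis
  proof (rule that[OF PW(1,2)])
    fix v assume "v \<in> S p"
    then obtain X where "smooth_field A W X" "X p = v" "\<forall>m\<in>M \<inter> W. X m \<in> S m" using X by blast
    then show "\<exists>X. smooth_tangent_field A P X \<and> X p = v"
      using smooth_tangent_field_restrict[OF PW(1,3,4)] by blast
  qed
qed

text \<open>On a field extending a non-null \<open>v\<close>, the second fundamental form has the
  value \<open>g(v, v) h\<close>, which determines \<open>h\<close>.\<close>

lemma umbilical_normal_unique:
  assumes "locally_integrable" "p \<in> M" "n > 0" "umbilical_normal p h" "umbilical_normal p h'"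
  shows "h = h'"
proof -
  obtain v where v: "v \<in> S p" "g p v v \<noteq> 0" by (rule screen_nonnull_vector[OF assms(2,3)])
  obtain P where P: "integral_manifold A M n S P" "p \<in> P"
    and ex: "\<And>v. v \<in> S p \<Longrightarrow> \<exists>X. smooth_tangent_field A P X \<and> X p = v"
    using locally_integrableE[OF assms(1,2)] by metis
  obtain X where "smooth_tangent_field A P X" "X p = v" using ex[OF v(1)] by blast
  then have "g p v v *\<^sub>R h = g p v v *\<^sub>R h'"
    using assms(4,5) P unfolding umbilical_normal_def by metis
  then show ?thesis using v(2) by simp
qed

text \<open>An integral manifold through a point of the leaf prolongs the chain ending there, so it
  lies in the leaf.\<close>

lemma leaf_integral_manifolds:
  assumes "locally_integrable" "leaf A M n S L"
  shows "L = \<Union>{P. integral_manifold A M n S P \<and> P \<subseteq> L}"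
proof -
  let ?R = "{(a, b). \<exists>P. integral_manifold A M n S P \<and> a \<in> P \<and> b \<in> P}"
  obtain p where p: "p \<in> M" "L = {q. (p, q) \<in> ?R\<^sup>*}" using assms(2) unfolding leaf_def by blast
  have "x \<in> \<Union>{P. integral_manifold A M n S P \<and> P \<subseteq> L}" if x: "x \<in> L" for x
  proof -
    have chain: "(p, x) \<in> ?R\<^sup>*" using x p(2) by simp
    then have "x \<in> M"
      by (induction rule: rtrancl_induct) (use p(1) integral_manifold_facts(1) in blast)+
    then obtain P where P: "integral_manifold A M n S P" "x \<in> P" using locally_integrableE[OF assms(1)] by metis
    have "P \<subseteq> L"
    proof
      fix y assume "y \<in> P"
      then have "(x, y) \<in> ?R" using P by blast
      then show "y \<in> L" using rtrancl_into_rtrancl[OF chain] p(2) by blast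
    qed
    then show ?thesis using P by blast
  qed
  then show ?thesis by blast
qed

lemma leaf_through:
  assumes "p \<in> M"
  obtains L where "leaf A M n S L" "\<And>P. integral_manifold A M n S P \<Longrightarrow> p \<in> P \<Longrightarrow> P \<subseteq> L"
proof
  let ?R = "{(a, b). \<exists>P. integral_manifold A M n S P \<and> a \<in> P \<and> b \<in> P}"
  show "leaf A M n S {q. (p, q) \<in> ?R\<^sup>*}" using assms unfolding leaf_def by blast
  show "P \<subseteq> {q. (p, q) \<in> ?R\<^sup>*}" if "integral_manifold A M n S P" "p \<in> P" for P
    using that by (blast intro: r_into_rtrancl)
qed

text \<open>A leaf needs one field \<open>H\<close> for all its integral manifolds. It is chosen
  pointwise; for \<open>n > 0\<close>, uniqueness of umbilical normals makes the choice coincide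
  with the local smooth fields.\<close>

lemma leaves_totally_umbilical:
  assumes int: "locally_integrable"
    and loc: "\<And>p. p \<in> M \<Longrightarrow> \<exists>W H. open W \<and> p \<in> W \<and> smooth_field A W H \<and> (\<forall>m\<in>M \<inter> W. umbilical_normal m (H m))"
    and L: "leaf A M n S L"
  shows "totally_umbilical_leaf A g D M n S L"
proof -
  (* For n = 0 the screen is trivial and every vector is an umbilical normal, so SOME need not be smooth. *)
  define H where "H m = (if n = 0 then 0 else (SOME h. umbilical_normal m h))" for m
  have zero: "umbilical_normal m 0" if n: "n = 0" and m: "m \<in> M" for m
  proof -
    obtain W h where "m \<in> W" "\<forall>m\<in>M \<inter> W. umbilical_normal m (h m)" using loc[OF m] by blast
    then have h: "umbilical_normal m (h m)" using m by blast
    have "S m \<subseteq> {0}" using screen_facts(2)[OF m] n dim_eq_0 by metis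
    show ?thesis
      unfolding umbilical_normal_def
    proof (intro conjI allI impI ballI)
      fix P X Y
      assume P: "integral_manifold A M n S P \<and> m \<in> P \<and> smooth_tangent_field A P X \<and> smooth_tangent_field A P Y"
      then have "X m \<in> S m" using integral_manifold_facts(2)[of P m] by (auto simp: smooth_tangent_field_def)
      then have "X m = 0" using \<open>S m \<subseteq> {0}\<close> by blast
      moreover have "second_fundamental_form A g D P X Y m = g m (X m) (Y m) *\<^sub>R h m"
        using h P unfolding umbilical_normal_def by blast
      ultimately show "second_fundamental_form A g D P X Y m = g m (X m) (Y m) *\<^sub>R 0" by (simp add: g_simps)
    qed (simp add: g_simps)
  qed
  have H_local: "\<exists>W H'. open W \<and> p \<in> W \<and> smooth_field A W H' \<and> (\<forall>m\<in>M \<inter> W. H' m = H m)"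
    and H_normal: "umbilical_normal p (H p)" if p: "p \<in> M" for p
  proof -
    obtain W H' where W: "open W" "p \<in> W" "smooth_field A W H'" "\<And>m. m \<in> M \<inter> W \<Longrightarrow> umbilical_normal m (H' m)"
      using loc[OF p] by blast
    have eq: "H' m = H m" if "n > 0" "m \<in> M \<inter> W" for m
      using that umbilical_normal_unique[OF int _ that(1) W(4)[OF that(2)]] someI[of "umbilical_normal m", OF W(4)[OF that(2)]]
      by (simp add: H_def)
    show "umbilical_normal p (H p)"
      using zero[OF _ p] eq[of p] W(2) W(4)[of p] p by (cases "n = 0") (auto simp: H_def)
    \<comment> \<open>For \<open>n = 0\<close> a smooth extension of \<open>H = 0\<close> is needed;
      a zero multiple of \<open>H'\<close> provides it.\<close>
    have "smooth_field A W (\<lambda>m. 0 *\<^sub>R H' m)"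
      by (rule smooth_field_scaleR[OF W(1) smooth_fun_const[OF W(1)] W(3)])
    then show "\<exists>W H'. open W \<and> p \<in> W \<and> smooth_field A W H' \<and> (\<forall>m\<in>M \<inter> W. H' m = H m)"
      using eq W(1-3) by (cases "n = 0") (auto simp: H_def)
  qed
  have "nondegenerate_submanifold A g n P \<and> umbilical_with A g D P H"
    if P: "integral_manifold A M n S P" for P
  proof
    note PM = integral_manifold_facts[OF P]
    show "nondegenerate_submanifold A g n P"
      unfolding nondegenerate_submanifold_def
    proof
      show "submanifold A n P" using P by (simp add: integral_manifold_def)
      show "\<forall>p\<in>P. nondegenerate_on (g p) (tangent_space A P p)"
      proof
        fix p assume "p \<in> P"
        then show "nondegenerate_on (g p) (tangent_space A P p)"
          using PM(1) screen_facts(4)[of p] unfolding PM(2)[OF \<open>p \<in> P\<close>] by blast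
      qed
    qed
    have "smooth_field_along A P H"
      unfolding smooth_field_along_def field_extension_def
    proof
      fix p assume "p \<in> P"
      then have "p \<in> M" using PM(1) by blast
      from H_local[OF this] obtain W H' where "open W" "p \<in> W" "smooth_field A W H'"
        and H': "\<forall>m\<in>M \<inter> W. H' m = H m"
        by (elim exE conjE)
      moreover have "\<forall>q\<in>P \<inter> W. H' q = H q" using H' PM(1) by blast
      ultimately show "\<exists>Z W. open W \<and> p \<in> W \<and> smooth_field A W Z \<and> (\<forall>q\<in>P \<inter> W. Z q = H q)"
        by (intro exI conjI)
    qed
    moreover have "H m \<in> normal_space A g P m" if "m \<in> P" for m
      using H_normal[of m] that PM by (auto simp: normal_space_def umbilical_normal_def)
    ultimately show "umbilical_with A g D P H"
      using H_normal PM(1) P unfolding umbilical_with_def umbilical_normal_def by blast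
  qed
  then show ?thesis
    using leaf_integral_manifolds[OF int L] unfolding totally_umbilical_leaf_def by blast
qed

end

context null_pair_domain
begin

text \<open>Modulo the screen, a vector is known by its products with \<open>\<xi>\<close> and
  \<open>N\<close>. As these are null with product \<open>1\<close>, coefficients are read off
  crosswise: the product with \<open>N\<close> gives the coefficient of \<open>\<xi>\<close> and
  conversely. Nondegeneracy of the screen makes the normal component unique.\<close>

lemma second_fundamental_form_eq:
  assumes P: "integral_manifold A M n S P" and p: "p \<in> P" "p \<in> U"
    and X: "smooth_tangent_field A P X" and Y: "smooth_tangent_field A P Y"
  shows "second_fundamental_form A g D P X Y p =
    C p (X p) (Y p) *\<^sub>R \<xi> p + B p (X p) (Y p) *\<^sub>R N p"
proof -
  note PM = integral_manifold_facts[OF P]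
  note pM = U_subset[OF p(2)]
  obtain Z where Z: "field_extension A P Y p Z"
    using Y p(1) unfolding smooth_tangent_field_def smooth_field_along_def by blast
  then obtain W where W: "open W" "p \<in> W" "smooth_field A W Z" "\<And>m. m \<in> P \<inter> W \<Longrightarrow> Z m = Y m"
    unfolding field_extension_def by blast
  have v: "X p \<in> tangent_space A P p" using X p(1) by (simp add: smooth_tangent_field_def)
  define d where "d = D p (X p) Z"
  have cov: "cov_along A D P p (X p) Y = d" unfolding d_def by (rule cov_along_eq[OF Z v])
  have ZS: "Z m \<in> S m" if "m \<in> P \<inter> W" for m
    using W(4)[OF that] Y that PM(2) by (auto simp: smooth_tangent_field_def)
  have Zp: "Z p = Y p" using W(2,4) p(1) by blast
  have "g p d (\<xi> p) = B p (X p) (Y p)"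
    unfolding d_def Zp[symmetric]
    by (rule D_xi[OF p(2) PM(1) v W(1-3)]) (use ZS PM(1) screen_facts(3) in blast)
  moreover have "g p d (N p) = C p (X p) (Y p)"
    unfolding d_def Zp[symmetric] by (rule D_N[OF p(2) PM(1) v W(1-3) ZS])
  ultimately have diff: "d - (C p (X p) (Y p) *\<^sub>R \<xi> p + B p (X p) (Y p) *\<^sub>R N p) \<in> S p"
    unfolding screen_eq[OF p(2)] tangent_eq[OF p(2)]
    by (simp add: g_simps pair_facts(3-5)[OF p(2)] xi_facts(2)[OF p(2)])
  have normal: "normal_space A g P p = {v. \<forall>w\<in>S p. g p v w = 0}"
    using PM(2)[OF p(1)] by (simp add: normal_space_def)
  have \<xi>S: "g p (\<xi> p) w = 0" if "w \<in> S p" for w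
    using xi_facts(4)[OF p(2)] that screen_facts(3)[OF pM] by blast
  show ?thesis
    unfolding second_fundamental_form_def cov normal PM(2)[OF p(1)]
  proof (rule the_equality)
    show "C p (X p) (Y p) *\<^sub>R \<xi> p + B p (X p) (Y p) *\<^sub>R N p \<in> {v. \<forall>w\<in>S p. g p v w = 0} \<and>
        d - (C p (X p) (Y p) *\<^sub>R \<xi> p + B p (X p) (Y p) *\<^sub>R N p) \<in> S p"
      using diff by (simp add: g_simps \<xi>S pair_facts(6)[OF p(2)])
    fix w assume w: "w \<in> {v. \<forall>w\<in>S p. g p v w = 0} \<and> d - w \<in> S p"
    let ?w = "C p (X p) (Y p) *\<^sub>R \<xi> p + B p (X p) (Y p) *\<^sub>R N p"
    have "w - ?w \<in> S p"
      using subspace_diff[OF screen_facts(1)[OF pM] diff conjunct2[OF w]] by (simp add: algebra_simps)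
    moreover have "g p (w - ?w) s = 0" if "s \<in> S p" for s
      using w that by (simp add: g_simps \<xi>S pair_facts(6)[OF p(2)])
    ultimately have "w - ?w = 0" using screen_facts(4)[OF pM] unfolding nondegenerate_on_def by blast
    then show "w = ?w" by simp
  qed
qed

text \<open>Both \<open>B\<close> and \<open>g\<close> ignore multiples of \<open>\<xi>\<close> in
  either argument, so only the screen parts such as \<open>v - g p v (N p) *\<^sub>R \<xi> p\<close>
  count.\<close>

lemma umbilical_screen_imp_tangent:
  assumes p: "p \<in> U" and b: "\<And>v w. v \<in> S p \<Longrightarrow> w \<in> S p \<Longrightarrow> B p v w = b * g p v w"
    and v: "v \<in> tangent_space A M p" and w: "w \<in> tangent_space A M p"
  shows "B p v w = b * g p v w"
proof -
  have decomp: "B p v w = B p (v - g p v (N p) *\<^sub>R \<xi> p) w" "B p v w = B p v (w - g p w (N p) *\<^sub>R \<xi> p)"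
    if vw: "v \<in> tangent_space A M p" "w \<in> tangent_space A M p" for v w
  proof -
    have r: "B p v (w - k *\<^sub>R \<xi> p) = B p v w" if "v \<in> tangent_space A M p" for v w k
      using B_linear[OF p, of v 1 w "- k" "\<xi> p"] B_xi(1)[OF p that] by simp
    show "B p v w = B p v (w - g p w (N p) *\<^sub>R \<xi> p)" using r[OF vw(1)] by simp
    have "v - g p v (N p) *\<^sub>R \<xi> p \<in> tangent_space A M p"
      using screen_part[OF p vw(1)] screen_facts(3)[OF U_subset[OF p]] by blast
    then show "B p v w = B p (v - g p v (N p) *\<^sub>R \<xi> p) w"
      using r[OF vw(2), of v "g p v (N p)"] B_sym[OF p _ vw(2)] vw(1) by simp
  qed
  let ?v = "v - g p v (N p) *\<^sub>R \<xi> p" and ?w = "w - g p w (N p) *\<^sub>R \<xi> p"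
  have vT: "?v \<in> tangent_space A M p"
    using screen_part[OF p v] screen_facts(3)[OF U_subset[OF p]] by blast
  have "B p v w = B p ?v ?w" using decomp(1)[OF v w] decomp(2)[OF vT w] by simp
  also have "\<dots> = b * g p ?v ?w" by (rule b[OF screen_part[OF p v] screen_part[OF p w]])
  also have "g p ?v ?w = g p v w" using xi_facts[OF p] v w by (simp add: g_simps)
  finally show ?thesis .
qed

text \<open>Total umbilicity is phrased for tangent fields on the whole domain of a null pair, but
  prescribed vectors are extended only near a point. Since the definition covers every domain, it is
  applied to the restricted pair on \<open>U \<inter> W\<close>, where fields with constant slice
  components exist.\<close>

lemma umbilical_coefficient_local:
  assumes umb: "totally_umbilical_null A g D M S" and p: "p \<in> U"
  obtains W \<beta> where "open W" "p \<in> W" "smooth_fun_along A (U \<inter> W) \<beta>"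
    "\<And>m v w. m \<in> U \<inter> W \<Longrightarrow> v \<in> S m \<Longrightarrow> w \<in> S m \<Longrightarrow> B m v w = \<beta> m * g m v w"
proof -
  obtain W F where W: "open W" "p \<in> W" and F: "\<And>m v. smooth_field A W (F m v)" "\<And>m v. m \<in> W \<Longrightarrow> F m v m = v"
    "\<And>m v m'. m \<in> M \<inter> W \<Longrightarrow> v \<in> tangent_space A M m \<Longrightarrow> m' \<in> M \<inter> W \<Longrightarrow> F m v m' \<in> tangent_space A M m'"
    by (rule tangent_fields[OF U_subset[OF p]]) blast
  have "null_pair A g M S (U \<inter> W) \<xi> N"
    unfolding null_pair_def
  proof (intro conjI)
    show "openin (top_of_set M) (U \<inter> W)" using pair W(1) by (simp add: null_pair_def openin_Int_open)
    show "smooth_field_along A (U \<inter> W) \<xi>" "smooth_field_along A (U \<inter> W) N"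
      using pair smooth_field_along_subset[of A U _ "U \<inter> W"] by (simp_all add: null_pair_def)
  qed (use pair in \<open>simp add: null_pair_def\<close>)
  then interpret R: null_pair_domain A g D q M S n "U \<inter> W" \<xi> N by unfold_locales
  obtain \<beta> where \<beta>: "smooth_fun_along A (U \<inter> W) \<beta>"
    "\<And>X Y m. smooth_tangent_field A (U \<inter> W) X \<Longrightarrow> smooth_tangent_field A (U \<inter> W) Y \<Longrightarrow> m \<in> U \<inter> W \<Longrightarrow>
      gauss_B A D (U \<inter> W) N m (X m) Y = \<beta> m * g m (X m) (Y m)"
    using umb R.pair unfolding totally_umbilical_null_def by blast
  show ?thesis
  proof (rule that[OF W \<beta>(1)])
    fix m v w assume m: "m \<in> U \<inter> W" and "v \<in> S m" "w \<in> S m"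
    then have vw: "v \<in> tangent_space A M m" "w \<in> tangent_space A M m" and mU: "m \<in> U" "m \<in> M \<inter> W"
      using screen_facts(3)[of m] U_subset[of m] by auto
    have tangent: "smooth_tangent_field A (U \<inter> W) (F m v)" if v: "v \<in> tangent_space A M m" for v
      using F(1)[of m v] F(3)[OF mU(2) v] W(1) R.tangent_U U_subset
      unfolding smooth_tangent_field_def smooth_field_along_def field_extension_def by blast
    have mW: "m \<in> W" using m by blast
    have "R.B m v w = \<beta> m * g m v w"
      using \<beta>(2)[OF tangent[OF vw(1)] tangent[OF vw(2)] m] R.gauss_B_eq[OF m vw(1) tangent[OF vw(2)]]
      by (simp add: F(2)[OF mW])
    \<comment> \<open>Extensions along \<open>U\<close> are also extensions along
      \<open>U \<inter> W\<close>, so both domains have the same form \<open>B\<close>.\<close>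
    moreover have "R.B m v w = B m v w"
    proof -
      obtain \<Xi> where e: "field_extension A U \<xi> m \<Xi>"
        using pair mU(1) unfolding null_pair_def smooth_field_along_def by blast
      then have "cov_along A D U m v \<xi> = D m v \<Xi>"
        by (rule cov_along_eq) (use vw(1) tangent_U[OF mU(1)] in simp)
      moreover have "cov_along A D (U \<inter> W) m v \<xi> = D m v \<Xi>"
        by (rule cov_along_eq[OF field_extension_subset[OF e]]) (use vw(1) R.tangent_U[OF m] in auto)
      ultimately show ?thesis by (simp add: B_def R.B_def)
    qed
    ultimately show "B m v w = \<beta> m * g m v w" by simp
  qed
qed

text \<open>All ingredients of \<open>(\<phi> \<beta> + \<psi>) \<xi> + \<beta> N\<close> extend
  smoothly to a common neighbourhood; the same combination of the extensions is the required
  \<open>H\<close>.\<close>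

lemma umbilical_normal_local:
  assumes qc: "screen_quasi_conformal_on A g D M S U \<xi> N \<phi> \<psi>"
    and umb: "totally_umbilical_null A g D M S" and p: "p \<in> U"
  shows "\<exists>W H. open W \<and> p \<in> W \<and> smooth_field A W H \<and> (\<forall>m\<in>M \<inter> W. umbilical_normal m (H m))"
proof -
  obtain W1 \<beta> where W1: "open W1" "p \<in> W1" and \<beta>: "smooth_fun_along A (U \<inter> W1) \<beta>"
    "\<And>m v w. m \<in> U \<inter> W1 \<Longrightarrow> v \<in> S m \<Longrightarrow> w \<in> S m \<Longrightarrow> B m v w = \<beta> m * g m v w"
    using umbilical_coefficient_local[OF umb p] by metis
  obtain W2 \<Xi> \<nu> where W2: "open W2" "p \<in> W2" "smooth_field A W2 \<Xi>" "smooth_field A W2 \<nu>"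
    "\<And>m. m \<in> M \<inter> W2 \<Longrightarrow> m \<in> U \<and> \<Xi> m = \<xi> m \<and> \<nu> m = N m"
    using extension[OF p] by metis
  obtain W3 b where W3: "open W3" "p \<in> W3" "smooth_fun A W3 b" "\<And>m. m \<in> (U \<inter> W1) \<inter> W3 \<Longrightarrow> b m = \<beta> m"
    using bspec[OF \<beta>(1)[unfolded smooth_fun_along_def], of p] p W1(2) by blast
  have \<phi>: "smooth_fun_along A U \<phi>" and \<psi>: "smooth_fun_along A U \<psi>"
    using qc by (simp_all add: screen_quasi_conformal_on_def)
  obtain W4 f where W4: "open W4" "p \<in> W4" "smooth_fun A W4 f" "\<And>m. m \<in> U \<inter> W4 \<Longrightarrow> f m = \<phi> m"
    using bspec[OF \<phi>[unfolded smooth_fun_along_def] p] by blast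
  obtain W5 h where W5: "open W5" "p \<in> W5" "smooth_fun A W5 h" "\<And>m. m \<in> U \<inter> W5 \<Longrightarrow> h m = \<psi> m"
    using bspec[OF \<psi>[unfolded smooth_fun_along_def] p] by blast
  define W where "W = W1 \<inter> W2 \<inter> W3 \<inter> W4 \<inter> W5"
  define H where "H m = (f m * b m + h m) *\<^sub>R \<Xi> m + b m *\<^sub>R \<nu> m" for m
  have W: "open W" "p \<in> W" unfolding W_def using W1 W2 W3 W4 W5 by auto
  have s: "smooth_field A W \<Xi>" "smooth_field A W \<nu>" "smooth_fun A W b" "smooth_fun A W f" "smooth_fun A W h"
    using smooth_field_subset[OF W2(3), of W] smooth_field_subset[OF W2(4), of W] smooth_fun_subset[OF W3(3), of W]
      smooth_fun_subset[OF W4(3), of W] smooth_fun_subset[OF W5(3), of W] by (auto simp: W_def)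
  have "smooth_field A W H"
    unfolding H_def by (intro smooth_field_add smooth_field_scaleR smooth_fun_add smooth_fun_mult s W(1))
  moreover have "umbilical_normal m (H m)" if m: "m \<in> M \<inter> W" for m
  proof -
    have mU: "m \<in> U" and eq: "\<Xi> m = \<xi> m" "\<nu> m = N m" using W2(5)[of m] m by (auto simp: W_def)
    have mW: "m \<in> U \<inter> W1" "m \<in> (U \<inter> W1) \<inter> W3" "m \<in> U \<inter> W4" "m \<in> U \<inter> W5" using m mU by (auto simp: W_def)
    have H: "H m = (\<phi> m * \<beta> m + \<psi> m) *\<^sub>R \<xi> m + \<beta> m *\<^sub>R N m"
      using W3(4)[OF mW(2)] W4(4)[OF mW(3)] W5(4)[OF mW(4)] by (simp add: H_def eq)
    have "g m (H m) w = 0" if "w \<in> S m" for w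
      using xi_facts(4)[OF mU] pair_facts(6)[OF mU that] that screen_facts(3)[OF U_subset[OF mU]]
      by (auto simp: H g_simps)
    moreover have "second_fundamental_form A g D P X Y m = g m (X m) (Y m) *\<^sub>R H m"
      if P: "integral_manifold A M n S P" "m \<in> P" "smooth_tangent_field A P X" "smooth_tangent_field A P Y" for P X Y
    proof -
      have XY: "X m \<in> S m" "Y m \<in> S m"
        using P integral_manifold_facts(2)[OF P(1)] by (auto simp: smooth_tangent_field_def)
      show ?thesis
        unfolding second_fundamental_form_eq[OF P(1,2) mU P(3,4)] quasi_conformal_C[OF qc mU XY] \<beta>(2)[OF mW(1) XY] H
        by (simp add: algebra_simps)
    qed
    ultimately show ?thesis unfolding umbilical_normal_def by blast
  qed
  ultimately show ?thesis using W by blast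
qed

text \<open>The factor \<open>\<beta>\<close> is first chosen point by point. For
  \<open>n > 0\<close> it is smooth because near each point it equals a quotient with denominator
  \<open>g(X, X)\<close> for a non-null screen field \<open>X\<close>.\<close>

lemma umbilical_leaves_imp_umbilical:
  assumes int: "locally_integrable"
    and leaves: "\<And>L. leaf A M n S L \<Longrightarrow> totally_umbilical_leaf A g D M n S L"
  shows "\<exists>\<beta>. smooth_fun_along A U \<beta> \<and> (\<forall>X Y. smooth_tangent_field A U X \<and> smooth_tangent_field A U Y \<longrightarrow>
    (\<forall>p\<in>U. gauss_B A D U N p (X p) Y = \<beta> p * g p (X p) (Y p)))"
proof -
  have ex: "\<exists>b. \<forall>v\<in>S p. \<forall>w\<in>S p. B p v w = b * g p v w" if p: "p \<in> U" for p
  proof -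
    note pM = U_subset[OF p]
    obtain P where P: "integral_manifold A M n S P" "p \<in> P"
      and fields: "\<And>v. v \<in> S p \<Longrightarrow> \<exists>X. smooth_tangent_field A P X \<and> X p = v"
      using locally_integrableE[OF int pM] by metis
    obtain L where L: "leaf A M n S L" "P \<subseteq> L" using leaf_through[OF pM] P by metis
    obtain H where "umbilical_with A g D P H"
      using leaves[OF L(1)] P(1) L(2) unfolding totally_umbilical_leaf_def by blast
    then have H: "second_fundamental_form A g D P X Y p = g p (X p) (Y p) *\<^sub>R H p"
      if "smooth_tangent_field A P X" "smooth_tangent_field A P Y" for X Y
      using that P(2) unfolding umbilical_with_def by blast
    have "B p v w = g p (H p) (\<xi> p) * g p v w" if v: "v \<in> S p" and w: "w \<in> S p" for v w
    proof -
      obtain X Y where XY: "smooth_tangent_field A P X" "X p = v" "smooth_tangent_field A P Y" "Y p = w"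
        using fields[OF v] fields[OF w] by blast
      have "g p v w *\<^sub>R H p = C p v w *\<^sub>R \<xi> p + B p v w *\<^sub>R N p"
        using H[OF XY(1,3)] second_fundamental_form_eq[OF P p XY(1,3)] XY(2,4) by simp
      \<comment> \<open>The product with \<open>\<xi>\<close> removes the \<open>\<xi>\<close>-term
        and leaves the coefficient of \<open>N\<close>.\<close>
      from arg_cong[OF this, of "\<lambda>x. g p x (\<xi> p)"] show ?thesis
        by (simp add: g_simps xi_facts(2)[OF p] pair_facts(4)[OF p] mult.commute)
    qed
    then show ?thesis by blast
  qed
  \<comment> \<open>For \<open>n = 0\<close> every number satisfies the condition, and an arbitrary
    choice need not be smooth; hence the value \<open>0\<close>.\<close>
  define \<beta> where "\<beta> p = (if n = 0 then 0 else (SOME b. \<forall>v\<in>S p. \<forall>w\<in>S p. B p v w = b * g p v w))" for p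
  have \<beta>: "B p v w = \<beta> p * g p v w" if p: "p \<in> U" and vw: "v \<in> S p" "w \<in> S p" for p v w
  proof (cases "n = 0")
    case True
    then have "S p \<subseteq> {0}" using screen_facts(2)[OF U_subset[OF p]] dim_eq_0 by metis
    then have "w = 0" using vw by blast
    then show ?thesis by (simp add: B_def g_simps)
  next
    case False
    have "\<forall>v\<in>S p. \<forall>w\<in>S p. B p v w = (SOME b. \<forall>v\<in>S p. \<forall>w\<in>S p. B p v w = b * g p v w) * g p v w"
      by (rule someI_ex[OF ex[OF p]])
    then have "B p v w = (SOME b. \<forall>v\<in>S p. \<forall>w\<in>S p. B p v w = b * g p v w) * g p v w"
      using vw by blast
    then show ?thesis using False by (simp only: \<beta>_def if_False)
  qed
  have "smooth_fun_along A U \<beta>"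
    unfolding smooth_fun_along_def
  proof
    fix p assume p: "p \<in> U"
    show "\<exists>W F. open W \<and> p \<in> W \<and> smooth_fun A W F \<and> (\<forall>q\<in>U \<inter> W. F q = \<beta> q)"
    proof (cases "n = 0")
      case True
      then show ?thesis using smooth_fun_const[of UNIV 0] by (intro exI[of _ UNIV] exI[of _ "\<lambda>_. 0"]) (simp add: \<beta>_def)
    next
      case False
      then obtain v where v: "v \<in> S p" "g p v v \<noteq> 0"
        using screen_nonnull_vector[OF U_subset[OF p]] by blast
      obtain W1 X where X: "open W1" "p \<in> W1" "smooth_field A W1 X" "X p = v" "\<And>m. m \<in> M \<inter> W1 \<Longrightarrow> X m \<in> S m"
        using int U_subset[OF p] v(1) unfolding locally_integrable_def by (meson subsetD)
      obtain W2 \<Xi> \<nu> where W2: "open W2" "p \<in> W2" "smooth_field A W2 \<Xi>"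
        "\<And>m. m \<in> M \<inter> W2 \<Longrightarrow> m \<in> U \<and> \<Xi> m = \<xi> m \<and> \<nu> m = N m"
        using extension[OF p] by metis
      define W3 where "W3 = {m \<in> W1 \<inter> W2. g m (X m) (X m) \<noteq> 0}"
      have W12: "open (W1 \<inter> W2)" using X(1) W2(1) by blast
      have s: "smooth_field A (W1 \<inter> W2) X" "smooth_field A (W1 \<inter> W2) \<Xi>"
        using smooth_field_subset[OF X(3)] smooth_field_subset[OF W2(3)] by auto
      have W3: "open W3" "W3 \<subseteq> W1 \<inter> W2"
        unfolding W3_def using open_smooth_fun_nonzero[OF W12 smooth_g[OF W12 s(1,1)]] by auto
      note s3 = smooth_field_subset[OF s(1) W3(2)] smooth_field_subset[OF s(2) W3(2)]
      \<comment> \<open>Along \<open>M\<close> the numerator is \<open>B(X, X)\<close>, so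
        \<open>F\<close> extends \<open>\<beta>\<close>. It is smooth on all of \<open>W3\<close>,
        being built from fields defined there.\<close>
      define F where "F m = g m (D m (X m) X) (\<Xi> m) / g m (X m) (X m)" for m
      have "smooth_fun A W3 F"
        unfolding F_def
        by (intro smooth_fun_divide smooth_g D_smooth s3 W3(1)) (simp add: W3_def)
      moreover have "F m = \<beta> m" if m: "m \<in> U \<inter> W3" for m
      proof -
        have mM: "m \<in> M" "m \<in> W1" "m \<in> W2" "m \<in> U" using m U_subset W3(2) by auto
        have XS: "X m \<in> S m" using X(5) mM by blast
        have XT: "X m' \<in> tangent_space A M m'" if "m' \<in> M \<inter> W1" for m'
          using X(5)[OF that] screen_facts(3) that by blast
        have "g m (D m (X m) X) (\<xi> m) = B m (X m) (X m)"
          by (rule D_xi[OF mM(4) order_refl _ X(1) mM(2) X(3) XT]) (use XT mM in auto)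
        also have "\<dots> = \<beta> m * g m (X m) (X m)" by (rule \<beta>[OF mM(4) XS XS])
        finally show ?thesis using m W2(4)[of m] mM by (simp add: F_def W3_def)
      qed
      moreover have "p \<in> W3" using X(2,4) W2(2) v(2) by (simp add: W3_def)
      ultimately show ?thesis using W3(1) by blast
    qed
  qed
  moreover have "gauss_B A D U N p (X p) Y = \<beta> p * g p (X p) (Y p)"
    if "smooth_tangent_field A U X" "smooth_tangent_field A U Y" and p: "p \<in> U" for X Y p
  proof -
    have XY: "X p \<in> tangent_space A M p" "Y p \<in> tangent_space A M p"
      using that tangent_U[OF p] by (auto simp: smooth_tangent_field_def)
    show ?thesis
      unfolding gauss_B_eq[OF p XY(1) that(2)]
      by (rule umbilical_screen_imp_tangent[OF p \<beta>[OF p] XY])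
  qed
  ultimately show ?thesis by blast
qed

end

theorem theorem3p6:
  fixes A :: "('m::{t2_space, second_countable_topology}, 'e::euclidean_space) chart set"
    and g :: "'m \<Rightarrow> 'e \<Rightarrow> 'e \<Rightarrow> real"
    and D :: "'m \<Rightarrow> 'e \<Rightarrow> ('m \<Rightarrow> 'e) \<Rightarrow> 'e"
    and M :: "'m set"
    and S :: "'m \<Rightarrow> 'e set"
    and I :: "'i set"
    and U :: "'i \<Rightarrow> 'm set"
    and \<xi> N :: "'i \<Rightarrow> 'm \<Rightarrow> 'e"
    and \<phi> \<psi> :: "'i \<Rightarrow> 'm \<Rightarrow> real"
    and n q :: nat
  assumes "DIM('e) = n + 2"
    and "q \<in> {1..n + 1}"
    and "smooth_atlas A"
    and "semi_riemannian_metric A g q"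
    and "levi_civita A g D"
    and "null_hypersurface A g M"
    and "screen_distribution A g M S"
    and "M = (\<Union>i\<in>I. U i)"
    and "\<And>i. i \<in> I \<Longrightarrow> screen_quasi_conformal_on A g D M S (U i) (\<xi> i) (N i) (\<phi> i) (\<psi> i)"
    and "\<exists>i\<in>I. \<exists>p\<in>U i. \<psi> i p \<noteq> 0"
  shows "integrable_distribution A M n S \<and>
    (totally_umbilical_null A g D M S \<longleftrightarrow>
      (\<forall>L. leaf A M n S L \<longrightarrow> totally_umbilical_leaf A g D M n S L))"
proof -
  interpret null_hypersurface_with_screen A g D q M S n
    by unfold_locales (rule assms(1) assms(3) assms(4) assms(5) assms(6) assms(7))+
  have qc: "screen_quasi_conformal_on A g D M S (U i) (\<xi> i) (N i) (\<phi> i) (\<psi> i)" if "i \<in> I" for i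
    by (rule assms(9)[OF that])
  have pair: "null_pair_domain A g D q M S n (U i) (\<xi> i) (N i)" if "i \<in> I" for i
    by unfold_locales (use qc[OF that] in \<open>simp add: screen_quasi_conformal_on_def\<close>)
  have int: locally_integrable
    unfolding locally_integrable_def
  proof
    fix p assume "p \<in> M"
    then obtain i where i: "i \<in> I" "p \<in> U i" using assms(8) by blast
    interpret P: null_pair_domain A g D q M S n "U i" "\<xi> i" "N i" by (rule pair[OF i(1)])
    have "P.C m v w = P.C m w v" if m: "m \<in> U i" and vw: "v \<in> S m" "w \<in> S m" for m v w
    proof -
      have "v \<in> tangent_space A M m" "w \<in> tangent_space A M m"
        using vw screen_facts(3)[OF P.U_subset[OF m]] by blast+
      then show ?thesis
        using P.quasi_conformal_C[OF qc[OF i(1)] m vw] P.quasi_conformal_C[OF qc[OF i(1)] m vw(2,1)]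
          P.B_sym[OF m, of v w] g_sym[of m v w] by simp
    qed
    then obtain P W where "integral_manifold A M n S P" "p \<in> P" "open W" "P \<subseteq> W"
      "\<And>v. v \<in> S p \<Longrightarrow> \<exists>X. smooth_field A W X \<and> X p = v \<and> (\<forall>m\<in>M \<inter> W. X m \<in> S m)"
      using P.screen_integral_manifold[OF _ i(2)] by metis
    then show "\<exists>P W. integral_manifold A M n S P \<and> p \<in> P \<and> open W \<and> P \<subseteq> W \<and>
        (\<forall>v\<in>S p. \<exists>X. smooth_field A W X \<and> X p = v \<and> (\<forall>m\<in>M \<inter> W. X m \<in> S m))"
      by blast
  qed
  then have "integrable_distribution A M n S"
    unfolding integrable_distribution_def locally_integrable_def by blast
  moreover have "totally_umbilical_leaf A g D M n S L"
    if umb: "totally_umbilical_null A g D M S" and L: "leaf A M n S L" for L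
  proof (rule leaves_totally_umbilical[OF int _ L])
    fix p assume "p \<in> M"
    then obtain i where i: "i \<in> I" "p \<in> U i" using assms(8) by blast
    show "\<exists>W H. open W \<and> p \<in> W \<and> smooth_field A W H \<and> (\<forall>m\<in>M \<inter> W. umbilical_normal m (H m))"
      by (rule null_pair_domain.umbilical_normal_local[OF pair[OF i(1)] qc[OF i(1)] umb i(2)])
  qed
  moreover have "totally_umbilical_null A g D M S"
    if leaves: "\<And>L. leaf A M n S L \<Longrightarrow> totally_umbilical_leaf A g D M n S L"
    unfolding totally_umbilical_null_def
  proof (intro allI impI)
    \<comment> \<open>This null pair is arbitrary and need not come from the covering family;
      integral manifolds and screen fields reach it through \<open>int\<close>.\<close>
    fix U \<xi> N assume "null_pair A g M S U \<xi> N"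
    then interpret Q: null_pair_domain A g D q M S n U \<xi> N
      by (intro null_pair_domain.intro null_pair_domain_axioms.intro null_hypersurface_with_screen_axioms)
    show "\<exists>\<beta>. smooth_fun_along A U \<beta> \<and> (\<forall>X Y. smooth_tangent_field A U X \<and> smooth_tangent_field A U Y \<longrightarrow>
        (\<forall>p\<in>U. gauss_B A D U N p (X p) Y = \<beta> p * g p (X p) (Y p)))"
      by (rule Q.umbilical_leaves_imp_umbilical[OF int leaves])
  qed
  ultimately show ?thesis by blast
qed

end
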